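(* The structures of types (I)–(VI) described in the context are unique in the following sense. (1) Groups of different types (I)–(VI) cannot be isomorphic. (2) Suppose a finite group $G$ has one of the types (I)–(VI) with respect to some subgroups $A$, $B$ (and whichever of $T$, $Q_8$, $\Theta$, $\Phi$ and $2A_5$ are relevant), and also has that type with respect to some subgroups $A^*$, $B^*$ (and $T^*$, $Q_8^*$, $\Theta^*$, $\Phi^*$ and $2A_5^*$, when relevant). Then some (single) element of $G$ conjugates every unstarred subgroup to the corresponding starred subgroup. In particular, $A^*=A$ (and $Q_8^*=Q_8$ and $2A_5^*=2A_5$, when relevant).
   Context: Notation: $N:K$ means that the group has normal subgroup $N$ and a subgroup $K$ that is a complement to $N$ (internal semidirect product). $X\times Y$ is an internal direct product of subgroups. $H\cdot 2$ means a group having $H$ as a normal subgroup with quotient $\mathbb{Z}/2$, the extension being nonsplit. Actions are by conjugation in $G$. An automorphism is called outer if it is not inner. A quaternionic group is one of the groups $Q_{2^m}=\langle x,y\mid x^{2^{m-1}}=1,\ yxy^{-1}=x^{-1},\ y^2=x^{2^{m-2}}\rangle$, $m\ge 3$. $2A_5$ is the binary icosahedral group $\mathrm{SL}_2(\mathbb{F}_5)$. In the structures below the symbols $Q_8$ and $2A_5$ denote subgroups of $G$ isomorphic to these groups. Structures. In every case $A$ and $B$ are cyclic subgroups of $G$ whose orders are odd and coprime, every nontrivial Sylow subgroup of $B$ acts nontrivially on $A$, and every prime-order element of $B$ acts trivially on $A$. (I) $G=A:(B\times T)$ with $T$ a cyclic $2$-group, such that if $T\ne1$ then its involution fixes $A$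 pointwise. (II) $G=A:(B\times T)$ with $T$ a quaternionic group. (III) $G=(Q_8\times A):(\Theta\times B)$, where $\Theta$ is a cyclic $3$-group which acts nontrivially on $Q_8$ and whose elements of order $3$ centralize $A$, and $|A|$, $|B|$ are prime to $3$. (IV) $G=\bigl((Q_8\times A):(\Theta\times B)\bigr)\cdot2$, where $\Theta$, $|A|$, $|B|$ are as in (III), and the quotient $\mathbb{Z}/2$ is the image of a subgroup $\Phi\cong\mathbb{Z}/4$ of $G$ whose elements of order $4$ act by an outer automorphism on $Q_8$, by inversion on $\Theta$ and trivially on $B$. (V) $G=2A_5\times(A:B)$, where $|A|$, $|B|$ are prime to $15$. (VI) $G=\bigl(2A_5\times(A:B)\bigr)\cdot2$, where $|A|$, $|B|$ are prime to $15$, and the quotient $\mathbb{Z}/2$ is the image of a subgroup $\Phi\cong\mathbb{Z}/4$ of $G$ whose elements of order $4$ act by an outer automorphism on $2A_5$ and trivially on $B$. *)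

theory Defs
  imports "HOL-Analysis.Determinants" "HOL-Algebra.Algebra"
begin

text \<open>
  A subgroup \<open>H\<close> of \<open>G\<close> is a set; the group it forms is \<open>G\<lparr>carrier := H\<rparr>\<close>.
\<close>

definition internal_semidirect :: "('a, 'b) monoid_scheme \<Rightarrow> 'a set \<Rightarrow> 'a set \<Rightarrow> bool" where
  "internal_semidirect G N K \<longleftrightarrow>
     N \<lhd> G \<and> subgroup K G \<and> N <#>\<^bsub>G\<^esub> K = carrier G \<and> N \<inter> K = {\<one>\<^bsub>G\<^esub>}"

definition internal_direct :: "('a, 'b) monoid_scheme \<Rightarrow> 'a set \<Rightarrow> 'a set \<Rightarrow> bool" where
  "internal_direct G H K \<longleftrightarrow>
     H \<lhd> G \<and> K \<lhd> G \<and> H <#>\<^bsub>G\<^esub> K = carrier G \<and> H \<inter> K = {\<one>\<^bsub>G\<^esub>}"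

text \<open>\<open>G = H\<cdot>2\<close>: the extension of \<open>\<int>/2\<close> by \<open>H\<close> is nonsplit, i.e. \<open>H\<close> has no complement.\<close>

definition nonsplit_ext_by_2 :: "('a, 'b) monoid_scheme \<Rightarrow> 'a set \<Rightarrow> bool" where
  "nonsplit_ext_by_2 G H \<longleftrightarrow>
     H \<lhd> G \<and> G Mod H \<cong> integer_mod_group 2 \<and> \<not> (\<exists>K. internal_semidirect G H K)"

definition sylow_subgroup :: "nat \<Rightarrow> ('a, 'b) monoid_scheme \<Rightarrow> 'a set \<Rightarrow> bool" where
  "sylow_subgroup p G P \<longleftrightarrow> subgroup P G \<and> card P = p ^ multiplicity p (order G)"

definition conj_map :: "('a, 'b) monoid_scheme \<Rightarrow> 'a \<Rightarrow> 'a set \<Rightarrow> 'a \<Rightarrow> 'a" where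
  "conj_map G g H = (\<lambda>h\<in>H. g \<otimes>\<^bsub>G\<^esub> h \<otimes>\<^bsub>G\<^esub> inv\<^bsub>G\<^esub> g)"

definition conj_set :: "('a, 'b) monoid_scheme \<Rightarrow> 'a \<Rightarrow> 'a set \<Rightarrow> 'a set" where
  "conj_set G g H = conj_map G g H ` H"

definition acts_trivially :: "('a, 'b) monoid_scheme \<Rightarrow> 'a \<Rightarrow> 'a set \<Rightarrow> bool" where
  "acts_trivially G g H \<longleftrightarrow> (\<forall>h\<in>H. conj_map G g H h = h)"

definition acts_by_inversion :: "('a, 'b) monoid_scheme \<Rightarrow> 'a \<Rightarrow> 'a set \<Rightarrow> bool" where
  "acts_by_inversion G g H \<longleftrightarrow> (\<forall>h\<in>H. conj_map G g H h = inv\<^bsub>G\<^esub> h)"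

definition inner_automorphisms :: "('a, 'b) monoid_scheme \<Rightarrow> ('a \<Rightarrow> 'a) set" where
  "inner_automorphisms K = (\<lambda>k. conj_map K k (carrier K)) ` carrier K"

definition acts_by_outer :: "('a, 'b) monoid_scheme \<Rightarrow> 'a \<Rightarrow> 'a set \<Rightarrow> bool" where
  "acts_by_outer G g H \<longleftrightarrow>
     conj_map G g H \<in> auto (G\<lparr>carrier := H\<rparr>) - inner_automorphisms (G\<lparr>carrier := H\<rparr>)"

text \<open>
  Group presentations.  Words are lists of letters \<open>(g, True)\<close>, standing for the generator \<open>g\<close>,
  and \<open>(g, False)\<close>, standing for its inverse.  A relation \<open>u = v\<close> is the pair \<open>(u, v)\<close>.
\<close>

type_synonym 'g word = "('g \<times> bool) list"

inductive word_eq :: "('g word \<times> 'g word) set \<Rightarrow> 'g word \<Rightarrow> 'g word \<Rightarrow> bool"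
  for R :: "('g word \<times> 'g word) set" where
  rel: "(u, v) \<in> R \<Longrightarrow> word_eq R u v"
| cancel: "word_eq R [(g, b), (g, \<not> b)] []"
| refl: "word_eq R u u"
| sym: "word_eq R u v \<Longrightarrow> word_eq R v u"
| trans: "word_eq R u v \<Longrightarrow> word_eq R v w \<Longrightarrow> word_eq R u w"
| append: "word_eq R u v \<Longrightarrow> word_eq R u' v' \<Longrightarrow> word_eq R (u @ u') (v @ v')"

definition presented_group :: "('g word \<times> 'g word) set \<Rightarrow> 'g word set monoid" where
  "presented_group R =
     \<lparr>carrier = UNIV // {(u, v). word_eq R u v},
      mult = (\<lambda>U V. \<Union>u\<in>U. \<Union>v\<in>V. {w. word_eq R (u @ v) w}),
      one = {w. word_eq R [] w}\<rparr>"

datatype quat_gen = gen_x | gen_y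

text \<open>
  \<open>\<langle>x, y | x^(2^(m-1)) = 1, y x y^-1 = x^-1, y^2 = x^(2^(m-2))\<rangle>\<close>, used only for \<open>m \<ge> 3\<close>
\<close>

definition quaternion_group :: "nat \<Rightarrow> quat_gen word set monoid" where
  "quaternion_group m = presented_group
     {(replicate (2 ^ (m - 1)) (gen_x, True), []),
      ([(gen_y, True), (gen_x, True), (gen_y, False)], [(gen_x, False)]),
      ([(gen_y, True), (gen_y, True)], replicate (2 ^ (m - 2)) (gen_x, True))}"

definition is_quaternionic :: "('a, 'b) monoid_scheme \<Rightarrow> bool" where
  "is_quaternionic K \<longleftrightarrow> (\<exists>m\<ge>3. K \<cong> quaternion_group m)"

text \<open>The numeral type \<open>5\<close> is the ring of integers modulo 5, that is, the field with five elements.\<close>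

definition SL2_F5 :: "(5 ^ 2 ^ 2) monoid" where
  "SL2_F5 = \<lparr>carrier = {M. det M = 1}, mult = (**), one = mat 1\<rparr>"

text \<open>
  In the conditions below the parities and coprimalities also force finiteness, as infinite sets
  have cardinality 0.
\<close>

definition AB_conditions :: "('a, 'b) monoid_scheme \<Rightarrow> 'a set \<Rightarrow> 'a set \<Rightarrow> bool" where
  "AB_conditions G A B \<longleftrightarrow>
     subgroup A G \<and> subgroup B G \<and>
     cyclic_group (G\<lparr>carrier := A\<rparr>) \<and> cyclic_group (G\<lparr>carrier := B\<rparr>) \<and>
     odd (card A) \<and> odd (card B) \<and> coprime (card A) (card B) \<and>
     (\<forall>p P. Factorial_Ring.prime p \<and> sylow_subgroup p (G\<lparr>carrier := B\<rparr>) P \<and> P \<noteq> {\<one>\<^bsub>G\<^esub>} \<longrightarrow>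
        (\<exists>g\<in>P. \<not> acts_trivially G g A)) \<and>
     (\<forall>b\<in>B. Factorial_Ring.prime (group.ord G b) \<longrightarrow> acts_trivially G b A)"

definition cyclic_p_subgroup :: "nat \<Rightarrow> ('a, 'b) monoid_scheme \<Rightarrow> 'a set \<Rightarrow> bool" where
  "cyclic_p_subgroup p G T \<longleftrightarrow>
     subgroup T G \<and> cyclic_group (G\<lparr>carrier := T\<rparr>) \<and> (\<exists>k. card T = p ^ k)"

definition structure_I ::
  "('a, 'b) monoid_scheme \<Rightarrow> 'a set \<Rightarrow> 'a set \<Rightarrow> 'a set \<Rightarrow> bool" where
  "structure_I G A B T \<longleftrightarrow>
     AB_conditions G A B \<and>
     internal_semidirect G A (B <#>\<^bsub>G\<^esub> T) \<and>
     internal_direct (G\<lparr>carrier := B <#>\<^bsub>G\<^esub> T\<rparr>) B T \<and>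
     cyclic_p_subgroup 2 G T \<and>
     (\<forall>t\<in>T. group.ord G t = 2 \<longrightarrow> acts_trivially G t A)"

definition structure_II ::
  "('a, 'b) monoid_scheme \<Rightarrow> 'a set \<Rightarrow> 'a set \<Rightarrow> 'a set \<Rightarrow> bool" where
  "structure_II G A B T \<longleftrightarrow>
     AB_conditions G A B \<and>
     internal_semidirect G A (B <#>\<^bsub>G\<^esub> T) \<and>
     internal_direct (G\<lparr>carrier := B <#>\<^bsub>G\<^esub> T\<rparr>) B T \<and>
     subgroup T G \<and> is_quaternionic (G\<lparr>carrier := T\<rparr>)"

definition structure_III ::
  "('a, 'b) monoid_scheme \<Rightarrow> 'a set \<Rightarrow> 'a set \<Rightarrow> 'a set \<Rightarrow> 'a set \<Rightarrow> bool" where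
  "structure_III G A B Q \<Theta> \<longleftrightarrow>
     AB_conditions G A B \<and>
     internal_semidirect G (Q <#>\<^bsub>G\<^esub> A) (\<Theta> <#>\<^bsub>G\<^esub> B) \<and>
     internal_direct (G\<lparr>carrier := Q <#>\<^bsub>G\<^esub> A\<rparr>) Q A \<and>
     internal_direct (G\<lparr>carrier := \<Theta> <#>\<^bsub>G\<^esub> B\<rparr>) \<Theta> B \<and>
     subgroup Q G \<and> G\<lparr>carrier := Q\<rparr> \<cong> quaternion_group 3 \<and>
     cyclic_p_subgroup 3 G \<Theta> \<and>
     (\<exists>t\<in>\<Theta>. \<not> acts_trivially G t Q) \<and>
     (\<forall>t\<in>\<Theta>. group.ord G t = 3 \<longrightarrow> acts_trivially G t A) \<and>
     coprime (card A) 3 \<and> coprime (card B) 3"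

definition structure_IV ::
  "('a, 'b) monoid_scheme \<Rightarrow> 'a set \<Rightarrow> 'a set \<Rightarrow> 'a set \<Rightarrow> 'a set \<Rightarrow> 'a set \<Rightarrow> bool" where
  "structure_IV G A B Q \<Theta> \<Phi> \<longleftrightarrow>
     (let H = (Q <#>\<^bsub>G\<^esub> A) <#>\<^bsub>G\<^esub> (\<Theta> <#>\<^bsub>G\<^esub> B) in
        structure_III (G\<lparr>carrier := H\<rparr>) A B Q \<Theta> \<and>
        nonsplit_ext_by_2 G H \<and>
        subgroup \<Phi> G \<and> G\<lparr>carrier := \<Phi>\<rparr> \<cong> integer_mod_group 4 \<and>
        (\<lambda>f. H #>\<^bsub>G\<^esub> f) ` \<Phi> = carrier (G Mod H) \<and>
        (\<forall>f\<in>\<Phi>. group.ord G f = 4 \<longrightarrow>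
           acts_by_outer G f Q \<and> acts_by_inversion G f \<Theta> \<and> acts_trivially G f B))"

definition structure_V ::
  "('a, 'b) monoid_scheme \<Rightarrow> 'a set \<Rightarrow> 'a set \<Rightarrow> 'a set \<Rightarrow> bool" where
  "structure_V G A B S \<longleftrightarrow>
     AB_conditions G A B \<and>
     internal_direct G S (A <#>\<^bsub>G\<^esub> B) \<and>
     internal_semidirect (G\<lparr>carrier := A <#>\<^bsub>G\<^esub> B\<rparr>) A B \<and>
     G\<lparr>carrier := S\<rparr> \<cong> SL2_F5 \<and>
     coprime (card A) 15 \<and> coprime (card B) 15"

definition structure_VI ::
  "('a, 'b) monoid_scheme \<Rightarrow> 'a set \<Rightarrow> 'a set \<Rightarrow> 'a set \<Rightarrow> 'a set \<Rightarrow> bool" where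
  "structure_VI G A B S \<Phi> \<longleftrightarrow>
     (let H = S <#>\<^bsub>G\<^esub> (A <#>\<^bsub>G\<^esub> B) in
        structure_V (G\<lparr>carrier := H\<rparr>) A B S \<and>
        nonsplit_ext_by_2 G H \<and>
        subgroup \<Phi> G \<and> G\<lparr>carrier := \<Phi>\<rparr> \<cong> integer_mod_group 4 \<and>
        (\<lambda>f. H #>\<^bsub>G\<^esub> f) ` \<Phi> = carrier (G Mod H) \<and>
        (\<forall>f\<in>\<Phi>. group.ord G f = 4 \<longrightarrow> acts_by_outer G f S \<and> acts_trivially G f B))"

datatype structure_type = Type_I | Type_II | Type_III | Type_IV | Type_V | Type_VI

fun has_type :: "('a, 'b) monoid_scheme \<Rightarrow> structure_type \<Rightarrow> bool" where
  "has_type G Type_I \<longleftrightarrow> (\<exists>A B T. structure_I G A B T)"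
| "has_type G Type_II \<longleftrightarrow> (\<exists>A B T. structure_II G A B T)"
| "has_type G Type_III \<longleftrightarrow> (\<exists>A B Q \<Theta>. structure_III G A B Q \<Theta>)"
| "has_type G Type_IV \<longleftrightarrow> (\<exists>A B Q \<Theta> \<Phi>. structure_IV G A B Q \<Theta> \<Phi>)"
| "has_type G Type_V \<longleftrightarrow> (\<exists>A B S. structure_V G A B S)"
| "has_type G Type_VI \<longleftrightarrow> (\<exists>A B S \<Phi>. structure_VI G A B S \<Phi>)"

end

theory Submission
  imports Defs "HOL-Number_Theory.Cong"
begin

text \<open>
  Let \<open>p\<close> divide both \<open>|A|\<close> and \<open>|B*|\<close>. Since \<open>A\<close> is a normal Hall subgroup, it contains the Sylow
  \<open>p\<close>-subgroup of \<open>B*\<close>, which is therefore normal in \<open>G\<close>, as every subgroup of a cyclic normal subgroup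
  is; so it centralizes \<open>A*\<close>, a contradiction. Hence \<open>|A| = |A*|\<close>, and \<open>A = A*\<close> as normal Hall subgroups
  are determined by their order; the same applies to \<open>Q\<^sub>8\<close> and \<open>2A\<^sub>5\<close>. The complements are conjugate by
  Schur--Zassenhaus, for type III applied modulo the centre of \<open>Q\<^sub>8\<close>, where the kernel becomes abelian.

  For types IV and VI the subgroup of index 2 is unique because it is generated by elements of odd
  order. If \<open>\<phi>\<close> and \<open>\<phi>* = h \<phi>\<close> are generators of \<open>\<Phi>\<close> and \<open>\<Phi>*\<close>, both of whose squares are the unique
  involution \<open>z\<close> of that subgroup, then \<open>\<phi>\<close> inverts \<open>h\<close>. The component \<open>w\<close> of \<open>h\<close> of odd order has a square root \<open>v\<close>
  among its powers, and conjugation by \<open>v\<close> takes \<open>\<phi>\<close> to \<open>w \<phi>\<close>. In type IV the other component of \<open>h\<close>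
  centralizes \<open>\<Theta>\<close>, so it is \<open>1\<close> or \<open>z\<close>; in type VI it is dealt with inside a Sylow 2-subgroup of
  \<open>\<langle>2A\<^sub>5, \<phi>\<rangle>\<close>, using that an automorphism of \<open>SL\<^sub>2(F\<^sub>5)\<close> preserves traces.

  The types are told apart by the order of a Sylow 2-subgroup, by whether it is cyclic, and by the
  products of elements of odd order.
\<close>

section \<open>Conjugation and Hall subgroups\<close>

text \<open>Schur--Zassenhaus is used for abelian kernels only, where it is a statement about
  cocycles. In type III conjugacy modulo {1, z} lifts because the complement has odd order and z has
  order 2. Ambiguity by z is harmless for \<open>\<Phi>\<close> too: phi* has order 4 and square z,
  so z phi* is its inverse and generates the same subgroup. Hence phi need only be carried to phi*
  up to z, by an element that leaves the subgroups already matched in place. That phi inverts h is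
  the equation phi*^2 = phi^2 = z, read as h (phi h phi^-1) = 1. The obstacle is type VI, where the
  component of h in \<open>2A5\<close> need not be central. After conjugation into one Sylow
  2-subgroup that component lies in a Q8. Either phi acts nontrivially on Q8 modulo z, and then the
  component is, up to z, trivial or a commutator with phi; or phi acts on Q8 like an inner
  automorphism of Q8. In the second case rigidity (an automorphism of \<open>2A5\<close> fixing i
  and j is trivial) makes phi act on \<open>2A5\<close> by an inner automorphism, against the
  assumption.\<close>

lemma conj_set_eq: "conj_set G g H = (\<lambda>h. g \<otimes>\<^bsub>G\<^esub> h \<otimes>\<^bsub>G\<^esub> inv\<^bsub>G\<^esub> g) ` H"
  unfolding conj_set_def conj_map_def by auto

lemma coprimeI_prime_nat:
  fixes a b :: nat
  assumes "\<And>p. Factorial_Ring.prime p \<Longrightarrow> p dvd a \<Longrightarrow> \<not> p dvd b" shows "coprime a b"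
proof (rule ccontr)
  assume "\<not> coprime a b"
  then obtain p where "Factorial_Ring.prime p" "p dvd gcd a b"
    using prime_factor_nat coprime_iff_gcd_eq_1 by blast
  with assms show False by (meson dvd_trans gcd_dvd1 gcd_dvd2)
qed

context group
begin

abbreviation cj where "cj g x \<equiv> g \<otimes> x \<otimes> inv g"

lemma inv_cancel_left: "x \<in> carrier G \<Longrightarrow> y \<in> carrier G \<Longrightarrow> inv x \<otimes> (x \<otimes> y) = y"
  by (simp flip: m_assoc)

lemma cancel_inv_left: "x \<in> carrier G \<Longrightarrow> y \<in> carrier G \<Longrightarrow> x \<otimes> (inv x \<otimes> y) = y"
  by (simp flip: m_assoc)

text \<open>With the standard simp rules for units and inverses this is the complete rewriting
  system for groups: simp brings group words to normal form and so decides the conjugation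
  identities used throughout.\<close>

lemmas word_simps = m_assoc inv_mult_group inv_cancel_left cancel_inv_left

lemma cj_mult:
  "g \<in> carrier G \<Longrightarrow> x \<in> carrier G \<Longrightarrow> y \<in> carrier G \<Longrightarrow> cj g (x \<otimes> y) = cj g x \<otimes> cj g y"
  by (simp add: word_simps)

lemma cj_inv: "g \<in> carrier G \<Longrightarrow> x \<in> carrier G \<Longrightarrow> cj g (inv x) = inv (cj g x)"
  by (simp add: word_simps)

lemma cj_cj:
  "g \<in> carrier G \<Longrightarrow> h \<in> carrier G \<Longrightarrow> x \<in> carrier G \<Longrightarrow> cj g (cj h x) = cj (g \<otimes> h) x"
  by (simp add: word_simps)

lemma cj_pow: "g \<in> carrier G \<Longrightarrow> x \<in> carrier G \<Longrightarrow> cj g (x [^] (n::nat)) = cj g x [^] n"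
  by (induction n) (simp_all add: cj_mult)

lemma cj_int_pow: "g \<in> carrier G \<Longrightarrow> x \<in> carrier G \<Longrightarrow> cj g (x [^] (n::int)) = cj g x [^] n"
proof (cases "n < 0")
  assume g: "g \<in> carrier G" and x: "x \<in> carrier G" and n: "n < 0"
  have "cj g (inv (x [^] nat (- n))) = inv (cj g (x [^] nat (- n)))" by (rule cj_inv) (use g x in auto)
  also have "cj g (x [^] nat (- n)) = cj g x [^] nat (- n)" by (rule cj_pow) (use g x in auto)
  finally show ?thesis using n unfolding int_pow_def2 by simp
next
  assume g: "g \<in> carrier G" and x: "x \<in> carrier G" and n: "\<not> n < 0"
  then show ?thesis using cj_pow[OF g x, of "nat n"] by simp
qed

lemma cj_eq_iff_commute:
  "g \<in> carrier G \<Longrightarrow> x \<in> carrier G \<Longrightarrow> cj g x = x \<longleftrightarrow> g \<otimes> x = x \<otimes> g"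
  by (metis inv_solve_right' m_closed)

lemma cj_inj: "g \<in> carrier G \<Longrightarrow> H \<subseteq> carrier G \<Longrightarrow> inj_on (cj g) H"
  by (rule inj_onI) (metis (no_types, lifting) inv_closed l_cancel m_closed right_cancel subset_iff)

lemma conj_set_conj_set:
  "g \<in> carrier G \<Longrightarrow> h \<in> carrier G \<Longrightarrow> U \<subseteq> carrier G \<Longrightarrow>
    conj_set G g (conj_set G h U) = conj_set G (g \<otimes> h) U"
  unfolding conj_set_eq image_image using cj_cj by (intro image_cong) auto

lemma conj_set_one: "U \<subseteq> carrier G \<Longrightarrow> conj_set G \<one> U = U"
  unfolding conj_set_eq by (force simp: image_iff)

lemma card_conj_set: "g \<in> carrier G \<Longrightarrow> U \<subseteq> carrier G \<Longrightarrow> card (conj_set G g U) = card U"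
  unfolding conj_set_eq by (rule card_image) (rule cj_inj)

lemma normal_cj: "N \<lhd> G \<Longrightarrow> g \<in> carrier G \<Longrightarrow> x \<in> N \<Longrightarrow> cj g x \<in> N"
  by (rule normal.inv_op_closed2)

lemma conj_set_normal:
  assumes "N \<lhd> G" "g \<in> carrier G" shows "conj_set G g N = N"
proof
  show "conj_set G g N \<subseteq> N" unfolding conj_set_eq using normal_cj assms by auto
  show "N \<subseteq> conj_set G g N"
  proof
    fix x assume x: "x \<in> N"
    have xc: "x \<in> carrier G" using normal_imp_subgroup[OF assms(1)] x subgroup.mem_carrier by metis
    have "x = cj g (cj (inv g) x)" using assms(2) xc by (simp add: word_simps)
    then show "x \<in> conj_set G g N" unfolding conj_set_eq using normal_cj[OF assms(1), of "inv g" x] assms(2) x by auto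
  qed
qed

lemma conj_set_subgroup:
  assumes g: "g \<in> carrier G" and H: "subgroup H G" shows "subgroup (conj_set G g H) G"
proof -
  have "group_hom G G (cj g)"
    by (unfold_locales) (auto simp: hom_def g cj_mult simp del: m_assoc)
  then show ?thesis unfolding conj_set_eq using group_hom.subgroup_img_is_subgroup H by fastforce
qed

section \<open>Products of subgroups, coprime exponents and cyclic normal subgroups\<close>

lemma card_set_mult:
  assumes "subgroup H G" "subgroup K G" "H \<inter> K = {\<one>}"
  shows "card (H <#> K) = card H * card K"
proof -
  interpret group_disjoint_sum G H K
    using assms by (simp add: group_disjoint_sum_def is_group)
  have "inj_on (\<lambda>(x,y). x \<otimes> y) (H \<times> K)"
    using cancel assms(3) by (auto simp: inj_on_def)
  moreover have "H <#> K = (\<lambda>(x,y). x \<otimes> y) ` (H \<times> K)"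
    unfolding set_mult_def by auto
  ultimately show ?thesis by (simp add: card_image card_cartesian_product)
qed

lemma decomp_unique:
  assumes "subgroup H G" "subgroup K G" "H \<inter> K = {\<one>}"
    "x \<in> H" "y \<in> K" "x' \<in> H" "y' \<in> K" "x \<otimes> y = x' \<otimes> y'"
  shows "x = x'" "y = y'"
proof -
  interpret group_disjoint_sum G H K
    using assms by (simp add: group_disjoint_sum_def is_group)
  show "x = x'" "y = y'" using cancel assms by blast+
qed

text \<open>Bezout: if u m + v n = 1, then x is the product of a power of x^m and a power of
  x^n.\<close>

lemma subgroup_pow_coprime:
  assumes H: "subgroup H G" and x: "x \<in> carrier G"
    and m: "x [^] (m::nat) \<in> H" and n: "x [^] (n::nat) \<in> H" and co: "coprime m n"
  shows "x \<in> H"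
proof -
  obtain u v :: int where uv: "u * int m + v * int n = 1"
    using bezout_int[of "int m" "int n"] co by (auto simp: coprime_int_iff)
  have "x = x [^] (int m * u + int n * v)" using uv x by (simp add: mult.commute)
  also have "\<dots> = (x [^] m) [^] u \<otimes> (x [^] n) [^] v"
    using x by (simp add: int_pow_mult flip: int_pow_pow int_pow_int)
  also have "\<dots> \<in> H" using subgroup_int_pow_closed[OF H] m n H subgroup.m_closed by metis
  finally show ?thesis .
qed

lemma pow_card_subgroup:
  assumes H: "subgroup H G" and x: "x \<in> H" shows "x [^] card H = \<one>"
proof -
  have "x [^]\<^bsub>G\<lparr>carrier := H\<rparr>\<^esub> order (G\<lparr>carrier := H\<rparr>) = \<one>\<^bsub>G\<lparr>carrier := H\<rparr>\<^esub>"
    using group.pow_order_eq_1[OF subgroup_imp_group[OF H]] x by simp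
  then show ?thesis by (simp add: order_def nat_pow_consistent[symmetric])
qed

lemma pow_mult_eq_one: "x \<in> carrier G \<Longrightarrow> x [^] (n::nat) = \<one> \<Longrightarrow> x [^] (n * m) = \<one>"
  by (metis nat_pow_one nat_pow_pow)

lemma subgroup_coprime_inter:
  assumes "subgroup H G" "subgroup K G" "coprime (card H) (card K)" shows "H \<inter> K = {\<one>}"
proof -
  have "x = \<one>" if "x \<in> H" "x \<in> K" for x
  proof -
    have "x \<in> {\<one>}"
      by (rule subgroup_pow_coprime[OF triv_subgroup _ _ _ assms(3)])
        (use that pow_card_subgroup assms subgroup.mem_carrier in fastforce)+
    then show ?thesis by simp
  qed
  then show ?thesis using assms subgroup.one_closed by blast
qed

text \<open>The image of x in G/N is killed both by n and by the index m, hence is trivial. So N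
  contains every element killed by an exponent prime to its index.\<close>

lemma normal_mem_of_pow:
  assumes N: "N \<lhd> G" and fin: "finite (carrier G)" and ord: "order G = card N * m"
    and co: "coprime n m" and x: "x \<in> carrier G" and xn: "x [^] (n::nat) = \<one>"
  shows "x \<in> N"
proof -
  interpret N: normal N G by (rule N)
  have sub: "subgroup N G" using N normal_imp_subgroup by blast
  have pos: "card N > 0" using fin sub subgroup.finite_imp_card_positive by blast
  have "card (rcosets N) * card N = order G" using lagrange sub by simp
  then have "card (rcosets N) = m" using ord pos by simp
  then have om: "order (G Mod N) = m" by (simp add: order_def FactGroup_def)
  interpret Q: group "G Mod N" by (rule N.factorgroup_is_group)
  have "N #> x \<in> carrier (G Mod N)" using x by (auto simp: carrier_FactGroup)
  then have "(N #> x) [^]\<^bsub>G Mod N\<^esub> m = \<one>\<^bsub>G Mod N\<^esub>" using Q.pow_order_eq_1 om by simp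
  then have "N #> (x [^] m) = N" using N.FactGroup_pow[OF x] by simp
  then have "x [^] m \<in> N" using x coset_join1 N.subset nat_pow_closed sub by blast
  moreover have "x [^] n \<in> N" using xn N.one_closed by simp
  ultimately show ?thesis using subgroup_pow_coprime[OF sub x] co by blast
qed

lemma cyclic_subgroup_elems:
  assumes "subgroup A G" "cyclic_group (G\<lparr>carrier := A\<rparr>)"
  obtains t where "t \<in> A" "A = range (\<lambda>n::int. t [^] n)"
proof -
  interpret A: group "G\<lparr>carrier := A\<rparr>" by (rule subgroup_imp_group[OF assms(1)])
  obtain t where "t \<in> A" "A = range (\<lambda>n::int. t [^]\<^bsub>G\<lparr>carrier := A\<rparr>\<^esub> n)"
    using assms(2) A.cyclic_group by auto
  moreover have "t [^]\<^bsub>G\<lparr>carrier := A\<rparr>\<^esub> n = t [^] n" for n :: int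
    using int_pow_consistent[OF assms(1) \<open>t \<in> A\<close>] by simp
  ultimately show ?thesis using that by simp
qed

lemma cyclic_commute:
  assumes "subgroup A G" "cyclic_group (G\<lparr>carrier := A\<rparr>)" "x \<in> A" "y \<in> A"
  shows "x \<otimes> y = y \<otimes> x"
proof -
  interpret A: group "G\<lparr>carrier := A\<rparr>" by (rule subgroup_imp_group[OF assms(1)])
  have "x \<otimes> y = x \<otimes>\<^bsub>G\<lparr>carrier := A\<rparr>\<^esub> y" by simp
  also have "\<dots> = y \<otimes>\<^bsub>G\<lparr>carrier := A\<rparr>\<^esub> x"
    by (rule comm_groupE(4)[OF A.cyclic_imp_abelian_group[OF assms(2)]]) (use assms(3,4) in simp_all)
  finally show ?thesis by simp
qed

text \<open>Conjugation by \<open>h\<close> sends a generator of \<open>A\<close> to some j-th power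
  of it and therefore raises every element of \<open>A\<close> to the same power. In particular
  subgroups of a cyclic normal subgroup are normal in the whole group.\<close>

lemma cyclic_normal_cj:
  assumes A: "A \<lhd> G" and cyc: "cyclic_group (G\<lparr>carrier := A\<rparr>)"
    and y: "y \<in> A" and h: "h \<in> carrier G"
  obtains j :: int where "cj h y = y [^] j"
proof -
  have sub: "subgroup A G" using A normal_imp_subgroup by blast
  obtain t where t: "t \<in> A" "A = range (\<lambda>n::int. t [^] n)" using cyclic_subgroup_elems[OF sub cyc] .
  have tc: "t \<in> carrier G" using t sub subgroup.mem_carrier by metis
  obtain i where i: "y = t [^] (i::int)" using y t by auto
  obtain j where j: "cj h t = t [^] (j::int)" using normal_cj[OF A h t(1)] t(2) by auto
  have "cj h y = (t [^] j) [^] i" using i j cj_int_pow[OF h tc] by simp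
  also have "\<dots> = y [^] j" using i tc by (simp add: int_pow_pow mult.commute)
  finally show ?thesis using that by blast
qed

section \<open>Independence of \<open>A\<close> and of the order of \<open>B\<close> from the chosen
  structure\<close>

lemma AB_prime_disjoint:
  assumes fin: "finite (carrier G)"
    and A: "A \<lhd> G" and AB: "AB_conditions G A B" and ord: "order G = c * (card A * card B)"
    and co: "coprime c (card A * card B)"
    and A': "A' \<lhd> G" and AB': "AB_conditions G A' B'"
    and p: "Factorial_Ring.prime p" "p dvd card A"
  shows "\<not> p dvd card B'"
proof
  assume pb: "p dvd card B'"
  have sB': "subgroup B' G" and sA': "subgroup A' G" and sA: "subgroup A G"
    using AB AB' by (auto simp: AB_conditions_def)
  interpret B': group "G\<lparr>carrier := B'\<rparr>" by (rule subgroup_imp_group[OF sB'])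
  have finB': "finite B'" using fin sB' subgroup.subset finite_subset by blast
  have posB': "card B' > 0" using fin sB' subgroup.finite_imp_card_positive by blast
  let ?v = "multiplicity p (card B')"
  obtain m where m: "card B' = p ^ ?v * m" using multiplicity_dvd[of p "card B'"] by (auto simp: dvd_def)
  obtain P where P: "subgroup P (G\<lparr>carrier := B'\<rparr>)" "card P = p ^ ?v"
    using sylow_thm[OF p(1) subgroup_imp_group[OF sB'], of ?v m] m finB' by (auto simp: order_def)
  have "?v > 0" using pb p(1) posB' by (simp add: prime_multiplicity_gt_zero_iff)
  then have "card P > 1" using P(2) p(1) by (metis one_less_power prime_gt_1_nat)
  then have "P \<noteq> {\<one>}" by auto
  moreover have "sylow_subgroup p (G\<lparr>carrier := B'\<rparr>) P" using P by (simp add: sylow_subgroup_def order_def)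
  ultimately obtain g where g: "g \<in> P" "\<not> acts_trivially G g A'"
    using AB' p(1) unfolding AB_conditions_def by blast
  have sP: "subgroup P G" using P(1) incl_subgroup[OF sB'] by blast
  have PB': "P \<subseteq> B'" using P(1) subgroup.subset by fastforce
  have PA: "P \<subseteq> A"
  proof
    fix x assume x: "x \<in> P"
    have xc: "x \<in> carrier G" using x sP subgroup.mem_carrier by metis
    have "coprime p (card B * c)"
    proof -
      have "coprime (card A) (card B * c)" using co AB by (simp add: AB_conditions_def coprime_commute)
      then show ?thesis using p(2) by (metis coprime_commute coprime_divisors dvd_refl)
    qed
    then show "x \<in> A"
      using normal_mem_of_pow[OF A fin _ _ xc, of "card B * c" "p ^ ?v"] pow_card_subgroup[OF sP x] P(2) ord
      by (simp add: ac_simps)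
  qed
  have cycA: "cyclic_group (G\<lparr>carrier := A\<rparr>)" using AB by (simp add: AB_conditions_def)
  have "acts_trivially G g A'"
    unfolding acts_trivially_def conj_map_def
  proof
    fix x assume x: "x \<in> A'"
    have gc: "g \<in> carrier G" and xc: "x \<in> carrier G" using g x sP sA' subgroup.mem_carrier by metis+
    have "inv g \<in> A" using g(1) PA sA subgroup.m_inv_closed by (metis subset_iff)
    then obtain j where j: "cj x (inv g) = (inv g) [^] (j::int)"
      by (rule cyclic_normal_cj[OF A cycA _ xc])
    \<comment> \<open>The commutator of g and x is read in two ways: as a product of two elements of
      P, which x normalizes because P lies in the cyclic normal subgroup \<open>A\<close>, and as a
      product of two elements of \<open>A'\<close>. It therefore lies in the trivial intersection of
      \<open>A'\<close> and \<open>B'\<close>.\<close>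
    have "cj x (inv g) \<in> P" using j g sP subgroup.m_inv_closed subgroup_int_pow_closed by metis
    then have "g \<otimes> cj x (inv g) \<in> P" using g sP subgroup.m_closed by metis
    moreover have "g \<otimes> cj x (inv g) = cj g x \<otimes> inv x" using gc xc by (simp add: word_simps)
    moreover have "cj g x \<otimes> inv x \<in> A'"
      using normal_cj[OF A' gc x] x sA' subgroup.m_closed subgroup.m_inv_closed by metis
    moreover have "A' \<inter> B' = {\<one>}"
      using subgroup_coprime_inter[OF sA' sB'] AB' by (simp add: AB_conditions_def)
    ultimately have "cj g x \<otimes> inv x = \<one>" using PB' by auto
    then have "cj g x = x" using gc xc by (metis inv_solve_right l_one m_closed inv_closed one_closed)
    then show "(\<lambda>h\<in>A'. cj g h) x = x" using x by simp
  qed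
  with g show False by blast
qed

text \<open>\<open>c\<close> is the order of the remaining factor: a power of 2, 8 times a power of
  3, or 120. Coprimality across the two structures makes |A| |B| and |A'| |B'| divide each other;
  then |A|, being prime to |B'|, divides |A'|, and conversely.\<close>

lemma AB_unique:
  assumes fin: "finite (carrier G)"
    and A: "A \<lhd> G" and AB: "AB_conditions G A B" and ord: "order G = c * (card A * card B)"
    and co: "coprime c (card A * card B)"
    and A': "A' \<lhd> G" and AB': "AB_conditions G A' B'" and ord': "order G = c' * (card A' * card B')"
    and co': "coprime c' (card A' * card B')"
    and cc': "coprime c (card A' * card B')" "coprime c' (card A * card B)"
  shows "A' = A" "card B' = card B" "c' = c"
proof -
  have pos: "order G > 0" using fin by (simp add: order_gt_0_iff_finite)
  have pos': "card A * card B > 0" "card A' * card B' > 0" using pos ord ord' by (metis mult_is_0 not_gr_zero)+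
  have cop: "coprime (card A) (card B')"
    using AB_prime_disjoint[OF fin A AB ord co A' AB'] by (intro coprimeI_prime_nat) auto
  have cop': "coprime (card A') (card B)"
    using AB_prime_disjoint[OF fin A' AB' ord' co' A AB] by (intro coprimeI_prime_nat) auto
  have "card A * card B dvd c' * (card A' * card B')" "card A' * card B' dvd c * (card A * card B)"
    using ord ord' by (metis dvd_triv_right)+
  then have "card A * card B dvd card A' * card B'" "card A' * card B' dvd card A * card B"
    using cc' by (metis coprime_commute coprime_dvd_mult_right_iff)+
  then have ab: "card A * card B = card A' * card B'" using dvd_antisym by blast
  then show "c' = c" using ord ord' pos by (metis mult_is_0 mult_right_cancel not_gr_zero)
  have "card A dvd card A' * card B'" "card A' dvd card A * card B" using ab by (metis dvd_triv_left)+
  then have "card A dvd card A'" "card A' dvd card A"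
    using cop cop' by (auto simp: coprime_dvd_mult_left_iff)
  then have aa: "card A' = card A" using dvd_antisym by blast
  then show "card B' = card B" using ab pos ord by (metis mult_is_0 mult_left_cancel not_gr_zero)
  have sA: "subgroup A G" "subgroup A' G" using AB AB' by (auto simp: AB_conditions_def)
  have "A \<subseteq> A'"
  proof
    fix x assume x: "x \<in> A"
    have xc: "x \<in> carrier G" using x sA subgroup.mem_carrier by metis
    show "x \<in> A'"
      by (rule normal_mem_of_pow[OF A' fin _ _ xc, of "c' * card B'" "card A'"])
        (use pow_card_subgroup[OF sA(1) x] aa ord' co' AB' in \<open>auto simp: AB_conditions_def coprime_commute\<close>)
  qed
  moreover have "finite A'" using sA fin subgroup.subset finite_subset by blast
  ultimately show "A' = A" using aa card_subset_eq by metis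
qed

section \<open>The Schur--Zassenhaus theorem and Sylow conjugacy\<close>

lemma pow_cong:
  assumes x: "x \<in> carrier G" and n: "x [^] (n::nat) = \<one>" and ab: "[a = b] (mod n)"
  shows "x [^] a = x [^] b"
proof -
  have "x [^] k = x [^] (k mod n)" for k :: nat
  proof -
    have "x [^] k = x [^] (n * (k div n) + k mod n)" by simp
    also have "\<dots> = x [^] (n * (k div n)) \<otimes> x [^] (k mod n)" using x nat_pow_mult by metis
    also have "x [^] (n * (k div n)) = \<one>" using pow_mult_eq_one[OF x n] .
    finally show ?thesis using x by simp
  qed
  then show ?thesis using ab by (metis cong_def)
qed

text \<open>
  The map \<open>d\<close> with \<open>d k \<otimes> k \<in> K'\<close> is a cocycle \<open>K \<rightarrow> N\<close>. Multiplying the cocycle identity over all second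
  arguments shows that its \<open>|K|\<close>-th power is a coboundary, and \<open>|K|\<close> is invertible modulo \<open>|N|\<close>.
\<close>

lemma schur_zassenhaus_abelian:
  assumes fin: "finite (carrier G)" and N: "N \<lhd> G"
    and comm: "\<And>x y. x \<in> N \<Longrightarrow> y \<in> N \<Longrightarrow> x \<otimes> y = y \<otimes> x"
    and K: "subgroup K G" "N <#> K = carrier G" "N \<inter> K = {\<one>}"
    and K': "subgroup K' G" "N <#> K' = carrier G" "N \<inter> K' = {\<one>}"
    and co: "coprime (card N) (card K)"
  shows "\<exists>g\<in>carrier G. conj_set G g K = K'"
proof -
  have sN: "subgroup N G" using N normal_imp_subgroup by blast
  have Nc: "N \<subseteq> carrier G" and Kc: "K \<subseteq> carrier G" and Kc': "K' \<subseteq> carrier G"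
    using sN K K' subgroup.subset by blast+
  have finK: "finite K" "finite K'" "finite N" using fin Kc Kc' Nc finite_subset by blast+
  define C where "C = G\<lparr>carrier := N\<rparr>"
  interpret C: comm_group C
    unfolding C_def using comm
    by (intro group.group_comm_groupI subgroup_imp_group[OF sN]) auto
  have C_simps [simp]: "carrier C = N" "x \<otimes>\<^bsub>C\<^esub> y = x \<otimes> y" "\<one>\<^bsub>C\<^esub> = \<one>" "x [^]\<^bsub>C\<^esub> (n::nat) = x [^] n" for x y n
    by (simp_all add: C_def nat_pow_consistent[symmetric])
  have invC: "inv\<^bsub>C\<^esub> x = inv x" if "x \<in> N" for x
    using m_inv_consistent[OF sN that] by (simp add: C_def)
  have "\<exists>d\<in>N. d \<otimes> k \<in> K'" if k: "k \<in> K" for k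
  proof -
    obtain n k' where nk: "n \<in> N" "k' \<in> K'" "k = n \<otimes> k'"
      using k Kc K'(2) unfolding set_mult_def by blast
    then have "inv n \<otimes> k = k'" using Nc Kc' by (simp add: inv_cancel_left subset_iff)
    then show ?thesis using nk sN subgroup.m_inv_closed by metis
  qed
  then obtain d where d: "\<And>k. k \<in> K \<Longrightarrow> d k \<in> N" "\<And>k. k \<in> K \<Longrightarrow> d k \<otimes> k \<in> K'" by metis
  have dc: "\<And>k. k \<in> K \<Longrightarrow> d k \<in> carrier G" using d Nc by blast
  have d_unique: "d k = n" if "k \<in> K" "n \<in> N" "n \<otimes> k \<in> K'" for k n
  proof -
    have c: "k \<in> carrier G" "n \<in> carrier G" "d k \<in> carrier G" using that Kc Nc dc by blast+
    have "d k \<otimes> k \<otimes> inv (n \<otimes> k) \<in> K'"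
      using d(2)[OF that(1)] that(3) K'(1) subgroup.m_closed subgroup.m_inv_closed by metis
    moreover have "d k \<otimes> k \<otimes> inv (n \<otimes> k) = d k \<otimes> inv n" using c by (simp add: word_simps)
    moreover have "d k \<otimes> inv n \<in> N"
      using d(1)[OF that(1)] that(2) sN subgroup.m_closed subgroup.m_inv_closed by metis
    ultimately have "d k \<otimes> inv n = \<one>" using K'(3) by auto
    then show ?thesis using c by (metis inv_solve_right l_one one_closed)
  qed
  have cjN: "cj k n \<in> N" if "k \<in> K" "n \<in> N" for k n using normal_cj[OF N _ that(2)] that Kc by blast
  have cocycle: "d (k \<otimes> l) = d k \<otimes> cj k (d l)" if k: "k \<in> K" and l: "l \<in> K" for k l
  proof (rule d_unique)
    have c: "k \<in> carrier G" "l \<in> carrier G" "d k \<in> carrier G" "d l \<in> carrier G"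
      using k l Kc dc by blast+
    show "k \<otimes> l \<in> K" using k l K subgroup.m_closed by metis
    show "d k \<otimes> cj k (d l) \<in> N" using d(1) cjN k l sN subgroup.m_closed by metis
    have "(d k \<otimes> k) \<otimes> (d l \<otimes> l) \<in> K'" using d(2) k l K' subgroup.m_closed by metis
    moreover have "(d k \<otimes> k) \<otimes> (d l \<otimes> l) = d k \<otimes> cj k (d l) \<otimes> (k \<otimes> l)"
      using c by (simp add: word_simps)
    ultimately show "d k \<otimes> cj k (d l) \<otimes> (k \<otimes> l) \<in> K'" by simp
  qed
  define e where "e = finprod C d K"
  have eN: "e \<in> N" using C.finprod_closed[of d K] d by (auto simp: e_def)
  have ec: "e \<in> carrier G" using eN Nc by blast
  have cj_prod: "finprod C (\<lambda>l. cj k (d l)) J = cj k (finprod C d J)" if k: "k \<in> K" and J: "J \<subseteq> K" for k J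
  proof -
    have "finite J" using J finK finite_subset by blast
    then show ?thesis using J
    proof (induction J)
      case empty
      then show ?case using k Kc by auto
    next
      case (insert l J)
      have 1: "finprod C d J \<in> N" using C.finprod_closed[of d J] d insert by auto
      have "finprod C (\<lambda>l. cj k (d l)) (insert l J) = cj k (d l) \<otimes> finprod C (\<lambda>l. cj k (d l)) J"
        using insert cjN[OF k d(1)] by (subst C.finprod_insert) auto
      also have "\<dots> = cj k (d l) \<otimes> cj k (finprod C d J)" using insert by simp
      also have "\<dots> = cj k (d l \<otimes> finprod C d J)"
        by (rule cj_mult[symmetric]) (use k Kc dc 1 Nc insert in auto)
      also have "d l \<otimes> finprod C d J = finprod C d (insert l J)"
        using insert d(1) by (subst C.finprod_insert) auto
      finally show ?case .
    qed
  qed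
  have key: "d k [^] card K = e \<otimes> inv (cj k e)" if k: "k \<in> K" for k
  proof -
    have kc: "k \<in> carrier G" using k Kc by blast
    have img: "(\<lambda>l. k \<otimes> l) ` K = K"
    proof
      show "(\<lambda>l. k \<otimes> l) ` K \<subseteq> K" using k K subgroup.m_closed by fastforce
      show "K \<subseteq> (\<lambda>l. k \<otimes> l) ` K"
      proof
        fix l assume l: "l \<in> K"
        have "l = k \<otimes> (inv k \<otimes> l)" using kc l Kc by (simp add: cancel_inv_left subset_iff)
        moreover have "inv k \<otimes> l \<in> K" using k l K(1) subgroup.m_closed subgroup.m_inv_closed by metis
        ultimately show "l \<in> (\<lambda>l. k \<otimes> l) ` K" by blast
      qed
    qed
    have inj: "inj_on (\<lambda>l. k \<otimes> l) K" using inj_on_cmult[OF kc] Kc inj_on_subset by blast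
    \<comment> \<open>Translation by k permutes K, so e is also the product of all d(k l); the
      cocycle identity then splits off |K| equal factors d(k).\<close>
    have "e = finprod C d ((\<lambda>l. k \<otimes> l) ` K)" using img by (simp add: e_def)
    also have "\<dots> = finprod C (\<lambda>l. d (k \<otimes> l)) K"
      by (rule C.finprod_reindex) (use inj img d in auto)
    also have "\<dots> = finprod C (\<lambda>l. d k \<otimes>\<^bsub>C\<^esub> cj k (d l)) K"
      by (rule C.finprod_cong') (use k d cjN subgroup.m_closed[OF sN] cocycle in \<open>auto\<close>)
    also have "\<dots> = finprod C (\<lambda>l. d k) K \<otimes>\<^bsub>C\<^esub> finprod C (\<lambda>l. cj k (d l)) K"
      by (rule C.finprod_multf) (use k d cjN in auto)
    also have "\<dots> = d k [^] card K \<otimes> cj k e"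
      using C.finprod_const[of "d k" K] d k cj_prod[OF k, of K] by (auto simp: e_def)
    finally have "e = d k [^] card K \<otimes> cj k e" .
    then show ?thesis using ec kc dc[OF k] by (metis inv_closed inv_solve_right m_closed nat_pow_closed)
  qed
  obtain m where m: "[card K * m = 1] (mod (card N))"
    using cong_solve_coprime_nat[of "card K" "card N"] co by (auto simp: coprime_commute)
  have powm: "x [^] (card K * m) = x" if "x \<in> N" for x
  proof -
    have xc: "x \<in> carrier G" using that Nc by blast
    have "x [^] (card K * m) = x [^] (1::nat)"
      using pow_cong[OF xc pow_card_subgroup[OF sN that] m] .
    then show ?thesis using xc by simp
  qed
  \<comment> \<open>The power d(k)^|K| is the coboundary of e. Raising to the inverse m of |K|
    modulo |N| makes d itself the coboundary of f, which says that d(k) k = f k f^-1.\<close>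
  define f where "f = e [^] m"
  have fN: "f \<in> N" using eN by (metis C_simps(1,4) C.nat_pow_closed f_def)
  have fc: "f \<in> carrier G" using fN Nc by blast
  have "conj_set G f K \<subseteq> K'"
    unfolding conj_set_eq
  proof safe
    fix k assume k: "k \<in> K"
    have kc: "k \<in> carrier G" using k Kc by blast
    have cjN': "cj k e \<in> N" "inv (cj k e) \<in> N" using cjN[OF k eN] sN subgroup.m_inv_closed by metis+
    have "d k = (d k [^] card K) [^] m" using powm[OF d(1)[OF k]] dc[OF k] by (simp add: nat_pow_pow)
    also have "\<dots> = (e \<otimes> inv (cj k e)) [^] m" using key[OF k] by simp
    also have "\<dots> = e [^] m \<otimes> inv (cj k e) [^] m"
      by (rule pow_mult_distrib) (use comm eN cjN' Nc in auto)
    also have "inv (cj k e) [^] m = inv (cj k e [^] m)"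
      using nat_pow_inv[of "cj k e" m] kc ec by simp
    also have "cj k e [^] m = cj k f" unfolding f_def using cj_pow[OF kc ec] by simp
    finally have "d k = f \<otimes> inv (cj k f)" by (simp add: f_def)
    then have "d k \<otimes> k = cj f k" using fc kc by (simp add: word_simps)
    then show "cj f k \<in> K'" using d(2)[OF k] by simp
  qed
  moreover have "card (conj_set G f K) = card K'"
  proof -
    have "card N * card K = card N * card K'"
      using card_set_mult[OF sN K(1) K(3)] card_set_mult[OF sN K'(1) K'(3)] K(2) K'(2) by simp
    moreover have "card N > 0" using sN fin subgroup.finite_imp_card_positive by blast
    ultimately show ?thesis using card_conj_set[OF fc Kc] by simp
  qed
  ultimately show ?thesis using fc finK card_subset_eq by metis
qed

text \<open>Modulo M the kernel N becomes abelian, while the images of N and K stay complementary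
  and of coprime orders, so the abelian theorem applies to G/M. Lifting back leaves a factor from M
  undetermined.\<close>

lemma schur_zassenhaus_step:
  assumes fin: "finite (carrier G)" and N: "N \<lhd> G" and M: "M \<lhd> G" "M \<subseteq> N"
    and comm: "\<And>x y. x \<in> N \<Longrightarrow> y \<in> N \<Longrightarrow> x \<otimes> y \<otimes> inv x \<otimes> inv y \<in> M"
    and K: "subgroup K G" "N <#> K = carrier G" "N \<inter> K = {\<one>}"
    and K': "subgroup K' G" "N <#> K' = carrier G" "N \<inter> K' = {\<one>}"
    and co: "coprime (card N) (card K)"
  shows "\<exists>g\<in>carrier G. M <#> conj_set G g K = M <#> K'"
proof -
  interpret M: normal M G by (rule M(1))
  define Q where "Q = G Mod M"
  interpret Q: group Q unfolding Q_def by (rule M.factorgroup_is_group)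
  define p where "p = (\<lambda>x. M #> x)"
  interpret p: group_hom G Q p
    unfolding Q_def p_def using M.r_coset_hom_Mod M.factorgroup_is_group
    by (simp add: group_hom_def group_hom_axioms_def)
  have sN: "subgroup N G" using N normal_imp_subgroup by blast
  have Nc: "N \<subseteq> carrier G" and Kc: "K \<subseteq> carrier G" and Kc': "K' \<subseteq> carrier G"
    using sN K K' subgroup.subset by blast+
  have surj: "p ` carrier G = carrier Q" by (simp add: p_def Q_def carrier_FactGroup)
  have p_eq: "p x = p y \<longleftrightarrow> x \<otimes> inv y \<in> M" if "x \<in> carrier G" "y \<in> carrier G" for x y
    unfolding p_def using that M.rcos_module[OF is_group that(2,1)] repr_independence rcos_self
    by (metis M.is_subgroup)
  have img_mult: "p ` U <#>\<^bsub>Q\<^esub> p ` V = p ` (U <#> V)" if "U \<subseteq> carrier G" "V \<subseteq> carrier G" for U V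
    using set_mult_hom[OF p.homh that] by simp
  have img_int: "p ` N \<inter> p ` L = {\<one>\<^bsub>Q\<^esub>}" if L: "subgroup L G" "N \<inter> L = {\<one>}" for L
  proof
    show "{\<one>\<^bsub>Q\<^esub>} \<subseteq> p ` N \<inter> p ` L"
      using p.hom_one sN L subgroup.one_closed image_eqI by (metis Int_iff empty_subsetI insert_subset)
    show "p ` N \<inter> p ` L \<subseteq> {\<one>\<^bsub>Q\<^esub>}"
    proof
      fix y assume "y \<in> p ` N \<inter> p ` L"
      then obtain n l where n: "n \<in> N" and l: "l \<in> L" and e: "p n = p l" and y: "y = p n" by blast
      have c: "n \<in> carrier G" "l \<in> carrier G" using n l Nc L subgroup.mem_carrier by (blast, metis)
      have "n \<otimes> inv l \<in> N" using p_eq[OF c] e M by blast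
      then have "inv n \<otimes> (n \<otimes> inv l) \<in> N" using n sN subgroup.m_closed subgroup.m_inv_closed by metis
      then have "inv l \<in> N" using c by (simp add: inv_cancel_left)
      then have "l \<in> N" using c sN subgroup.m_inv_closed inv_inv by metis
      then have "l = \<one>" using l L by blast
      then show "y \<in> {\<one>\<^bsub>Q\<^esub>}" using e y by simp
    qed
  qed
  \<comment> \<open>First isomorphism theorem for the restriction of \<open>p\<close> to L.
    Divisibility is what carries coprimality of the orders over to the quotient.\<close>
  have card_img: "card (p ` L) dvd card L" if L: "subgroup L G" for L
  proof -
    interpret L: group "G\<lparr>carrier := L\<rparr>" by (rule subgroup_imp_group[OF L])
    have sL: "subgroup (p ` L) Q" using p.subgroup_img_is_subgroup L by blast
    interpret h: group_hom "G\<lparr>carrier := L\<rparr>" "Q\<lparr>carrier := p ` L\<rparr>" p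
      unfolding group_hom_def group_hom_axioms_def
      using subgroup.mem_carrier[OF L] p.homh
      by (auto simp: hom_def L.is_group Q.subgroup_imp_group[OF sL])
    let ?k = "kernel (G\<lparr>carrier := L\<rparr>) (Q\<lparr>carrier := p ` L\<rparr>) p"
    have "card (carrier (G\<lparr>carrier := L\<rparr> Mod ?k)) = card (p ` L)"
      using iso_same_card[OF h.FactGroup_iso] by simp
    moreover have "card (rcosets\<^bsub>G\<lparr>carrier := L\<rparr>\<^esub> ?k) dvd order (G\<lparr>carrier := L\<rparr>)"
      using L.lagrange[OF h.subgroup_kernel] by (metis dvd_triv_left)
    ultimately show ?thesis by (simp add: FactGroup_def order_def)
  qed
  have sKQ: "subgroup (p ` K) Q" "subgroup (p ` K') Q"
    using p.subgroup_img_is_subgroup K K' by blast+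
  have NQ: "p ` N \<lhd> Q"
  proof -
    have "subgroup (p ` N) Q" using p.subgroup_img_is_subgroup sN by blast
    moreover have "y \<otimes>\<^bsub>Q\<^esub> x \<otimes>\<^bsub>Q\<^esub> inv\<^bsub>Q\<^esub> y \<in> p ` N"
      if y: "y \<in> carrier Q" and x: "x \<in> p ` N" for x y
    proof -
      obtain a where a1: "a \<in> carrier G" "y = p a" using y surj by (metis imageE)
      obtain n where n1: "n \<in> N" "x = p n" using x by (metis imageE)
      note a = a1 n1
      have nc: "n \<in> carrier G" using n1(1) Nc by blast
      have "y \<otimes>\<^bsub>Q\<^esub> x \<otimes>\<^bsub>Q\<^esub> inv\<^bsub>Q\<^esub> y = p (cj a n)"
        unfolding a(2,4) using a(1) nc by simp
      moreover have "cj a n \<in> N" by (rule normal_cj[OF N a(1,3)])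
      ultimately show ?thesis by simp
    qed
    ultimately show ?thesis by (intro Q.normal_invI)
  qed
  have "\<exists>h\<in>carrier Q. conj_set Q h (p ` K) = p ` K'"
  proof (rule Q.schur_zassenhaus_abelian[OF _ NQ])
    show "finite (carrier Q)" using fin surj finite_imageI by metis
    show "x \<otimes>\<^bsub>Q\<^esub> y = y \<otimes>\<^bsub>Q\<^esub> x" if xy: "x \<in> p ` N" "y \<in> p ` N" for x y
    proof -
      obtain a b where ab: "a \<in> N" "x = p a" "b \<in> N" "y = p b" using xy by blast
      have c: "a \<in> carrier G" "b \<in> carrier G" using ab Nc by blast+
      have "(a \<otimes> b) \<otimes> inv (b \<otimes> a) \<in> M" using comm[OF ab(1,3)] c by (simp add: word_simps)
      then have "p (a \<otimes> b) = p (b \<otimes> a)"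
        using p_eq[OF m_closed[OF c] m_closed[OF c(2,1)]] by blast
      then show ?thesis using ab c by simp
    qed
    show "subgroup (p ` K) Q" "subgroup (p ` K') Q" by (fact sKQ)+
    show "p ` N <#>\<^bsub>Q\<^esub> p ` K = carrier Q" "p ` N <#>\<^bsub>Q\<^esub> p ` K' = carrier Q"
      using img_mult[OF Nc Kc] img_mult[OF Nc Kc'] K K' surj by simp_all
    show "p ` N \<inter> p ` K = {\<one>\<^bsub>Q\<^esub>}" "p ` N \<inter> p ` K' = {\<one>\<^bsub>Q\<^esub>}"
      using img_int K K' by blast+
    show "coprime (card (p ` N)) (card (p ` K))"
      using coprime_divisors[OF card_img[OF sN] card_img[OF K(1)] co] .
  qed
  then obtain g where g: "g \<in> carrier G" "conj_set Q (p g) (p ` K) = p ` K'"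
    by (metis imageE surj)
  have "conj_set Q (p g) (p ` K) = p ` conj_set G g K"
    unfolding conj_set_eq image_image
    by (rule image_cong) (use g Kc in auto)
  \<comment> \<open>Elements of the quotient are cosets, so taking unions turns an equality of sets
    of cosets into one of subsets of G.\<close>
  then have "\<Union>(p ` conj_set G g K) = \<Union>(p ` K')" using g by simp
  moreover have "\<Union>(p ` U) = M <#> U" for U unfolding p_def r_coset_def set_mult_def by blast
  ultimately show ?thesis using g by metis
qed

end

text \<open>Orbits of a p-group have p-power length, so those outside the fixed points have length
  divisible by p. The action is a plain function with closure laws, bijectivity being derived from
  inverses; this fits both uses, on cosets and by conjugation.\<close>

lemma p_group_fixed_points:
  fixes act :: "'a \<Rightarrow> 'x \<Rightarrow> 'x"
  assumes P: "group P" and ord: "order P = p ^ n" and p: "Factorial_Ring.prime (p::nat)" and fin: "finite U"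
    and closed: "\<And>g x. g \<in> carrier P \<Longrightarrow> x \<in> U \<Longrightarrow> act g x \<in> U"
    and one: "\<And>x. x \<in> U \<Longrightarrow> act \<one>\<^bsub>P\<^esub> x = x"
    and mult: "\<And>g h x. g \<in> carrier P \<Longrightarrow> h \<in> carrier P \<Longrightarrow> x \<in> U \<Longrightarrow> act (g \<otimes>\<^bsub>P\<^esub> h) x = act g (act h x)"
  shows "[card U = card {x\<in>U. \<forall>g\<in>carrier P. act g x = x}] (mod p)"
proof -
  interpret P: group P by (rule P)
  define F where "F = {x\<in>U. \<forall>g\<in>carrier P. act g x = x}"
  define E where "E = U - F"
  have act_inv: "act (inv\<^bsub>P\<^esub> g) (act g x) = x" "act g (act (inv\<^bsub>P\<^esub> g) x) = x" if "g \<in> carrier P" "x \<in> U" for g x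
    using that mult[of "inv\<^bsub>P\<^esub> g" g x] mult[of g "inv\<^bsub>P\<^esub> g" x] one by auto
  have F_act: "x \<in> F" if g: "g \<in> carrier P" and x: "x \<in> U" and F: "act g x \<in> F" for g x
  proof -
    have "act (inv\<^bsub>P\<^esub> g) (act g x) = act g x" using F g unfolding F_def by auto
    then show ?thesis using act_inv(1)[OF g x] F by simp
  qed
  have E_closed: "act g x \<in> E" if "g \<in> carrier P" "x \<in> E" for g x
    using that F_act closed unfolding E_def by blast
  \<comment> \<open>Elements of \<open>BijGroup\<close> are extensional, hence the restriction to
    \<open>E\<close>.\<close>
  define \<phi> where "\<phi> = (\<lambda>g. restrict (act g) E)"
  have bij: "bij_betw (act g) E E" if g: "g \<in> carrier P" for g
    by (rule bij_betw_byWitness[where f' = "act (inv\<^bsub>P\<^esub> g)"])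
      (use g E_closed act_inv in \<open>auto simp: E_def\<close>)
  have "group_hom P (BijGroup E) \<phi>"
    unfolding group_hom_def group_hom_axioms_def
  proof (intro conjI P group_BijGroup)
    show "\<phi> \<in> hom P (BijGroup E)"
    proof (rule homI)
      show "\<phi> g \<in> carrier (BijGroup E)" if "g \<in> carrier P" for g
        using bij[OF that] by (auto simp: BijGroup_def Bij_def \<phi>_def)
      fix g h assume g: "g \<in> carrier P" and h: "h \<in> carrier P"
      then show "\<phi> (g \<otimes>\<^bsub>P\<^esub> h) = \<phi> g \<otimes>\<^bsub>BijGroup E\<^esub> \<phi> h"
        using bij[OF g] bij[OF h] E_closed[OF h] mult
        by (auto simp: BijGroup_def Bij_def \<phi>_def compose_def fun_eq_iff E_def)
    qed
  qed
  then interpret A: group_action P E \<phi> by (simp add: group_action_def)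
  have "p dvd card orb" if orb: "orb \<in> orbits P E \<phi>" for orb
  proof -
    obtain x where x: "x \<in> E" "orb = orbit P \<phi> x" using orb unfolding orbits_def by blast
    have "card orb dvd p ^ n" using A.orbit_stabilizer_theorem[OF x(1)] x ord by (metis dvd_triv_left)
    then obtain i where i: "card orb = p ^ i" using divides_primepow_nat[OF p] by blast
    have "card orb \<noteq> 1"
    proof
      assume "card orb = 1"
      then obtain y where y: "orb = {y}" by (auto simp: card_1_singleton_iff)
      have "act g x \<in> orb" if "g \<in> carrier P" for g
        using that x by (auto simp: orbit_def \<phi>_def)
      then have "act g x = x" if "g \<in> carrier P" for g
        using that y one[of x] x P.one_closed by (metis E_def DiffD1 singletonD)
      then show False using x by (auto simp: E_def F_def)
    qed
    then show ?thesis using i by (metis dvd_power power_0 not_gr_zero)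
  qed
  then have "p dvd (\<Sum>orb\<in>orbits P E \<phi>. \<Sum>x\<in>orb. 1)" by (auto intro: dvd_sum)
  also have "\<dots> = card E" using A.disjoint_sum[of "\<lambda>_. 1::nat"] fin by (simp add: E_def)
  finally have "p dvd card E" .
  moreover have "card U = card E + card F"
    unfolding E_def using fin by (subst card_Diff_subset) (auto simp: F_def card_mono)
  ultimately show ?thesis unfolding F_def[symmetric] by (simp add: cong_def mod_add_eq mod_0_imp_dvd dvd_eq_mod_eq_0 mod_add_left_eq[symmetric])
qed

context group
begin

text \<open>P acts on the right cosets of S. Their number m is prime to p, so some coset S x is
  fixed, and S x g = S x for all g in P says that x P x^-1 lies in S.\<close>

lemma sylow_conjugate:
  assumes fin: "finite (carrier G)" and p: "Factorial_Ring.prime (p::nat)"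
    and P: "subgroup P G" "card P = p ^ i"
    and S: "subgroup S G" "order G = card S * m" "\<not> p dvd m"
  shows "\<exists>g\<in>carrier G. conj_set G g P \<subseteq> S"
proof -
  interpret S: subgroup S G by (rule S)
  have Pc: "P \<subseteq> carrier G" using P subgroup.subset by blast
  have posS: "card S > 0" using S fin subgroup.finite_imp_card_positive by blast
  have card: "card (rcosets S) = m" using lagrange[OF S(1)] S(2) posS by simp
  \<comment> \<open>The inverse turns right multiplication into a left action.\<close>
  let ?act = "\<lambda>g C. C #> inv g"
  let ?F = "{C\<in>rcosets S. \<forall>g\<in>carrier (G\<lparr>carrier := P\<rparr>). ?act g C = C}"
  have "[card (rcosets S) = card ?F] (mod p)"
  proof (rule p_group_fixed_points[OF subgroup_imp_group[OF P(1)] _ p])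
    show "order (G\<lparr>carrier := P\<rparr>) = p ^ i" using P by (simp add: order_def)
    show "finite (rcosets S)" using fin by (simp add: RCOSETS_def)
    show "C #> inv g \<in> rcosets S" if g: "g \<in> carrier (G\<lparr>carrier := P\<rparr>)" and C: "C \<in> rcosets S" for g C
    proof -
      obtain x where "x \<in> carrier G" "C = S #> x" using C unfolding RCOSETS_def by blast
      then have "C #> inv g = S #> (x \<otimes> inv g)" "x \<otimes> inv g \<in> carrier G"
        using g Pc S.subset by (auto simp: coset_mult_assoc)
      then show ?thesis by (auto simp: RCOSETS_def)
    qed
    show "C #> inv \<one>\<^bsub>G\<lparr>carrier := P\<rparr>\<^esub> = C" if "C \<in> rcosets S" for C
      using that S.rcosets_carrier[OF is_group that] by simp
    show "C #> inv (g \<otimes>\<^bsub>G\<lparr>carrier := P\<rparr>\<^esub> h) = C #> inv h #> inv g"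
      if "g \<in> carrier (G\<lparr>carrier := P\<rparr>)" "h \<in> carrier (G\<lparr>carrier := P\<rparr>)" "C \<in> rcosets S" for g h C
    proof -
      have "C \<subseteq> carrier G" "g \<in> carrier G" "h \<in> carrier G"
        using that Pc S.rcosets_carrier[OF is_group that(3)] by auto
      then show ?thesis by (simp add: coset_mult_assoc inv_mult_group)
    qed
  qed
  then have "m mod p = card ?F mod p" unfolding card cong_def .
  moreover have "m mod p \<noteq> 0" using S(3) by (simp add: dvd_eq_mod_eq_0)
  ultimately have "card ?F mod p \<noteq> 0" by simp
  then have "card ?F \<noteq> 0" by (rule contrapos_nn) simp
  then have "?F \<noteq> {}" by (metis card.empty)
  then obtain C where C: "C \<in> rcosets S" "\<And>g. g \<in> P \<Longrightarrow> C #> inv g = C" by auto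
  obtain x where x: "x \<in> carrier G" "C = S #> x" using C by (auto simp: RCOSETS_def)
  have "cj x g \<in> S" if g: "g \<in> P" for g
  proof -
    have gc: "g \<in> carrier G" using g Pc by blast
    have "C #> inv (inv g) = C" using C(2) g P(1) subgroup.m_inv_closed by metis
    then have "S #> (x \<otimes> g) = S #> x" using x gc S.subset by (simp add: coset_mult_assoc)
    then have "x \<otimes> g \<in> S #> x" using rcos_self[OF _ S(1), of "x \<otimes> g"] x gc by simp
    then show ?thesis using S.rcos_module_imp[OF is_group x(1)] by simp
  qed
  then show ?thesis using x unfolding conj_set_eq by blast
qed

end

section \<open>Group presentations and the quaternion groups\<close>

definition word_class :: "('g word \<times> 'g word) set \<Rightarrow> 'g word \<Rightarrow> 'g word set" where
  "word_class R u = {w. word_eq R u w}"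

definition word_inverse :: "'g word \<Rightarrow> 'g word" where
  "word_inverse w = rev (map (\<lambda>(g, b). (g, \<not> b)) w)"

lemma word_class_eq_iff: "word_class R u = word_class R v \<longleftrightarrow> word_eq R u v"
  unfolding word_class_def using word_eq.refl word_eq.sym word_eq.trans by blast

lemma carrier_presented_group: "carrier (presented_group R) = range (word_class R)"
  unfolding presented_group_def word_class_def quotient_def by auto

lemma one_presented_group: "\<one>\<^bsub>presented_group R\<^esub> = word_class R []"
  unfolding presented_group_def word_class_def by simp

lemma mult_presented_group:
  "word_class R u \<otimes>\<^bsub>presented_group R\<^esub> word_class R v = word_class R (u @ v)"
proof -
  have "word_eq R (u @ v) w" if "word_eq R u u'" "word_eq R v v'" "word_eq R (u' @ v') w" for u' v' w
    using that word_eq.append word_eq.trans by blast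
  then show ?thesis unfolding presented_group_def word_class_def using word_eq.refl by fastforce
qed

lemma word_inverse_left: "word_eq R (word_inverse w @ w) []"
proof (induction w)
  case Nil
  then show ?case by (simp add: word_inverse_def word_eq.refl)
next
  case (Cons l w)
  obtain g b where l: "l = (g, b)" by force
  have "word_eq R ([(g, \<not> b), (g, \<not> \<not> b)] @ w) ([] @ w)"
    by (intro word_eq.append word_eq.cancel word_eq.refl)
  then have "word_eq R (word_inverse w @ ([(g, \<not> b), (g, b)] @ w)) (word_inverse w @ ([] @ w))"
    by (intro word_eq.append[OF word_eq.refl]) simp
  then have "word_eq R (word_inverse (l # w) @ (l # w)) (word_inverse w @ w)"
    by (simp add: l word_inverse_def)
  then show ?case using Cons word_eq.trans by blast
qed

lemma group_presented_group: "group (presented_group R)"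
proof (rule groupI)
  show "\<exists>y\<in>carrier (presented_group R). y \<otimes>\<^bsub>presented_group R\<^esub> x = \<one>\<^bsub>presented_group R\<^esub>"
    if "x \<in> carrier (presented_group R)" for x
    using that by (auto simp: carrier_presented_group one_presented_group mult_presented_group
        word_class_eq_iff intro!: bexI[OF _ rangeI] word_inverse_left)
qed (auto simp: carrier_presented_group one_presented_group mult_presented_group)

fun word_eval :: "('a, 'b) monoid_scheme \<Rightarrow> ('g \<Rightarrow> 'a) \<Rightarrow> 'g word \<Rightarrow> 'a" where
  "word_eval M f [] = \<one>\<^bsub>M\<^esub>"
| "word_eval M f ((g, b) # w) = (if b then f g else inv\<^bsub>M\<^esub> (f g)) \<otimes>\<^bsub>M\<^esub> word_eval M f w"

context group
begin

lemma word_eval_closed: "(\<And>g. f g \<in> carrier G) \<Longrightarrow> word_eval G f w \<in> carrier G"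
  by (induction w) auto

lemma word_eval_append:
  "(\<And>g. f g \<in> carrier G) \<Longrightarrow> word_eval G f (u @ v) = word_eval G f u \<otimes> word_eval G f v"
  by (induction u) (auto simp: word_eval_closed m_assoc)

lemma word_eval_replicate:
  "(\<And>g. f g \<in> carrier G) \<Longrightarrow> word_eval G f (replicate n (g, True)) = f g [^] n"
proof (induction n)
  case (Suc n)
  then have "word_eval G f (replicate (Suc n) (g, True)) = f g \<otimes> f g [^] n" by simp
  also have "\<dots> = f g [^] Suc n" using Suc(2) nat_pow_Suc2[of "f g" n] by presburger
  finally show ?case .
qed simp

text \<open>Von Dyck's theorem: evaluation is invariant under \<open>word_eq\<close>, by induction
  on its derivation, and so descends to classes of words.\<close>

lemma presented_group_hom:
  assumes f: "\<And>g. f g \<in> carrier G"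
    and R: "\<And>u v. (u, v) \<in> R \<Longrightarrow> word_eval G f u = word_eval G f v"
  obtains h where "h \<in> hom (presented_group R) G" "\<And>w. h (word_class R w) = word_eval G f w"
proof -
  have resp: "word_eval G f u = word_eval G f v" if "word_eq R u v" for u v
    using that
  proof induction
    case (cancel g b)
    then show ?case using f by (cases b) auto
  qed (use R f in \<open>auto simp: word_eval_append\<close>)
  define h where "h = (\<lambda>U. word_eval G f (SOME u. u \<in> U))"
  have h: "h (word_class R w) = word_eval G f w" for w
  proof -
    have "w \<in> word_class R w" by (simp add: word_class_def word_eq.refl)
    then have "(SOME u. u \<in> word_class R w) \<in> word_class R w" by (rule someI)
    then show ?thesis unfolding h_def word_class_def using resp by auto
  qed
  have "h \<in> hom (presented_group R) G"
    by (rule homI) (auto simp: carrier_presented_group h mult_presented_group word_eval_append f word_eval_closed)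
  with h that show ?thesis by blast
qed

end

text \<open>The pair (i, a) stands for x^i y^a in a group of order 4 n. Moving y past x^j inverts
  it, whence the sign; y y = x^n accounts for the summand n.\<close>

definition quaternion_model :: "int \<Rightarrow> (int \<times> bool) monoid" where
  "quaternion_model n = \<lparr>carrier = {0..<2 * n} \<times> UNIV,
     mult = (\<lambda>(i, a) (j, b). ((i + (if a then - j else j) + (if a \<and> b then n else 0)) mod (2 * n), a \<noteq> b)),
     one = (0, False)\<rparr>"

lemma group_quaternion_model:
  assumes "n > 0" shows "group (quaternion_model n)"
proof (rule groupI)
  let ?M = "quaternion_model n"
  show "\<exists>y\<in>carrier ?M. y \<otimes>\<^bsub>?M\<^esub> x = \<one>\<^bsub>?M\<^esub>" if "x \<in> carrier ?M" for x
  proof (cases x)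
    case (Pair i a)
    have "((i + n) mod (2 * n) - i + n) mod (2 * n) = (i + n - i + n) mod (2 * n)"
      by (metis mod_add_left_eq mod_diff_left_eq)
    then have "((i + n) mod (2 * n) - i + n) mod (2 * n) = 0" by simp
    \<comment> \<open>The inverse of x^i y is x^(i+n) y, because y^-1 = x^n y.\<close>
    then show ?thesis
      by (intro bexI[of _ "((if a then i + n else - i) mod (2 * n), a)"])
        (use assms in \<open>auto simp: Pair quaternion_model_def mod_simps\<close>)
  qed
  fix x y z assume "x \<in> carrier ?M" "y \<in> carrier ?M" "z \<in> carrier ?M"
  obtain i a j b k c where xyz: "x = (i, a)" "y = (j, b)" "z = (k, c)" by (metis surj_pair)
  have nn: "(u + (v + n) - w) mod (n * 2) = (u + v - (w + n)) mod (n * 2)" for u v w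
    using mod_add_self2[of "u + v - (w + n)" "n * 2"] by (simp add: algebra_simps)
  have inner: "(u + v mod (n * 2) - w) mod (n * 2) = (u + v - w) mod (n * 2)" for u v w
    by (metis mod_add_right_eq mod_diff_left_eq)
  show "x \<otimes>\<^bsub>?M\<^esub> y \<otimes>\<^bsub>?M\<^esub> z = x \<otimes>\<^bsub>?M\<^esub> (y \<otimes>\<^bsub>?M\<^esub> z)"
    unfolding xyz quaternion_model_def
    by (cases a; cases b; cases c) (auto simp: mod_simps algebra_simps nn inner)
qed (use assms in \<open>auto simp: quaternion_model_def\<close>)

text \<open>The normal forms x^i y^a, parametrized by \<open>e\<close>, exhaust the presented group,
  because they are closed under left multiplication by letters. Conversely the model satisfies the
  relations, so von Dyck yields \<open>h\<close>; since \<open>h\<close> undoes \<open>e\<close> on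
  the model, it is bijective.\<close>

lemma quaternion_group_iso:
  assumes m: "m \<ge> 3" shows "quaternion_group m \<cong> quaternion_model (2 ^ (m - 2))"
proof -
  define k :: nat where "k = 2 ^ (m - 2)"
  define n :: int where "n = int k"
  have k: "k > 0" "2 ^ (m - 1) = 2 * k"
    using m by (auto simp: k_def simp flip: power_Suc)
  have n: "n > 0" "n = 2 ^ (m - 2)" using k by (simp_all add: n_def k_def)
  define R where "R = {(replicate (2 * k) (gen_x, True), []),
      ([(gen_y, True), (gen_x, True), (gen_y, False)], [(gen_x, False)]),
      ([(gen_y, True), (gen_y, True)], replicate k (gen_x, True))}"
  define P where "P = presented_group R"
  have P: "quaternion_group m = P"
    unfolding quaternion_group_def P_def R_def k(2) by (simp add: k_def)
  define M where "M = quaternion_model n"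
  interpret P: group P unfolding P_def by (rule group_presented_group)
  interpret M: group M unfolding M_def using n by (intro group_quaternion_model)
  let ?c = "word_class R"
  define x where "x = ?c [(gen_x, True)]"
  define y where "y = ?c [(gen_y, True)]"
  have xy [simp]: "x \<in> carrier P" "y \<in> carrier P"
    by (simp_all add: x_def y_def P_def carrier_presented_group)
  have mult: "?c u \<otimes>\<^bsub>P\<^esub> ?c v = ?c (u @ v)" for u v unfolding P_def by (rule mult_presented_group)
  have one: "\<one>\<^bsub>P\<^esub> = ?c []" unfolding P_def by (rule one_presented_group)
  have inv_letter: "?c [(g, False)] = inv\<^bsub>P\<^esub> ?c [(g, True)]" for g
    by (rule P.inv_equality[symmetric])
      (auto simp: P_def carrier_presented_group mult_presented_group one_presented_group word_class_eq_iff
        intro: word_eq.cancel[of R g False, simplified])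
  have pow: "?c (replicate i (gen_x, True)) = x [^]\<^bsub>P\<^esub> i" for i
    by (induction i) (simp_all add: one x_def flip: mult replicate_append_same)
  have rel: "x [^]\<^bsub>P\<^esub> (2 * k) = \<one>\<^bsub>P\<^esub>" "y \<otimes>\<^bsub>P\<^esub> x \<otimes>\<^bsub>P\<^esub> inv\<^bsub>P\<^esub> y = inv\<^bsub>P\<^esub> x" "y \<otimes>\<^bsub>P\<^esub> y = x [^]\<^bsub>P\<^esub> k"
  proof -
    have "?c (replicate (2 * k) (gen_x, True)) = ?c []"
      unfolding word_class_eq_iff by (rule word_eq.rel) (simp add: R_def)
    then show "x [^]\<^bsub>P\<^esub> (2 * k) = \<one>\<^bsub>P\<^esub>" by (simp add: pow one)
    have "?c [(gen_y, True), (gen_x, True), (gen_y, False)] = ?c [(gen_x, False)]"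
      unfolding word_class_eq_iff by (rule word_eq.rel) (simp add: R_def)
    then show "y \<otimes>\<^bsub>P\<^esub> x \<otimes>\<^bsub>P\<^esub> inv\<^bsub>P\<^esub> y = inv\<^bsub>P\<^esub> x"
      by (simp add: x_def y_def mult flip: inv_letter)
    have "?c [(gen_y, True), (gen_y, True)] = ?c (replicate k (gen_x, True))"
      unfolding word_class_eq_iff by (rule word_eq.rel) (simp add: R_def)
    then show "y \<otimes>\<^bsub>P\<^esub> y = x [^]\<^bsub>P\<^esub> k" by (simp add: pow) (simp add: y_def mult)
  qed
  define e where "e = (\<lambda>(i::int, a). x [^]\<^bsub>P\<^esub> i \<otimes>\<^bsub>P\<^esub> (if a then y else \<one>\<^bsub>P\<^esub>))"
  have yx: "y \<otimes>\<^bsub>P\<^esub> x [^]\<^bsub>P\<^esub> i = x [^]\<^bsub>P\<^esub> (- i) \<otimes>\<^bsub>P\<^esub> y" for i :: int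
  proof -
    have "y \<otimes>\<^bsub>P\<^esub> x [^]\<^bsub>P\<^esub> i \<otimes>\<^bsub>P\<^esub> inv\<^bsub>P\<^esub> y = x [^]\<^bsub>P\<^esub> (- i)"
      using P.cj_int_pow[of y x i] by (simp add: rel P.int_pow_inv P.int_pow_neg)
    then show ?thesis by (metis P.inv_solve_right' P.int_pow_closed P.m_closed xy)
  qed
  have yy: "y \<otimes>\<^bsub>P\<^esub> y = x [^]\<^bsub>P\<^esub> n" using rel(3) by (simp add: n_def int_pow_int)
  have e_x: "x [^]\<^bsub>P\<^esub> j \<otimes>\<^bsub>P\<^esub> e (i, a) = e (j + i, a)" for i j :: int and a
    by (simp add: e_def P.int_pow_mult P.m_assoc)
  have e_y: "y \<otimes>\<^bsub>P\<^esub> e (i, a) = e (if a then n - i else - i, \<not> a)" for i a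
  proof -
    have "y \<otimes>\<^bsub>P\<^esub> e (i, a) = x [^]\<^bsub>P\<^esub> (- i) \<otimes>\<^bsub>P\<^esub> (y \<otimes>\<^bsub>P\<^esub> (if a then y else \<one>\<^bsub>P\<^esub>))"
      unfolding e_def using yx[of i] by (simp flip: P.m_assoc)
    also have "\<dots> = e (if a then n - i else - i, \<not> a)"
      using yy P.int_pow_mult[of x "- i" n] by (auto simp: e_def)
    finally show ?thesis .
  qed
  have word_e: "?c w \<in> range e" for w
  proof (induction w)
    case Nil
    have "?c [] = e (0, False)" by (simp add: e_def flip: one)
    then show ?case by blast
  next
    case (Cons l w)
    obtain g b where l: "l = (g, b)" by force
    obtain i a where ia: "?c w = e (i, a)" using Cons by auto
    have split: "?c (l # w) = ?c [l] \<otimes>\<^bsub>P\<^esub> e (i, a)" using mult[of "[l]" w] ia by simp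
    \<comment> \<open>Replaces the letter y^-1 by a word in powers of x and y, for which
      \<open>e_x\<close> and \<open>e_y\<close> already describe left multiplication.\<close>
    have invy: "inv\<^bsub>P\<^esub> y = x [^]\<^bsub>P\<^esub> n \<otimes>\<^bsub>P\<^esub> y"
    proof (rule P.inv_equality)
      have "x [^]\<^bsub>P\<^esub> n \<otimes>\<^bsub>P\<^esub> y \<otimes>\<^bsub>P\<^esub> y = x [^]\<^bsub>P\<^esub> (n + n)" using P.int_pow_mult[of x n n] by (simp add: P.m_assoc yy)
      also have "n + n = int (2 * k)" by (simp add: n_def)
      finally show "x [^]\<^bsub>P\<^esub> n \<otimes>\<^bsub>P\<^esub> y \<otimes>\<^bsub>P\<^esub> y = \<one>\<^bsub>P\<^esub>" using rel(1) by (simp only: int_pow_int)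
    qed auto
    have ec: "e p \<in> carrier P" for p by (auto simp: e_def split: prod.split)
    have "?c [l] \<otimes>\<^bsub>P\<^esub> e (i, a) \<in> range e"
    proof (cases g; cases b)
      assume "g = gen_x" "b"
      then show ?thesis using e_x[of 1 i a] by (simp add: l flip: x_def)
    next
      assume "g = gen_x" "\<not> b"
      then show ?thesis using e_x[of "-1" i a] by (simp add: l inv_letter P.int_pow_neg flip: x_def)
    next
      assume "g = gen_y" "b"
      then show ?thesis using e_y[of i a] by (simp add: l flip: y_def)
    next
      assume "g = gen_y" "\<not> b"
      then have "?c [l] \<otimes>\<^bsub>P\<^esub> e (i, a) = x [^]\<^bsub>P\<^esub> n \<otimes>\<^bsub>P\<^esub> (y \<otimes>\<^bsub>P\<^esub> e (i, a))"
        using ec by (simp add: l inv_letter invy P.m_assoc flip: y_def)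
      then show ?thesis unfolding e_y e_x by blast
    qed
    then show ?case using split by simp
  qed
  have e_mod: "e (i, a) = e (i mod (2 * n), a)" for i a
  proof -
    have "x [^]\<^bsub>P\<^esub> i = x [^]\<^bsub>P\<^esub> (2 * n * (i div (2 * n)) + i mod (2 * n))" by simp
    also have "\<dots> = (x [^]\<^bsub>P\<^esub> (2 * n)) [^]\<^bsub>P\<^esub> (i div (2 * n)) \<otimes>\<^bsub>P\<^esub> x [^]\<^bsub>P\<^esub> (i mod (2 * n))"
      by (simp only: P.int_pow_mult[OF xy(1)] P.int_pow_pow[OF xy(1)])
    also have "2 * n = int (2 * k)" by (simp add: n_def)
    also have "x [^]\<^bsub>P\<^esub> int (2 * k) = \<one>\<^bsub>P\<^esub>" using rel(1) by (simp only: int_pow_int)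
    finally show ?thesis by (simp add: e_def n_def)
  qed
  have cP: "carrier P = e ` carrier M"
  proof
    show "e ` carrier M \<subseteq> carrier P" by (auto simp: e_def)
    show "carrier P \<subseteq> e ` carrier M"
    proof
      fix s assume "s \<in> carrier P"
      then obtain i a where "s = e (i, a)" using word_e by (auto simp: P_def carrier_presented_group) (metis imageE surj_pair)
      then have "s = e (i mod (2 * n), a)" using e_mod by simp
      moreover have "(i mod (2 * n), a) \<in> carrier M" using n by (simp add: M_def quaternion_model_def)
      ultimately show "s \<in> e ` carrier M" by blast
    qed
  qed
  define f where "f = (\<lambda>g. case g of gen_x \<Rightarrow> (1 mod (2 * n), False) | gen_y \<Rightarrow> (0::int, True))"
  have fc: "f g \<in> carrier M" for g using n by (cases g) (auto simp: f_def M_def quaternion_model_def)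
  have fpow: "f gen_x [^]\<^bsub>M\<^esub> i = (int i mod (2 * n), False)" for i :: nat
    by (induction i) (simp_all add: f_def M_def quaternion_model_def mod_simps add.commute)
  have finv: "inv\<^bsub>M\<^esub> (f gen_x) = (- 1 mod (2 * n), False)" "inv\<^bsub>M\<^esub> (f gen_y) = (n, True)"
    by (rule M.inv_equality; use n in \<open>auto simp: f_def M_def quaternion_model_def mod_simps\<close>)+
  obtain h where h: "h \<in> hom P M" "\<And>w. h (?c w) = word_eval M f w"
  proof (rule M.presented_group_hom[of f R])
    show "f g \<in> carrier M" for g by (rule fc)
    show "word_eval M f u = word_eval M f v" if "(u, v) \<in> R" for u v
    proof -
      have 1: "word_eval M f (replicate i (gen_x, True)) = (int i mod (2 * n), False)" for i
        using M.word_eval_replicate[of f i gen_x] fc fpow by simp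
      have 2: "word_eval M f [(gen_y, True), (gen_x, True), (gen_y, False)] = word_eval M f [(gen_x, False)]"
        using n by (simp add: finv) (simp add: f_def M_def quaternion_model_def mod_simps)
      have 3: "word_eval M f [(gen_y, True), (gen_y, True)] = (n, False)"
        using n by (simp add: f_def M_def quaternion_model_def)
      have 4: "word_eval M f [] = (0, False)" by (simp add: M_def quaternion_model_def)
      show ?thesis using that 1[of k] 1[of "2 * k"] 2 3 4 n unfolding R_def by (auto simp: n_def)
    qed
  qed (auto simp: P_def)
  interpret h: group_hom P M h using h by (simp add: group_hom_def group_hom_axioms_def P.is_group M.is_group)
  have hx: "h x = f gen_x" "h y = f gen_y" using h(2) fc by (simp_all add: x_def y_def)
  have "h (e p) = p" if "p \<in> carrier M" for p
  proof -
    obtain i a where p: "p = (i, a)" "0 \<le> i" "i < 2 * n" using \<open>p \<in> carrier M\<close> by (cases p) (auto simp: M_def quaternion_model_def)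
    obtain q where q: "i = int q" using p(2) nonneg_int_cases by blast
    have "h (e p) = f gen_x [^]\<^bsub>M\<^esub> q \<otimes>\<^bsub>M\<^esub> (if a then f gen_y else \<one>\<^bsub>M\<^esub>)"
      by (simp add: p(1) q e_def h.hom_nat_pow hx int_pow_int)
    also have "\<dots> = p" using p n q by (simp add: fpow) (simp add: f_def M_def quaternion_model_def)
    finally show ?thesis .
  qed
  then have "bij_betw h (carrier P) (carrier M)"
    unfolding cP by (intro bij_betw_byWitness[where f' = e]) auto
  then have "h \<in> iso P M" using h(1) by (simp add: iso_def)
  then show ?thesis unfolding P M_def n(2)[symmetric] is_iso_def by blast
qed

lemma card_quaternion_model: "n \<ge> 0 \<Longrightarrow> card (carrier (quaternion_model n)) = nat (4 * n)"
  by (simp add: quaternion_model_def card_cartesian_product nat_mult_distrib)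

lemma quaternion_model_nonabelian:
  assumes "n \<ge> 2"
  shows "\<exists>x\<in>carrier (quaternion_model n). \<exists>y\<in>carrier (quaternion_model n).
    x \<otimes>\<^bsub>quaternion_model n\<^esub> y \<noteq> y \<otimes>\<^bsub>quaternion_model n\<^esub> x"
proof (intro bexI)
  have "(- 1) mod (2 * n) = 2 * n - 1" using assms by (simp add: zmod_minus1)
  then show "(1, False) \<otimes>\<^bsub>quaternion_model n\<^esub> (0, True) \<noteq> (0, True) \<otimes>\<^bsub>quaternion_model n\<^esub> (1, False)"
    using assms by (simp add: quaternion_model_def)
qed (use assms in \<open>auto simp: quaternion_model_def\<close>)

text \<open>The facts about Q8 needed later: a unique involution z, and commutators in {1, z}. They
  are checked over the eight elements.\<close>

lemma quaternion_model_2: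
  fixes x y :: "int \<times> bool"
  defines "Q \<equiv> quaternion_model 2" and "z \<equiv> (2, False)"
  shows "z \<in> carrier Q" "z \<noteq> \<one>\<^bsub>Q\<^esub>" "z \<otimes>\<^bsub>Q\<^esub> z = \<one>\<^bsub>Q\<^esub>"
    "x \<in> carrier Q \<Longrightarrow> x \<otimes>\<^bsub>Q\<^esub> x = \<one>\<^bsub>Q\<^esub> \<Longrightarrow> x = \<one>\<^bsub>Q\<^esub> \<or> x = z"
    "x \<in> carrier Q \<Longrightarrow> y \<in> carrier Q \<Longrightarrow> x \<otimes>\<^bsub>Q\<^esub> y = y \<otimes>\<^bsub>Q\<^esub> x \<or> x \<otimes>\<^bsub>Q\<^esub> y = z \<otimes>\<^bsub>Q\<^esub> (y \<otimes>\<^bsub>Q\<^esub> x)"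
proof -
  have set4: "{0..<4::int} = {0, 1, 2, 3}" by auto
  show "z \<in> carrier Q" "z \<noteq> \<one>\<^bsub>Q\<^esub>" "z \<otimes>\<^bsub>Q\<^esub> z = \<one>\<^bsub>Q\<^esub>"
    by (simp_all add: Q_def z_def quaternion_model_def)
  show "x \<in> carrier Q \<Longrightarrow> x \<otimes>\<^bsub>Q\<^esub> x = \<one>\<^bsub>Q\<^esub> \<Longrightarrow> x = \<one>\<^bsub>Q\<^esub> \<or> x = z"
    by (cases x; cases "snd x") (auto simp: Q_def z_def quaternion_model_def set4)
  show "x \<in> carrier Q \<Longrightarrow> y \<in> carrier Q \<Longrightarrow> x \<otimes>\<^bsub>Q\<^esub> y = y \<otimes>\<^bsub>Q\<^esub> x \<or> x \<otimes>\<^bsub>Q\<^esub> y = z \<otimes>\<^bsub>Q\<^esub> (y \<otimes>\<^bsub>Q\<^esub> x)"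
    by (cases x; cases y; cases "snd x"; cases "snd y") (auto simp: Q_def z_def quaternion_model_def set4)
qed

section \<open>The group \<open>SL\<^sub>2(F\<^sub>5)\<close>\<close>

definition m2 :: "5 \<Rightarrow> 5 \<Rightarrow> 5 \<Rightarrow> 5 \<Rightarrow> 5 ^ 2 ^ 2" where
  "m2 a b c d = (\<chi> i j. if i = 1 then (if j = 1 then a else b) else (if j = 1 then c else d))"

text \<open>Reduces numerals and their negatives to the residues 0 to 4, so that simp computes in
  the field.\<close>

lemma F5_numerals [simp]:
  "- (1::5) = 4" "- (2::5) = 3" "- (3::5) = 2" "- (4::5) = 1"
  "(5::5) = 0"
  "(6::5) = 1"
  "(7::5) = 2"
  "(8::5) = 3"
  "(9::5) = 4"
  "(10::5) = 0"
  "(11::5) = 1"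
  "(12::5) = 2"
  "(13::5) = 3"
  "(14::5) = 4"
  "(15::5) = 0"
  "(16::5) = 1"
  "(17::5) = 2"
  "(18::5) = 3"
  "(19::5) = 4"
  "(20::5) = 0"
  "(21::5) = 1"
  "(22::5) = 2"
  "(23::5) = 3"
  "(24::5) = 4"
  "(25::5) = 0"
  "(26::5) = 1"
  "(27::5) = 2"
  "(28::5) = 3"
  "(29::5) = 4"
  "(30::5) = 0"
  "(31::5) = 1"
  "(32::5) = 2"
  "(33::5) = 3"
  "(34::5) = 4"
  "(35::5) = 0"
  "(36::5) = 1"
  "(37::5) = 2"
  "(38::5) = 3"
  "(39::5) = 4"
  "(40::5) = 0"
  by simp_all

lemma F5_cases:
  fixes x :: 5
  obtains "x = 0" | "x = 1" | "x = 2" | "x = 3" | "x = 4"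
proof (cases x rule: bit1_cases)
  case (of_int z)
  then have "z \<in> {0, 1, 2, 3, 4}" by auto
  then show ?thesis using that of_int by auto
qed

lemma F5_mult_eq_0: "x * y = 0 \<Longrightarrow> x = 0 \<or> y = 0" for x y :: 5
  by (cases x rule: F5_cases; cases y rule: F5_cases) simp_all

text \<open>Fermat's little theorem, bracketed so as to exhibit x^3 as the inverse of x; divisions
  below appear as multiplications by a cube.\<close>

lemma F5_pow4: "x \<noteq> 0 \<Longrightarrow> x * (x * x * x) = 1" for x :: 5
  by (cases x rule: F5_cases) simp_all

lemma F5_square_eq_1: "x * x = 1 \<Longrightarrow> x = 1 \<or> x = 4" for x :: 5
  by (cases x rule: F5_cases) simp_all

lemma m2_cases:
  obtains a b c d where "M = m2 a b c d"
proof -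
  have "M = m2 (M $ 1 $ 1) (M $ 1 $ 2) (M $ 2 $ 1) (M $ 2 $ 2)"
    by (simp add: m2_def vec_eq_iff forall_2)
  then show ?thesis using that by blast
qed

lemma m2_eq_iff: "m2 a b c d = m2 a' b' c' d' \<longleftrightarrow> a = a' \<and> b = b' \<and> c = c' \<and> d = d'"
  by (auto simp: m2_def vec_eq_iff forall_2)

lemma m2_mult:
  "m2 a b c d ** m2 a' b' c' d' = m2 (a * a' + b * c') (a * b' + b * d') (c * a' + d * c') (c * b' + d * d')"
  by (simp add: m2_def matrix_matrix_mult_def vec_eq_iff forall_2 sum_2)

lemma det_m2: "det (m2 a b c d) = a * d - b * c"
  by (simp add: det_2 m2_def)

lemma mat_1_m2: "mat 1 = m2 1 0 0 1"
  by (simp add: m2_def mat_def vec_eq_iff forall_2)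

lemma m2_in_SL2: "m2 a b c d \<in> carrier SL2_F5 \<longleftrightarrow> a * d - b * c = 1"
  by (simp add: SL2_F5_def det_m2)

lemma SL2_simps [simp]:
  "x \<otimes>\<^bsub>SL2_F5\<^esub> y = x ** y" "\<one>\<^bsub>SL2_F5\<^esub> = m2 1 0 0 1"
  by (simp_all add: SL2_F5_def mat_1_m2)

lemma SL2_cases:
  assumes "M \<in> carrier SL2_F5"
  obtains a b c d where "M = m2 a b c d" "a * d - b * c = 1"
  using assms m2_in_SL2 m2_cases by metis

lemma group_SL2_F5: "group SL2_F5"
proof (rule groupI)
  show "\<exists>y\<in>carrier SL2_F5. y \<otimes>\<^bsub>SL2_F5\<^esub> x = \<one>\<^bsub>SL2_F5\<^esub>" if x: "x \<in> carrier SL2_F5" for x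
  proof -
    obtain a b c d where m: "x = m2 a b c d" "a * d - b * c = 1" using SL2_cases[OF x] .
    show ?thesis
      by (rule bexI[of _ "m2 d (- b) (- c) a"]) (use m in \<open>auto simp: m2_in_SL2 m2_mult m2_eq_iff algebra_simps\<close>)
  qed
qed (auto simp: SL2_F5_def det_mul matrix_mul_assoc simp flip: mat_1_m2)

interpretation SL2: group SL2_F5 by (rule group_SL2_F5)

text \<open>120 = 100 + 20. If a is nonzero, then a, b, c are free and d = (1 + b c) / a with 1/a =
  a^3. If a = 0, then b is nonzero, d is free and c = -1/b = 4 b^3.\<close>

lemma card_SL2_F5: "card (carrier SL2_F5) = 120"
proof -
  let ?U = "{1, 2, 3, 4} :: 5 set" and ?F = "{0, 1, 2, 3, 4} :: 5 set"
  let ?f = "\<lambda>(a, b, c). m2 a b c ((1 + b * c) * (a * a * a))"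
  let ?g = "\<lambda>(b, d). m2 0 b (4 * (b * b * b)) d"
  have F: "x \<in> ?F" for x by (cases x rule: F5_cases) auto
  have U: "x \<in> ?U \<longleftrightarrow> x \<noteq> 0" for x by (cases x rule: F5_cases) auto
  have carrier_eq: "carrier SL2_F5 = ?f ` (?U \<times> ?F \<times> ?F) \<union> ?g ` (?U \<times> ?F)"
  proof (intro equalityI subsetI)
    fix M assume "M \<in> carrier SL2_F5"
    then obtain a b c d where M: "M = m2 a b c d" "a * d - b * c = 1" by (rule SL2_cases)
    show "M \<in> ?f ` (?U \<times> ?F \<times> ?F) \<union> ?g ` (?U \<times> ?F)"
    proof (cases "a = 0")
      case False
      have "(a * d) * (a * a * a) = (a * (a * a * a)) * d" by (simp add: ac_simps)
      then have "d = (a * d) * (a * a * a)" using F5_pow4[OF False] by simp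
      also have "a * d = 1 + b * c" using M(2) by (simp add: algebra_simps)
      finally have "M = ?f (a, b, c)" using M(1) by simp
      moreover have "(a, b, c) \<in> ?U \<times> ?F \<times> ?F" using F U False by blast
      ultimately show ?thesis by blast
    next
      case True
      have "b * c = - (a * d - b * c)" using True by simp
      then have bc: "b * c = - 1" using M(2) by simp
      then have b: "b \<noteq> 0" by auto
      have "(b * c) * (b * b * b) = (b * (b * b * b)) * c" by (simp add: ac_simps)
      then have "c = (b * c) * (b * b * b)" using F5_pow4[OF b] by simp
      then have "M = ?g (b, d)" using M(1) True bc by simp
      moreover have "(b, d) \<in> ?U \<times> ?F" using F U b by blast
      ultimately show ?thesis by blast
    qed
  next
    fix M assume "M \<in> ?f ` (?U \<times> ?F \<times> ?F) \<union> ?g ` (?U \<times> ?F)"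
    then consider a b c where "a \<noteq> 0" "M = ?f (a, b, c)" | b d where "b \<noteq> 0" "M = ?g (b, d)"
      using U by blast
    then show "M \<in> carrier SL2_F5"
    proof cases
      case 1
      have "a * ((1 + b * c) * (a * a * a)) = (1 + b * c) * (a * (a * a * a))" by (simp add: ac_simps)
      then show ?thesis using 1 F5_pow4 by (simp add: m2_in_SL2)
    next
      case 2
      have "b * (4 * (b * b * b)) = 4 * (b * (b * b * b))" by (simp add: ac_simps)
      then show ?thesis using 2 F5_pow4[of b] by (simp add: m2_in_SL2)
    qed
  qed
  have cards: "card ?U = 4" "card ?F = 5" by simp_all
  have "inj ?f" by (rule injI) (auto simp: m2_eq_iff)
  then have "card (?f ` (?U \<times> ?F \<times> ?F)) = card (?U \<times> ?F \<times> ?F)"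
    by (rule card_image[OF inj_on_subset[OF _ subset_UNIV]])
  then have card_f: "card (?f ` (?U \<times> ?F \<times> ?F)) = 100" unfolding card_cartesian_product cards by simp
  have "inj ?g" by (rule injI) (auto simp: m2_eq_iff)
  then have "card (?g ` (?U \<times> ?F)) = card (?U \<times> ?F)"
    by (rule card_image[OF inj_on_subset[OF _ subset_UNIV]])
  then have card_g: "card (?g ` (?U \<times> ?F)) = 20" unfolding card_cartesian_product cards by simp
  have "?f (a, b, c) \<noteq> ?g (b', d)" if "a \<in> ?U" for a b c b' d
    using that unfolding U by (simp add: m2_eq_iff)
  then have disj: "?f ` (?U \<times> ?F \<times> ?F) \<inter> ?g ` (?U \<times> ?F) = {}" by blast
  have fin: "finite (?f ` (?U \<times> ?F \<times> ?F))" "finite (?g ` (?U \<times> ?F))" by (rule finite)+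
  show ?thesis unfolding carrier_eq card_Un_disjoint[OF fin disj] card_f card_g by simp
qed

section \<open>Powers and traces of matrices of determinant 1\<close>

text \<open>\<open>u M - v\<close>, the shape of the powers of \<open>M\<close> by the Cayley--Hamilton theorem\<close>

definition lin :: "5 \<Rightarrow> 5 \<Rightarrow> 5 ^ 2 ^ 2 \<Rightarrow> 5 ^ 2 ^ 2" where
  "lin u v M = m2 (u * M $ 1 $ 1 - v) (u * M $ 1 $ 2) (u * M $ 2 $ 1) (u * M $ 2 $ 2 - v)"

definition tr2 :: "5 ^ 2 ^ 2 \<Rightarrow> 5" where "tr2 M = M $ 1 $ 1 + M $ 2 $ 2"

lemma lin_m2: "lin u v (m2 a b c d) = m2 (u * a - v) (u * b) (u * c) (u * d - v)"
  by (simp add: lin_def m2_def)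

lemma tr2_m2: "tr2 (m2 a b c d) = a + d"
  by (simp add: tr2_def m2_def)

text \<open>For determinant 1 and trace t one has M^2 = t M - 1, so multiplying u M - v by M gives
  (u t - v) M - u: a recursion for the powers of M.\<close>

lemma lin_mult: "M \<in> carrier SL2_F5 \<Longrightarrow> lin u v M ** M = lin (u * tr2 M - v) u M"
proof (erule SL2_cases)
  fix a b c d assume M: "M = m2 a b c d" and "a * d - b * c = 1"
  then have "u * (a * d) = u * (1 + b * c)" by (simp add: diff_eq_eq)
  then show ?thesis by (simp add: M lin_m2 tr2_m2 m2_mult m2_eq_iff algebra_simps)
qed

lemma lin_1: "lin 1 0 M = M"
  by (rule m2_cases[of M]) (simp add: lin_m2)

text \<open>The scalar matrices of determinant 1 are 1 and -1, and -1 is written with entries 4. Any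
  other M is linearly independent of the identity.\<close>

lemma lin_scalar:
  assumes M: "M \<in> carrier SL2_F5" "M \<noteq> m2 1 0 0 1" "M \<noteq> m2 4 0 0 4"
    and l: "lin u v M = m2 e 0 0 e"
  shows "u = 0 \<and> v = - e"
proof -
  obtain a b c d where m: "M = m2 a b c d" "a * d - b * c = 1" using SL2_cases[OF M(1)] .
  have e: "u * a - v = e" "u * b = 0" "u * c = 0" "u * d - v = e"
    using l by (simp_all add: m lin_m2 m2_eq_iff)
  have "u = 0"
  proof (rule ccontr)
    assume "u \<noteq> 0"
    then have bc: "b = 0" "c = 0" using e F5_mult_eq_0 by blast+
    have "u * (a - d) = 0" using e by (simp add: algebra_simps)
    then have "a = d" using F5_mult_eq_0 \<open>u \<noteq> 0\<close> by fastforce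
    then have "a = 1 \<or> a = 4" using m bc F5_square_eq_1 by simp
    then show False using M m bc \<open>a = d\<close> by auto
  qed
  moreover from this have "e = - v" using e(1) by simp
  ultimately show ?thesis by simp
qed

text \<open>For any other M, equating M^2 = t M - 1 with 1 would force 1 = -1 in the field.\<close>

lemma SL2_involution:
  assumes M: "M \<in> carrier SL2_F5" "M ** M = m2 1 0 0 1"
  shows "M = m2 1 0 0 1 \<or> M = m2 4 0 0 4"
proof (rule ccontr)
  assume "\<not> ?thesis"
  moreover have "lin (tr2 M) 1 M = m2 1 0 0 1" using lin_mult[OF M(1), of 1 0] M(2) by (simp add: lin_1)
  ultimately have "(1::5) = - 1" using lin_scalar[OF M(1)] by blast
  then show False by simp
qed

lemma SL2_powers:
  assumes "M \<in> carrier SL2_F5"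
  defines "t \<equiv> tr2 M"
  shows "M ** M = lin t 1 M" "M ** M ** M = lin (t * t - 1) t M"
    "M ** M ** M ** M = lin ((t * t - 1) * t - t) (t * t - 1) M"
    "M ** M ** M ** M ** M = lin (((t * t - 1) * t - t) * t - (t * t - 1)) ((t * t - 1) * t - t) M"
proof -
  show 2: "M ** M = lin t 1 M" using lin_mult[OF assms(1), of 1 0] by (simp add: lin_1 t_def)
  show 3: "M ** M ** M = lin (t * t - 1) t M" unfolding 2 using lin_mult[OF assms(1)] by (simp add: t_def)
  show 4: "M ** M ** M ** M = lin ((t * t - 1) * t - t) (t * t - 1) M"
    unfolding 3 using lin_mult[OF assms(1)] by (simp add: t_def)
  show "M ** M ** M ** M ** M = lin (((t * t - 1) * t - t) * t - (t * t - 1)) ((t * t - 1) * t - t) M"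
    unfolding 4 using lin_mult[OF assms(1)] by (simp add: t_def)
qed

lemma lin_0: "lin 0 v M = m2 (- v) 0 0 (- v)"
  by (rule m2_cases[of M]) (simp add: lin_m2)

text \<open>An element other than \<open>1\<close> and \<open>-1\<close> has order 4, 6, 5, 10 or 3 according as its trace is
  0, 1, 2, 3 or 4.\<close>

lemma SL2_hom_trace:
  assumes h: "h \<in> hom SL2_F5 SL2_F5" and inj: "inj_on h (carrier SL2_F5)"
    and neg: "h (m2 4 0 0 4) = m2 4 0 0 4" and M: "M \<in> carrier SL2_F5"
  shows "tr2 (h M) = tr2 M"
proof (cases "M = m2 1 0 0 1 \<or> M = m2 4 0 0 4")
  case True
  have "h (m2 1 0 0 1) = m2 1 0 0 1" using hom_one[OF h group_SL2_F5 group_SL2_F5] by simp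
  then show ?thesis using True neg by auto
next
  case False
  define N where "N = h M"
  have N: "N \<in> carrier SL2_F5" using h M by (auto simp: N_def hom_def)
  have one: "h (m2 1 0 0 1) = m2 1 0 0 1" using hom_one[OF h group_SL2_F5 group_SL2_F5] by simp
  have "m2 1 0 0 1 \<in> carrier SL2_F5" "m2 4 0 0 4 \<in> carrier SL2_F5" by (simp_all add: m2_in_SL2)
  then have Nn: "N \<noteq> m2 1 0 0 1" "N \<noteq> m2 4 0 0 4"
    using inj M False one neg unfolding N_def inj_on_def by metis+
  have mult: "h (u ** v) = h u ** h v" if "u \<in> carrier SL2_F5" "v \<in> carrier SL2_F5" for u v
    using h that by (auto simp: hom_def)
  have closed: "u ** v \<in> carrier SL2_F5" if "u \<in> carrier SL2_F5" "v \<in> carrier SL2_F5" for u v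
    using SL2.m_closed[OF that] by simp
  have hp: "h (M ** M) = N ** N" "h (M ** M ** M) = N ** N ** N"
    "h (M ** M ** M ** M ** M) = N ** N ** N ** N ** N"
    using M by (simp_all add: mult closed N_def)
  define s where "s = tr2 N"
  note pM = SL2_powers[OF M] and pN = SL2_powers[OF N, folded s_def] and sc = lin_scalar[OF N Nn]
  \<comment> \<open>According to the trace, M satisfies M^2 = -1, M^3 = -1, M^5 = 1, M^5 = -1 or M^3
    = 1. The relation passes to N because h fixes -1, and there it becomes a pair of equations whose
    only solution is the same trace.\<close>
  show ?thesis
    unfolding N_def[symmetric] s_def[symmetric]
  proof (cases "tr2 M" rule: F5_cases)
    case 1
    then have "M ** M = m2 4 0 0 4" using pM(1) by (simp add: lin_0)
    then have "lin s 1 N = m2 4 0 0 4" using hp(1) pN(1) neg by simp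
    then have "s = 0 \<and> (1::5) = - 4" by (rule sc)
    then show "s = tr2 M" using 1 by simp
  next
    case 2
    then have "M ** M ** M = m2 4 0 0 4" using pM(2) by (simp add: lin_0)
    then have "lin (s * s - 1) s N = m2 4 0 0 4" using hp(2) pN(2) neg by simp
    then have "s * s - 1 = 0 \<and> s = - 4" by (rule sc)
    then show "s = tr2 M" using 2 by simp
  next
    case 3
    then have "M ** M ** M ** M ** M = m2 1 0 0 1" using pM(4) by (simp add: lin_0)
    then have "lin (((s * s - 1) * s - s) * s - (s * s - 1)) ((s * s - 1) * s - s) N = m2 1 0 0 1"
      using hp(3) pN(4) one by simp
    then have "((s * s - 1) * s - s) * s - (s * s - 1) = 0 \<and> (s * s - 1) * s - s = - 1" by (rule sc)
    then show "s = tr2 M" using 3 by (cases s rule: F5_cases) simp_all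
  next
    case 4
    then have "M ** M ** M ** M ** M = m2 4 0 0 4" using pM(4) by (simp add: lin_0)
    then have "lin (((s * s - 1) * s - s) * s - (s * s - 1)) ((s * s - 1) * s - s) N = m2 4 0 0 4"
      using hp(3) pN(4) neg by simp
    then have "((s * s - 1) * s - s) * s - (s * s - 1) = 0 \<and> (s * s - 1) * s - s = - 4" by (rule sc)
    then show "s = tr2 M" using 4 by (cases s rule: F5_cases) simp_all
  next
    case 5
    then have "M ** M ** M = m2 1 0 0 1" using pM(2) by (simp add: lin_0)
    then have "lin (s * s - 1) s N = m2 1 0 0 1" using hp(2) pN(2) one by simp
    then have "s * s - 1 = 0 \<and> s = - 1" by (rule sc)
    then show "s = tr2 M" using 5 by simp
  qed
qed

text \<open>Since 2 is a square root of -1 modulo 5, these matrices satisfy i^2 = j^2 = -1 and i j =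
  - j i; they generate a copy of Q8.\<close>

abbreviation "mat_i \<equiv> m2 2 0 0 3"
abbreviation "mat_j \<equiv> m2 0 1 4 0"

text \<open>The trace form is nondegenerate, so a matrix is determined by the traces of its products with
  \<open>1\<close>, \<open>i\<close>, \<open>j\<close> and \<open>i j\<close>.\<close>

lemma SL2_endomorphism_id:
  assumes h: "h \<in> hom SL2_F5 SL2_F5" and inj: "inj_on h (carrier SL2_F5)"
    and i: "h mat_i = mat_i" and j: "h mat_j = mat_j" and M: "M \<in> carrier SL2_F5"
  shows "h M = M"
proof -
  have mult: "h (u ** v) = h u ** h v" if "u \<in> carrier SL2_F5" "v \<in> carrier SL2_F5" for u v
    using h that by (auto simp: hom_def)
  have closed: "u ** v \<in> carrier SL2_F5" if "u \<in> carrier SL2_F5" "v \<in> carrier SL2_F5" for u v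
    using SL2.m_closed[OF that] by simp
  have ij: "mat_i \<in> carrier SL2_F5" "mat_j \<in> carrier SL2_F5" by (simp_all add: m2_in_SL2)
  have "h (mat_i ** mat_i) = mat_i ** mat_i" using mult ij i by simp
  then have neg: "h (m2 4 0 0 4) = m2 4 0 0 4" by (simp add: m2_mult)
  note tr = SL2_hom_trace[OF h inj neg]
  obtain a b c d where m: "M = m2 a b c d" using m2_cases .
  obtain a' b' c' d' where m': "h M = m2 a' b' c' d'" using m2_cases .
  have 1: "a' + d' = a + d" using tr[OF M] unfolding m' unfolding m by (simp add: tr2_m2)
  have 2: "2 * a' + 3 * d' = 2 * a + 3 * d"
    using tr[OF closed[OF ij(1) M]] mult[OF ij(1) M] unfolding i m' unfolding m by (simp add: m2_mult tr2_m2)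
  have 3: "c' + 4 * b' = c + 4 * b"
    using tr[OF closed[OF ij(2) M]] mult[OF ij(2) M] unfolding j m' unfolding m by (simp add: m2_mult tr2_m2)
  have 4: "2 * c' + 2 * b' = 2 * c + 2 * b"
    using tr[OF closed[OF closed[OF ij] M]] mult[OF closed[OF ij] M] mult[OF ij]
    unfolding i j m' unfolding m by (simp add: m2_mult tr2_m2)
  have solve: "x = 0 \<and> y = 0" if "x + y = 0" "2 * x + 3 * y = 0" for x y :: 5
    using that by (cases x rule: F5_cases; cases y rule: F5_cases) simp_all
  have solve': "x = 0 \<and> y = 0" if "x + 4 * y = 0" "2 * x + 2 * y = 0" for x y :: 5
    using that by (cases x rule: F5_cases; cases y rule: F5_cases) simp_all
  have "(a' - a) + (d' - d) = (a' + d') - (a + d)"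
    "2 * (a' - a) + 3 * (d' - d) = (2 * a' + 3 * d') - (2 * a + 3 * d)"
    by (simp_all add: right_diff_distrib)
  then have ad: "a' - a = 0 \<and> d' - d = 0" unfolding 1 2 by (intro solve) simp_all
  have "(c' - c) + 4 * (b' - b) = (c' + 4 * b') - (c + 4 * b)"
    "2 * (c' - c) + 2 * (b' - b) = (2 * c' + 2 * b') - (2 * c + 2 * b)"
    by (simp_all add: right_diff_distrib)
  then have "c' - c = 0 \<and> b' - b = 0" unfolding 3 4 by (intro solve') simp_all
  then show ?thesis using m m' ad by simp
qed

text \<open>The transvections have trace 2, hence fifth power 1. A matrix with nonzero lower left
  entry is a product of an upper, a lower and an upper transvection; the others reach this case
  after multiplication by one more.\<close>

lemma SL2_generated:
  assumes D: "subgroup D SL2_F5"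
    and odd: "\<And>M. M \<in> carrier SL2_F5 \<Longrightarrow> M [^]\<^bsub>SL2_F5\<^esub> (5::nat) = \<one>\<^bsub>SL2_F5\<^esub> \<Longrightarrow> M \<in> D"
  shows "D = carrier SL2_F5"
proof
  show "D \<subseteq> carrier SL2_F5" using D subgroup.subset by blast
  have mD: "u ** v \<in> D" if "u \<in> D" "v \<in> D" for u v using subgroup.m_closed[OF D that] by simp
  have tr2D: "M \<in> D" if M: "M \<in> carrier SL2_F5" "tr2 M = 2" for M
  proof (rule odd[OF M(1)])
    have "M ** M ** M ** M ** M = m2 1 0 0 1" using SL2_powers(4)[OF M(1)] M(2) by (simp add: lin_0)
    moreover have "m2 1 0 0 1 ** M = M" by (rule m2_cases[of M]) (simp add: m2_mult)
    ultimately show "M [^]\<^bsub>SL2_F5\<^esub> (5::nat) = \<one>\<^bsub>SL2_F5\<^esub>" by (simp add: numeral_eq_Suc)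
  qed
  have U: "m2 1 x 0 1 \<in> D" and L: "m2 1 0 x 1 \<in> D" for x
    by (rule tr2D; simp add: m2_in_SL2 tr2_m2)+
  have nz: "m2 a b c d \<in> D" if m: "a * d - b * c = 1" and c: "c \<noteq> 0" for a b c d
  proof -
    \<comment> \<open>These are (a - 1)/c and (d - 1)/c, with c^3 in place of 1/c.\<close>
    let ?x = "(a - 1) * (c * c * c)" and ?y = "(d - 1) * (c * c * c)"
    have "?x * c = (c * (c * c * c)) * (a - 1)" "c * ?y = (c * (c * c * c)) * (d - 1)"
      by (simp_all add: ac_simps)
    then have xc: "?x * c = a - 1" "c * ?y = d - 1" using F5_pow4[OF c] by simp_all
    have "c * (a * ?y + ?x) = a * (c * ?y) + ?x * c" by (simp add: algebra_simps)
    also have "\<dots> = a * d - 1" unfolding xc by (simp add: algebra_simps)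
    also have "\<dots> = c * b" using m by (simp add: algebra_simps)
    finally have "c * (a * ?y + ?x - b) = 0" by (simp add: right_diff_distrib)
    then have b: "a * ?y + ?x = b" using F5_mult_eq_0 c by fastforce
    have "m2 1 ?x 0 1 ** m2 1 0 c 1 ** m2 1 ?y 0 1 = m2 (1 + ?x * c) ((1 + ?x * c) * ?y + ?x) c (c * ?y + 1)"
      by (simp add: m2_mult)
    also have "\<dots> = m2 a b c d" unfolding xc using b by simp
    finally show ?thesis using mD U L by metis
  qed
  show "carrier SL2_F5 \<subseteq> D"
  proof
    fix M assume "M \<in> carrier SL2_F5"
    then obtain a b c d where m: "M = m2 a b c d" "a * d - b * c = 1" by (rule SL2_cases)
    show "M \<in> D"
    proof (cases "c = 0")
      case False
      then show ?thesis using nz m by simp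
    next
      case True
      then have d: "d \<noteq> 0" using m by auto
      \<comment> \<open>This is M times the lower transvection with entry 1, whose lower left entry
        d is nonzero; the transvection with entry 4 = -1 undoes that factor.\<close>
      have "m2 (a + b) b d d \<in> D" by (rule nz) (use m d True in \<open>auto simp: algebra_simps\<close>)
      moreover have "m2 (a + b) b d d ** m2 1 0 4 1 = M"
        using m True by (simp add: m2_mult m2_eq_iff algebra_simps)
      ultimately show ?thesis using mD L by metis
    qed
  qed
qed

text \<open>The eight matrices are 1, i, j, i j and their negatives; closure is a finite
  check.\<close>

lemma SL2_Q8_subgroup:
  "subgroup {m2 1 0 0 1, m2 4 0 0 4, mat_i, m2 3 0 0 2, mat_j, m2 0 4 1 0, m2 0 2 2 0, m2 0 3 3 0} SL2_F5"
  (is "subgroup ?Q _")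
proof (rule SL2.subgroupI)
  show Qc: "?Q \<subseteq> carrier SL2_F5" by (simp add: m2_in_SL2)
  show mult: "a \<otimes>\<^bsub>SL2_F5\<^esub> b \<in> ?Q" if "a \<in> ?Q" "b \<in> ?Q" for a b
  proof -
    have "\<forall>a\<in>?Q. \<forall>b\<in>?Q. a ** b \<in> ?Q" by (simp add: m2_mult m2_eq_iff)
    then show ?thesis using that by (simp only: SL2_simps)
  qed
  show "inv\<^bsub>SL2_F5\<^esub> a \<in> ?Q" if "a \<in> ?Q" for a
  proof -
    have "\<forall>a\<in>?Q. \<exists>b\<in>?Q. b ** a = m2 1 0 0 1" by (simp add: m2_mult m2_eq_iff)
    then have "\<exists>b\<in>?Q. b ** a = m2 1 0 0 1" by (rule bspec) (rule that)
    then obtain b where b: "b \<in> ?Q" "b ** a = m2 1 0 0 1" by (rule bexE)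
    have "inv\<^bsub>SL2_F5\<^esub> a = b"
      by (rule SL2.inv_equality) (use b(2) subsetD[OF Qc that] subsetD[OF Qc b(1)] in simp_all)
    then show ?thesis using b(1) by (simp only:)
  qed
qed simp

section \<open>Subgroups isomorphic to \<open>SL\<^sub>2(F\<^sub>5)\<close>\<close>

context group
begin

lemma lagrange_dvd:
  assumes "subgroup H G" "subgroup K G" "K \<subseteq> H" shows "card K dvd card H"
proof -
  have "card (rcosets\<^bsub>G\<lparr>carrier := H\<rparr>\<^esub> K) * card K = card H"
    using group.lagrange[OF subgroup_imp_group[OF assms(1)] subgroup_incl[OF assms(2,1,3)]]
    by (simp add: order_def)
  then show ?thesis by (metis dvd_triv_right)
qed

text \<open>The coset x^-1 H is disjoint from H, so by counting it is the whole complement of H, and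
  y has the form x^-1 h.\<close>

lemma index_2_mult:
  assumes fin: "finite (carrier G)" and H: "H \<lhd> G" and ord: "order G = 2 * card H"
    and x: "x \<in> carrier G" "x \<notin> H" and y: "y \<in> carrier G" "y \<notin> H"
  shows "x \<otimes> y \<in> H"
proof -
  have sH: "subgroup H G" using H normal_imp_subgroup by blast
  have Hc: "H \<subseteq> carrier G" using sH subgroup.subset by blast
  have finH: "finite H" using fin Hc finite_subset by blast
  let ?C = "(\<lambda>h. inv x \<otimes> h) ` H"
  have Cc: "?C \<subseteq> carrier G" using x Hc by auto
  have "card ?C = card H"
    by (rule card_image) (rule inj_on_subset[OF inj_on_cmult Hc], use x in simp)
  moreover have "H \<inter> ?C = {}"
  proof (rule ccontr)
    assume "H \<inter> ?C \<noteq> {}"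
    then obtain h where h: "h \<in> H" "inv x \<otimes> h \<in> H" by blast
    then have "h \<otimes> inv (inv x \<otimes> h) \<in> H" using sH subgroup.m_closed subgroup.m_inv_closed by metis
    moreover have "h \<otimes> inv (inv x \<otimes> h) = x" using h Hc x by (auto simp: word_simps)
    ultimately show False using x by simp
  qed
  ultimately have "card (H \<union> ?C) = card (carrier G)"
    using ord finH by (simp add: card_Un_disjoint order_def)
  then have "H \<union> ?C = carrier G" using card_subset_eq[OF fin, of "H \<union> ?C"] Hc Cc by simp
  then obtain h where h: "h \<in> H" "y = inv x \<otimes> h" using y by blast
  then have "x \<otimes> y = h" using Hc x by (auto simp: cancel_inv_left)
  then show ?thesis using h by simp
qed

lemma cj_eq_one_iff: "g \<in> carrier G \<Longrightarrow> x \<in> carrier G \<Longrightarrow> cj g x = \<one> \<longleftrightarrow> x = \<one>"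
  using inj_on_eq_iff[OF cj_inj[of g "carrier G"], of x \<one>] by simp

text \<open>A conjugate of z is again an involution of N.\<close>

lemma unique_involution_central:
  assumes N: "N \<lhd> G" and z: "z \<in> N" "z \<noteq> \<one>" "z \<otimes> z = \<one>"
    and unique: "\<And>x. x \<in> N \<Longrightarrow> x \<otimes> x = \<one> \<Longrightarrow> x = \<one> \<or> x = z"
    and g: "g \<in> carrier G"
  shows "z \<otimes> g = g \<otimes> z"
proof -
  have zc: "z \<in> carrier G" using z(1) normal_imp_subgroup[OF N] subgroup.mem_carrier by metis
  have "cj g z \<otimes> cj g z = \<one>" using cj_mult[OF g zc zc] z g by simp
  then have "cj g z = z" using unique[OF normal_cj[OF N g z(1)]] cj_eq_one_iff[OF g zc] z(2) by blast
  then show ?thesis using cj_eq_iff_commute[OF g zc] by simp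
qed

lemma sylow_conjugate_elem:
  assumes fin: "finite (carrier G)" and p: "Factorial_Ring.prime (p::nat)"
    and x: "x \<in> carrier G" "x [^] (p ^ k) = \<one>"
    and S: "subgroup S G" "order G = card S * m" "\<not> p dvd m"
  obtains g where "g \<in> carrier G" "cj g x \<in> S"
proof -
  have "ord x dvd p ^ k" using x pow_eq_id by simp
  then obtain i where "ord x = p ^ i" using divides_primepow_nat[OF p] by blast
  then have "card (generate G {x}) = p ^ i" using generate_pow_card x by simp
  then obtain g where g: "g \<in> carrier G" "conj_set G g (generate G {x}) \<subseteq> S"
    using sylow_conjugate[OF fin p generate_is_subgroup _ S] x by blast
  moreover have "x \<in> generate G {x}" by (simp add: generate.incl)
  ultimately have "cj g x \<in> S" unfolding conj_set_eq by blast
  with g that show ?thesis by blast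
qed

end

text \<open>Fixing an embedding instead of asserting an isomorphism lets statements about
  \<open>S\<close> be checked on matrices. The ambient group matters in \<open>rigid\<close>, where
  the conjugating element may lie outside \<open>S\<close>.\<close>

locale SL2_embedding = group G for G (structure) +
  fixes h S
  assumes hom: "h \<in> hom SL2_F5 G" and inj: "inj_on h (carrier SL2_F5)" and img: "h ` carrier SL2_F5 = S"
begin

sublocale h: group_hom SL2_F5 G h
  using hom by (simp add: group_hom_def group_hom_axioms_def group_SL2_F5 is_group)

lemma SL2_elems:
  "m2 1 0 0 1 \<in> carrier SL2_F5" "m2 4 0 0 4 \<in> carrier SL2_F5" "mat_i \<in> carrier SL2_F5" "mat_j \<in> carrier SL2_F5"
  by (simp_all add: m2_in_SL2)

lemma SL2_mult_closed: "u \<in> carrier SL2_F5 \<Longrightarrow> v \<in> carrier SL2_F5 \<Longrightarrow> u ** v \<in> carrier SL2_F5"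
  using SL2.m_closed[of u v] by simp

lemma h_mult: "u \<in> carrier SL2_F5 \<Longrightarrow> v \<in> carrier SL2_F5 \<Longrightarrow> h (u ** v) = h u \<otimes> h v"
  using h.hom_mult[of u v] by simp

lemma h_one: "h (m2 1 0 0 1) = \<one>"
  using h.hom_one by simp

lemma h_eq: "u \<in> carrier SL2_F5 \<Longrightarrow> v \<in> carrier SL2_F5 \<Longrightarrow> h u = h v \<longleftrightarrow> u = v"
  using inj by (auto simp: inj_on_def)

lemma h_in: "u \<in> carrier SL2_F5 \<Longrightarrow> h u \<in> S"
  using img by blast

lemma S_elem:
  assumes "x \<in> S" obtains u where "u \<in> carrier SL2_F5" "x = h u"
  using assms img by blast

lemma card_S: "card S = 120"
  using card_image[OF inj] img card_SL2_F5 by simp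

definition z where "z = h (m2 4 0 0 4)"

lemma z: "z \<in> S" "z \<noteq> \<one>" "z \<otimes> z = \<one>"
proof -
  show "z \<in> S" using SL2_elems h_in by (simp add: z_def)
  show "z \<noteq> \<one>" using h_eq[OF SL2_elems(2,1)] h_one by (simp add: m2_eq_iff z_def)
  show "z \<otimes> z = \<one>" using h_mult[OF SL2_elems(2,2)] h_one by (simp add: m2_mult z_def)
qed

lemma involution:
  assumes x: "x \<in> S" "x \<otimes> x = \<one>" shows "x = \<one> \<or> x = z"
proof -
  obtain u where u: "u \<in> carrier SL2_F5" "x = h u" by (rule S_elem[OF x(1)])
  have "h (u ** u) = h (m2 1 0 0 1)" using x u h_mult h_one by simp
  then have "u ** u = m2 1 0 0 1" using h_eq SL2_mult_closed[OF u(1) u(1)] SL2_elems(1) by simp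
  then show ?thesis using SL2_involution[OF u(1)] u h_one by (auto simp: z_def)
qed

definition Q where
  "Q = h ` {m2 1 0 0 1, m2 4 0 0 4, mat_i, m2 3 0 0 2, mat_j, m2 0 4 1 0, m2 0 2 2 0, m2 0 3 3 0}"

definition I where "I = h mat_i"
definition J where "J = h mat_j"

lemma Q: "subgroup Q G" "Q \<subseteq> S" "card Q = 8"
proof -
  let ?Q = "{m2 1 0 0 1, m2 4 0 0 4, mat_i, m2 3 0 0 2, mat_j, m2 0 4 1 0, m2 0 2 2 0, m2 0 3 3 0}"
  have Qc: "?Q \<subseteq> carrier SL2_F5" by (simp add: m2_in_SL2)
  show "subgroup Q G" unfolding Q_def by (rule h.subgroup_img_is_subgroup[OF SL2_Q8_subgroup])
  show "Q \<subseteq> S" unfolding Q_def img[symmetric] by (rule image_mono[OF Qc])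
  have "card Q = card ?Q" unfolding Q_def by (rule card_image[OF inj_on_subset[OF inj Qc]])
  also have "card ?Q = 8" by (simp add: m2_eq_iff)
  finally show "card Q = 8" .
qed

lemma IJ: "I \<in> Q" "J \<in> Q" "z \<in> Q" "I \<otimes> J = z \<otimes> (J \<otimes> I)"
proof -
  show "I \<in> Q" "J \<in> Q" "z \<in> Q" unfolding I_def J_def z_def Q_def by (rule imageI; simp)+
  have "mat_i ** mat_j = m2 4 0 0 4 ** (mat_j ** mat_i)" by (simp add: m2_mult)
  then have "h (mat_i ** mat_j) = h (m2 4 0 0 4 ** (mat_j ** mat_i))" by (rule arg_cong)
  then show "I \<otimes> J = z \<otimes> (J \<otimes> I)"
    unfolding I_def J_def z_def
    by (simp only: h_mult SL2_mult_closed SL2_elems)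
qed

lemma square_Q:
  assumes x: "x \<in> Q" shows "x \<otimes> x = \<one> \<or> x \<otimes> x = z"
proof -
  let ?Q = "{m2 1 0 0 1, m2 4 0 0 4, mat_i, m2 3 0 0 2, mat_j, m2 0 4 1 0, m2 0 2 2 0, m2 0 3 3 0}"
  obtain u where u: "u \<in> ?Q" "x = h u" using x unfolding Q_def by (rule imageE) simp
  have "\<forall>u\<in>?Q. u ** u = m2 1 0 0 1 \<or> u ** u = m2 4 0 0 4" by (simp add: m2_mult m2_eq_iff)
  then have "u ** u = m2 1 0 0 1 \<or> u ** u = m2 4 0 0 4" using u(1) by (rule bspec)
  moreover have "u \<in> carrier SL2_F5" by (rule subsetD[OF _ u(1)]) (simp add: m2_in_SL2)
  ultimately show ?thesis using h_mult[of u u] u(2) h_one by (auto simp: z_def)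
qed

lemma generated:
  assumes D: "subgroup D G" and odd: "\<And>x. x \<in> S \<Longrightarrow> x [^] (5::nat) = \<one> \<Longrightarrow> x \<in> D"
  shows "S \<subseteq> D"
proof -
  have "{u \<in> carrier SL2_F5. h u \<in> D} = carrier SL2_F5"
  proof (rule SL2_generated)
    show "subgroup {u \<in> carrier SL2_F5. h u \<in> D} SL2_F5"
    proof (rule SL2.subgroupI)
      have "m2 1 0 0 1 \<in> {u \<in> carrier SL2_F5. h u \<in> D}"
        using subgroup.one_closed[OF D] h_one SL2_elems by simp
      then show "{u \<in> carrier SL2_F5. h u \<in> D} \<noteq> {}" by blast
    qed (use subgroup.m_closed[OF D] subgroup.m_inv_closed[OF D] SL2_mult_closed h_mult in auto)
    show "M \<in> {u \<in> carrier SL2_F5. h u \<in> D}"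
      if M: "M \<in> carrier SL2_F5" "M [^]\<^bsub>SL2_F5\<^esub> (5::nat) = \<one>\<^bsub>SL2_F5\<^esub>" for M
    proof -
      have "h M [^] (5::nat) = h (m2 1 0 0 1)" using M h.hom_nat_pow[OF M(1), of 5] by simp
      then show ?thesis using M(1) odd[OF h_in[OF M(1)]] h_one by simp
    qed
  qed
  then show ?thesis using img by blast
qed

text \<open>Conjugation by f, pulled back along h, is an injective endomorphism of the matrix group
  that fixes i and j; the trace argument makes it the identity.\<close>

lemma rigid:
  assumes f: "f \<in> carrier G" and fS: "\<And>x. x \<in> S \<Longrightarrow> cj f x \<in> S"
    and fI: "cj f I = I" and fJ: "cj f J = J" and x: "x \<in> S"
  shows "cj f x = x"
proof -
  have Sc: "S \<subseteq> carrier G" using img by auto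
  define k where "k = inv_into (carrier SL2_F5) h"
  have hk: "h (k y) = y" "k y \<in> carrier SL2_F5" if "y \<in> S" for y
    using that img by (auto simp: k_def f_inv_into_f inv_into_into)
  have kh: "k (h u) = u" if "u \<in> carrier SL2_F5" for u using that inj by (simp add: k_def)
  define s where "s = (\<lambda>u. k (cj f (h u)))"
  have hs: "h (s u) = cj f (h u)" "s u \<in> carrier SL2_F5" if "u \<in> carrier SL2_F5" for u
    unfolding s_def using hk[OF fS[OF h_in[OF that]]] .
  have hom_s: "s \<in> hom SL2_F5 SL2_F5"
  proof (rule homI)
    fix u v assume u: "u \<in> carrier SL2_F5" and v: "v \<in> carrier SL2_F5"
    have "h (s (u ** v)) = cj f (h u) \<otimes> cj f (h v)"
      using hs(1)[OF SL2_mult_closed[OF u v]] h_mult[OF u v] cj_mult[OF f, of "h u" "h v"] u v by simp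
    also have "\<dots> = h (s u ** s v)" using h_mult hs u v by simp
    finally have "h (s (u ** v)) = h (s u ** s v)" .
    then have "s (u ** v) = s u ** s v"
      by (rule iffD1[OF h_eq[OF hs(2)[OF SL2_mult_closed[OF u v]] SL2_mult_closed[OF hs(2)[OF u] hs(2)[OF v]]]])
    then show "s (u \<otimes>\<^bsub>SL2_F5\<^esub> v) = s u \<otimes>\<^bsub>SL2_F5\<^esub> s v" by simp
  qed (use hs in simp)
  have inj_s: "inj_on s (carrier SL2_F5)"
  proof (rule inj_onI)
    fix u v assume u: "u \<in> carrier SL2_F5" and v: "v \<in> carrier SL2_F5" and "s u = s v"
    then have "cj f (h u) = cj f (h v)" using hs by metis
    then have "h u = h v" using inj_onD[OF cj_inj[OF f Sc]] h_in u v by blast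
    then show "u = v" using h_eq u v by simp
  qed
  obtain u where u: "u \<in> carrier SL2_F5" "x = h u" by (rule S_elem[OF x])
  have "s mat_i = mat_i" "s mat_j = mat_j"
    unfolding s_def using fI fJ kh SL2_elems by (simp_all add: I_def J_def)
  then have "s u = u" by (rule SL2_endomorphism_id[OF hom_s inj_s _ _ u(1)])
  then show ?thesis using hs(1)[OF u(1)] u by simp
qed

text \<open>The transvections are chosen so that a b and c d have trace 0, hence square -1, while (a
  b)(c d) has trace 2 without being 1, hence order 5. One choice thus serves against both closure
  properties that tell \<open>2A5\<close> from the solvable types.\<close>

lemma odd_order_products:
  "\<exists>a\<in>S. \<exists>b\<in>S. \<exists>c\<in>S. \<exists>d\<in>S. a [^] (5::nat) = \<one> \<and> b [^] (5::nat) = \<one> \<and> c [^] (5::nat) = \<one> \<and> d [^] (5::nat) = \<one> \<and>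
    (a \<otimes> b) [^] (4::nat) = \<one> \<and> a \<otimes> b \<noteq> \<one> \<and> (c \<otimes> d) [^] (4::nat) = \<one> \<and>
    (a \<otimes> b \<otimes> (c \<otimes> d)) [^] (5::nat) = \<one> \<and> a \<otimes> b \<otimes> (c \<otimes> d) \<noteq> \<one>"
proof -
  define a b c d where "a = m2 1 1 0 1" and "b = m2 1 0 3 1" and "c = m2 1 2 0 1" and "d = m2 1 0 4 1"
  note abcd = a_def b_def c_def d_def
  have cc: "a \<in> carrier SL2_F5" "b \<in> carrier SL2_F5" "c \<in> carrier SL2_F5" "d \<in> carrier SL2_F5"
    by (simp_all add: abcd m2_in_SL2)
  have p5: "h M [^] (5::nat) = \<one>" if M: "M \<in> carrier SL2_F5" "tr2 M = 2" for M
  proof -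
    have "M ** M ** M ** M ** M = m2 1 0 0 1" using SL2_powers(4)[OF M(1)] M(2) by (simp add: lin_0)
    moreover have "m2 1 0 0 1 ** M = M" by (rule m2_cases[of M]) (simp add: m2_mult)
    ultimately have "M [^]\<^bsub>SL2_F5\<^esub> (5::nat) = m2 1 0 0 1" by (simp add: numeral_eq_Suc)
    then show ?thesis using h.hom_nat_pow[OF M(1), of 5] h_one by simp
  qed
  have p4: "h M [^] (4::nat) = \<one>" if M: "M \<in> carrier SL2_F5" "tr2 M = 0" for M
  proof -
    have "M ** M = m2 4 0 0 4" using SL2_powers(1)[OF M(1)] M(2) by (simp add: lin_0)
    then have "h M \<otimes> h M = z" using h_mult[OF M(1) M(1)] by (simp add: z_def)
    moreover have "h M [^] (4::nat) = (h M \<otimes> h M) \<otimes> (h M \<otimes> h M)"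
      using M(1) by (simp add: numeral_eq_Suc m_assoc)
    ultimately show ?thesis using z(3) by simp
  qed
  have hab: "h a \<otimes> h b = h (a ** b)" "h c \<otimes> h d = h (c ** d)"
    "h (a ** b) \<otimes> h (c ** d) = h (a ** b ** (c ** d))"
    using h_mult SL2_mult_closed cc by simp_all
  have cc2: "a ** b \<in> carrier SL2_F5" "c ** d \<in> carrier SL2_F5" "a ** b ** (c ** d) \<in> carrier SL2_F5"
    using SL2_mult_closed cc by simp_all
  show ?thesis
  proof (rule bexI[of _ "h a"], rule bexI[of _ "h b"], rule bexI[of _ "h c"], rule bexI[of _ "h d"], intro conjI)
    show "h a [^] (5::nat) = \<one>" "h b [^] (5::nat) = \<one>" "h c [^] (5::nat) = \<one>" "h d [^] (5::nat) = \<one>"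
      by (rule p5; use cc in \<open>simp add: abcd tr2_m2\<close>)+
    show "(h a \<otimes> h b) [^] (4::nat) = \<one>" "(h c \<otimes> h d) [^] (4::nat) = \<one>"
      unfolding hab by (rule p4[OF cc2(1)], simp add: abcd tr2_m2 m2_mult, rule p4[OF cc2(2)], simp add: abcd tr2_m2 m2_mult)
    show "(h a \<otimes> h b \<otimes> (h c \<otimes> h d)) [^] (5::nat) = \<one>"
      unfolding hab by (rule p5[OF cc2(3)]) (simp add: abcd tr2_m2 m2_mult)
    have "a ** b ** (c ** d) \<noteq> m2 1 0 0 1" "a ** b \<noteq> m2 1 0 0 1" by (simp_all add: abcd m2_mult m2_eq_iff)
    then show "h a \<otimes> h b \<otimes> (h c \<otimes> h d) \<noteq> \<one>" "h a \<otimes> h b \<noteq> \<one>"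
      unfolding hab using h_eq[OF cc2(1) SL2_elems(1)] h_eq[OF cc2(3) SL2_elems(1)] h_one by simp_all
  qed (use h_in cc in simp_all)
qed

end

context group
begin

lemma SL2_embedding_exists:
  assumes S: "subgroup S G" and iso: "G\<lparr>carrier := S\<rparr> \<cong> SL2_F5"
  obtains h where "SL2_embedding G h S"
proof -
  interpret GS: group "G\<lparr>carrier := S\<rparr>" by (rule subgroup_imp_group[OF S])
  obtain h where h: "h \<in> iso SL2_F5 (G\<lparr>carrier := S\<rparr>)"
    using GS.iso_sym[OF iso] by (auto simp: is_iso_def)
  have Sc: "S \<subseteq> carrier G" using S subgroup.subset by blast
  have "h \<in> hom SL2_F5 G" "inj_on h (carrier SL2_F5)" "h ` carrier SL2_F5 = S"
    using h Sc by (auto simp: iso_def hom_def bij_betw_def)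
  then have "SL2_embedding G h S" by (simp add: SL2_embedding_def SL2_embedding_axioms_def is_group)
  with that show ?thesis .
qed

text \<open>Conjugation by S brings f and f' into one Sylow 2-subgroup P that meets S in Q8. There
  the two differ by an element q of Q8, and it remains to see that q is, up to z, a commutator with
  the first of them.\<close>

lemma SL2_outer_conjugate:
  assumes fin: "finite (carrier G)" and S: "S \<lhd> G" and iso: "G\<lparr>carrier := S\<rparr> \<cong> SL2_F5"
    and ord: "order G = 240"
    and f: "f \<in> carrier G" "f \<notin> S" and f': "f' \<in> carrier G" "f' \<notin> S"
    and ff: "f \<otimes> f = z" "f' \<otimes> f' = z" and z: "z \<in> S" "z \<noteq> \<one>" "z \<otimes> z = \<one>"
    and outer: "\<not> (\<exists>s\<in>S. \<forall>x\<in>S. cj f x = cj s x)"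
  shows "\<exists>s\<in>S. cj s f = f' \<or> cj s f = z \<otimes> f'"
proof -
  have sS: "subgroup S G" using S normal_imp_subgroup by blast
  have Sc: "S \<subseteq> carrier G" using sS subgroup.subset by blast
  obtain h where "SL2_embedding G h S" by (rule SL2_embedding_exists[OF sS iso])
  then interpret h: SL2_embedding G h S .
  define Q where "Q = h.Q"
  define I where "I = h.I"
  define J where "J = h.J"
  note S120 = h.card_S
  note Q = h.Q[folded Q_def] and rigid = h.rigid[folded I_def J_def]
  have zz': "h.z = z" using h.involution[OF z(1,3)] z by auto
  note sq = h.square_Q[folded Q_def, unfolded zz'] and IJ = h.IJ[folded I_def J_def Q_def, unfolded zz']
  have zc: "z \<in> carrier G" using z Sc by blast
  have inv_z: "inv z = z" using z zc inv_equality by blast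
  have index: "order G = 2 * card S" using ord S120 by simp
  have z_central: "z \<otimes> x = x \<otimes> z" if "x \<in> carrier G" for x
    by (rule unique_involution_central[OF S z h.involution[unfolded zz'] that])
  have Qc: "Q \<subseteq> carrier G" using Q Sc by blast
  obtain P1 where P1: "subgroup P1 G" "card P1 = 2 ^ 4"
    using sylow_thm[of 2 G 4 15] is_group fin ord by auto
  have "\<exists>g\<in>carrier G. conj_set G g Q \<subseteq> P1"
    by (rule sylow_conjugate[OF fin _ Q(1) _ P1(1), of 2 3 15]) (use Q P1 ord in auto)
  then obtain g where g: "g \<in> carrier G" "conj_set G g Q \<subseteq> P1" by blast
  define P where "P = conj_set G (inv g) P1"
  have P1c: "P1 \<subseteq> carrier G" using P1 subgroup.subset by blast
  have sP: "subgroup P G" unfolding P_def using conj_set_subgroup P1 g by simp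
  have cP: "card P = 16" unfolding P_def using card_conj_set P1 g P1c by simp
  have "conj_set G (inv g) (conj_set G g Q) \<subseteq> P" unfolding P_def using g(2) unfolding conj_set_eq by (rule image_mono)
  then have QP: "Q \<subseteq> P" using conj_set_conj_set[of "inv g" g Q] conj_set_one g Qc by simp
  \<comment> \<open>The order of the intersection divides gcd(16, 120) = 8, which is already the
    order of Q.\<close>
  have QPS: "P \<inter> S = Q"
  proof -
    have sPS: "subgroup (P \<inter> S) G" using subgroups_Inter_pair sP sS by blast
    have "card (P \<inter> S) dvd card P" "card (P \<inter> S) dvd card S"
      using lagrange_dvd[OF sP sPS] lagrange_dvd[OF sS sPS] by auto
    then have "card (P \<inter> S) dvd gcd 16 120" using cP S120 by (metis gcd_greatest)
    then have "card (P \<inter> S) \<le> 8" by (intro dvd_imp_le) (simp_all add: gcd_non_0_nat)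
    moreover have "finite (P \<inter> S)" using fin Sc finite_subset by blast
    ultimately show ?thesis using card_seteq[of "P \<inter> S" Q] QP Q by auto
  qed
  have fpow: "f [^] ((2::nat) ^ 2) = \<one>" if "f \<in> carrier G" "f \<otimes> f = z" for f
    using that z by (simp add: numeral_eq_Suc m_assoc) (metis m_assoc m_closed)
  have into_P: "\<exists>s\<in>S. cj s f \<in> P" if f: "f \<in> carrier G" "f \<notin> S" "f \<otimes> f = z" for f
  proof -
    obtain e where e: "e \<in> carrier G" "cj e f \<in> P"
      by (rule sylow_conjugate_elem[OF fin _ f(1) fpow[OF f(1,3)] sP, of 15]) (use cP ord in auto)
    show ?thesis
    proof (cases "e \<in> S")
      case False
      \<comment> \<open>e f conjugates f exactly as e does. As S has index 2, one of e and e f lies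
        in S.\<close>
      have "e \<otimes> f \<in> S" by (rule index_2_mult[OF fin S index e(1) False f(1,2)])
      moreover have "cj (e \<otimes> f) f = cj e f" using e(1) f(1) by (simp add: word_simps)
      ultimately show ?thesis using e by metis
    qed (use e in blast)
  qed
  obtain s1 where s1: "s1 \<in> S" "cj s1 f \<in> P" using into_P f ff by blast
  obtain s2 where s2: "s2 \<in> S" "cj s2 f' \<in> P" using into_P f' ff by blast
  define f1 where "f1 = cj s1 f"
  define f2 where "f2 = cj s2 f'"
  have sc: "s1 \<in> carrier G" "s2 \<in> carrier G" using s1 s2 Sc by blast+
  have c12: "f1 \<in> carrier G" "f2 \<in> carrier G" using sc f f' by (simp_all add: f1_def f2_def)
  have notS: "cj s x \<notin> S" if "s \<in> carrier G" "x \<in> carrier G" "x \<notin> S" for s x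
  proof
    assume "cj s x \<in> S"
    then have "cj (inv s) (cj s x) \<in> S" using normal_cj[OF S, of "inv s"] that by simp
    then show False using that by (simp add: word_simps)
  qed
  have f12: "f1 \<notin> S" "f2 \<notin> S" "f1 \<in> P" "f2 \<in> P"
    using notS sc f f' s1 s2 by (simp_all add: f1_def f2_def)
  have cj_z: "cj s z = z" if "s \<in> carrier G" for s
    using z_central[OF that] that zc cj_eq_iff_commute by simp
  have sq12: "f1 \<otimes> f1 = z" "f2 \<otimes> f2 = z"
    using cj_mult[OF sc(1) f(1) f(1)] cj_mult[OF sc(2) f'(1) f'(1)] ff cj_z sc
    by (simp_all add: f1_def f2_def)
  define q where "q = f2 \<otimes> inv f1"
  have "inv f1 \<notin> S" using f12(1) c12 sS subgroup.m_inv_closed inv_inv by metis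
  then have "q \<in> S" unfolding q_def using index_2_mult[OF fin S index c12(2) f12(2)] c12 by simp
  moreover have "q \<in> P" unfolding q_def using f12 sP subgroup.m_closed subgroup.m_inv_closed by metis
  ultimately have q: "q \<in> Q" using QPS by blast
  have qc: "q \<in> carrier G" using q Qc by blast
  have f2q: "f2 = q \<otimes> f1" unfolding q_def using c12 by (simp add: m_assoc)
  have cjQ: "cj f1 x \<in> Q" if "x \<in> Q" for x
  proof -
    have "cj f1 x \<in> S" using normal_cj[OF S c12(1)] that Q by blast
    moreover have "cj f1 x \<in> P"
      using f12(3) that QP sP subgroup.m_closed subgroup.m_inv_closed by (metis subset_iff)
    ultimately show ?thesis using QPS by blast
  qed
  have cjcj: "cj f1 (cj f1 x) = x" if x: "x \<in> carrier G" for x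
  proof -
    have "cj f1 (cj f1 x) = cj z x" using cj_cj[OF c12(1) c12(1) x] sq12 by simp
    also have "\<dots> = x" using z_central[OF x] cj_eq_iff_commute[OF zc x] by simp
    finally show ?thesis .
  qed
  have inv_Q: "inv x = x \<or> inv x = z \<otimes> x" if x: "x \<in> Q" for x
  proof -
    have xc: "x \<in> carrier G" using x Qc by blast
    from sq[OF x] show ?thesis
    proof
      assume "x \<otimes> x = z"
      then have "(z \<otimes> x) \<otimes> x = \<one>" using z xc zc by (simp add: m_assoc)
      then show ?thesis using inv_equality xc zc by auto
    qed (use xc inv_equality in blast)
  qed
  \<comment> \<open>The cases ask whether f1 acts nontrivially on Q modulo {1, z}. If it does, a
    commutator with f1 supplies q up to z; if not, f1 acts on Q as some element of Q, which
    \<open>outer\<close> excludes.\<close>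
  have "\<exists>v\<in>S. cj v f1 = f2 \<or> cj v f1 = z \<otimes> f2"
  proof (cases "\<exists>v\<in>Q. cj f1 v \<noteq> v \<and> cj f1 v \<noteq> z \<otimes> v")
    case True
    then obtain v where v: "v \<in> Q" "cj f1 v \<noteq> v" "cj f1 v \<noteq> z \<otimes> v" by blast
    have vc: "v \<in> carrier G" using v Qc by blast
    define c where "c = v \<otimes> inv (cj f1 v)"
    have cQ: "c \<in> Q" unfolding c_def using v cjQ Q subgroup.m_closed subgroup.m_inv_closed by metis
    have cc: "c \<in> carrier G" using cQ Qc by blast
    have v_eq: "v = c \<otimes> cj f1 v" using vc c12 by (simp add: c_def m_assoc)
    have c1: "c \<noteq> \<one>" using v_eq v c12 vc by auto
    have cz: "c \<noteq> z"
    proof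
      assume "c = z"
      then have "z \<otimes> v = z \<otimes> (z \<otimes> cj f1 v)" using v_eq by simp
      then have "z \<otimes> v = cj f1 v" using z zc c12 vc by (simp flip: m_assoc)
      then show False using v by simp
    qed
    \<comment> \<open>The elements whose class modulo {1, z} is fixed by f1. Squares in Q lie in {1,
      z}, so inversion is trivial modulo z and C contains whatever f1 inverts, in particular q and
      c. Being proper in Q and of 2-power order, C has at most 4 elements, so it equals {1, z, c, z
      c}.\<close>
    define C where "C = {x \<in> Q. cj f1 x = x \<or> cj f1 x = z \<otimes> x}"
    have sC: "subgroup C G"
    proof (rule subgroupI)
      show "C \<subseteq> carrier G" using Qc by (auto simp: C_def)
      have "\<one> \<in> C" using subgroup.one_closed[OF Q(1)] c12 by (simp add: C_def)
      then show "C \<noteq> {}" by blast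
      show "inv x \<in> C" if x: "x \<in> C" for x
      proof -
        have xQ: "x \<in> Q" and xc: "x \<in> carrier G" using x Qc by (auto simp: C_def)
        have "inv x \<in> Q" using xQ Q subgroup.m_inv_closed by metis
        moreover have "cj f1 (inv x) = inv (cj f1 x)" using cj_inv c12 xc by simp
        moreover have "inv (z \<otimes> x) = z \<otimes> inv x"
          using inv_mult_group[OF zc xc] inv_z z_central[of "inv x"] xc by simp
        ultimately show ?thesis using x by (auto simp: C_def)
      qed
      show "x \<otimes> y \<in> C" if x: "x \<in> C" and y: "y \<in> C" for x y
      proof -
        have xQ: "x \<in> Q" "y \<in> Q" and xc: "x \<in> carrier G" "y \<in> carrier G" using x y Qc by (auto simp: C_def)
        have "x \<otimes> y \<in> Q" using xQ Q subgroup.m_closed by metis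
        moreover have "cj f1 (x \<otimes> y) = cj f1 x \<otimes> cj f1 y" using cj_mult c12 xc by simp
        moreover have "x \<otimes> (z \<otimes> y) = z \<otimes> (x \<otimes> y)" "(z \<otimes> x) \<otimes> y = z \<otimes> (x \<otimes> y)"
          "(z \<otimes> x) \<otimes> (z \<otimes> y) = x \<otimes> y"
        proof -
          show 1: "x \<otimes> (z \<otimes> y) = z \<otimes> (x \<otimes> y)" using z_central[of x] xc zc by (metis m_assoc)
          show "(z \<otimes> x) \<otimes> y = z \<otimes> (x \<otimes> y)" using xc zc by (simp add: m_assoc)
          have "(z \<otimes> x) \<otimes> (z \<otimes> y) = z \<otimes> (z \<otimes> (x \<otimes> y))" using 1 xc zc by (simp add: m_assoc)
          also have "\<dots> = x \<otimes> y" using z xc zc by (simp flip: m_assoc)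
          finally show "(z \<otimes> x) \<otimes> (z \<otimes> y) = x \<otimes> y" .
        qed
        ultimately show ?thesis using x y by (auto simp: C_def)
      qed
    qed
    have in_C: "x \<in> C" if "x \<in> Q" "cj f1 x = inv x" for x using inv_Q[OF that(1)] that by (auto simp: C_def)
    have "cj f1 c = cj f1 v \<otimes> inv (cj f1 (cj f1 v))"
      unfolding c_def using cj_mult c12 vc cj_inv by simp
    also have "\<dots> = cj f1 v \<otimes> inv v" using cjcj[OF vc] by simp
    also have "\<dots> = inv c" using vc c12 by (simp add: c_def inv_mult_group)
    finally have "c \<in> C" using in_C cQ by blast
    \<comment> \<open>Both squares are z, so this identity says that f1 inverts q.\<close>
    have "f2 \<otimes> f2 = q \<otimes> cj f1 q \<otimes> (f1 \<otimes> f1)" unfolding f2q using qc c12 by (simp add: word_simps)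
    then have "z = q \<otimes> cj f1 q \<otimes> z" using sq12 by simp
    then have "q \<otimes> cj f1 q = \<one>" using qc c12 zc r_cancel_one' by (metis inv_closed m_closed)
    then have "cj f1 q = inv q" using qc c12 inv_equality inv_comm by (metis inv_closed m_closed)
    then have "q \<in> C" using in_C q by blast
    have "z \<in> C" using IJ cj_z c12 by (simp add: C_def)
    have "card C dvd 8" using lagrange_dvd[OF Q(1) sC] Q by (auto simp: C_def)
    moreover have finC: "finite C" using fin sC subgroup.subset finite_subset by blast
    have finQ: "finite Q" using fin Qc finite_subset by blast
    have "v \<notin> C" using v by (simp add: C_def)
    then have "C \<subset> Q" using v by (auto simp: C_def)
    then have "card C < 8" using psubset_card_mono[OF finQ] Q by simp
    ultimately have "card C dvd 2 ^ 3" "card C < 2 ^ 3" by simp_all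
    then have "card C \<le> 4"
    proof -
      obtain i where i: "i \<le> 3" "card C = 2 ^ i" using \<open>card C dvd 2 ^ 3\<close> divides_primepow_nat[OF two_is_prime_nat, of "card C" 3] by blast
      then have "i \<le> 2" using \<open>card C < 2 ^ 3\<close> by (cases "i = 3") auto
      then show ?thesis using i power_increasing[of i 2 "2::nat"] by simp
    qed
    moreover have "{\<one>, z, c, z \<otimes> c} \<subseteq> C"
      using \<open>c \<in> C\<close> \<open>z \<in> C\<close> sC subgroup.m_closed subgroup.one_closed by fastforce
    moreover have "card {\<one>, z, c, z \<otimes> c} = 4"
    proof -
      have "z \<otimes> c \<noteq> \<one>" using cz inv_z cc zc by (metis inv_equality inv_inv inv_comm)
      moreover have "z \<otimes> c \<noteq> z" using c1 cc zc by simp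
      moreover have "z \<otimes> c \<noteq> c" using z cc zc by simp
      ultimately show ?thesis using c1 cz z by auto
    qed
    ultimately have "C = {\<one>, z, c, z \<otimes> c}" using card_seteq[OF finC] by metis
    then consider "q = \<one>" | "q = z" | "q = c" | "q = z \<otimes> c" using \<open>q \<in> C\<close> by blast
    moreover have "cj v f1 = c \<otimes> f1" using vc c12 by (simp add: c_def word_simps)
    moreover have "z \<otimes> (z \<otimes> x) = x" if "x \<in> carrier G" for x using z zc that by (simp flip: m_assoc)
    ultimately show ?thesis
    proof cases
      case 1
      then show ?thesis using f2q c12 subgroup.one_closed[OF sS] by (intro bexI[of _ \<one>]) auto
    next
      case 2
      then have "z \<otimes> f2 = f1" using f2q \<open>\<And>x. x \<in> carrier G \<Longrightarrow> z \<otimes> (z \<otimes> x) = x\<close> c12 by simp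
      then show ?thesis using c12 subgroup.one_closed[OF sS] by (intro bexI[of _ \<one>]) auto
    next
      case 3
      then show ?thesis using f2q \<open>cj v f1 = c \<otimes> f1\<close> v Q by (intro bexI[of _ v]) auto
    next
      case 4
      then have "z \<otimes> f2 = c \<otimes> f1"
        using f2q \<open>\<And>x. x \<in> carrier G \<Longrightarrow> z \<otimes> (z \<otimes> x) = x\<close> c12 cc zc by (simp add: m_assoc)
      then show ?thesis using \<open>cj v f1 = c \<otimes> f1\<close> v Q by (intro bexI[of _ v]) auto
    qed
  next
    case False
    then have I: "cj f1 I = I \<or> cj f1 I = z \<otimes> I" and J: "cj f1 J = J \<or> cj f1 J = z \<otimes> J"
      using IJ by blast+
    have ijc: "I \<in> carrier G" "J \<in> carrier G" using IJ Qc by blast+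
    have cII: "cj I I = I" "cj J J = J" using ijc by (simp_all add: m_assoc)
    have cIJ: "cj I J = z \<otimes> J" using IJ(4) ijc zc by (metis m_assoc m_closed inv_solve_right')
    have "J \<otimes> I = z \<otimes> (I \<otimes> J)" using IJ(4) ijc zc z by (simp add: m_assoc[symmetric])
    then have cJI: "cj J I = z \<otimes> I" using ijc zc by (metis m_assoc m_closed inv_solve_right')
    \<comment> \<open>The four sign patterns on I and J are realized by conjugation with 1, I, J and
      I J.\<close>
    have "\<exists>t\<in>Q. cj t I = cj f1 I \<and> cj t J = cj f1 J"
    proof -
      have "cj \<one> I = I" "cj \<one> J = J" using ijc by simp_all
      moreover have "cj (I \<otimes> J) I = z \<otimes> I"
        using cj_cj[OF ijc ijc(1)] cJI cj_mult[OF ijc(1) zc ijc(1)] cj_z[OF ijc(1)] cII by simp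
      moreover have "cj (I \<otimes> J) J = z \<otimes> J" using cj_cj[OF ijc ijc(2)] cII cIJ by simp
      moreover have "\<one> \<in> Q" "I \<otimes> J \<in> Q" using IJ Q subgroup.one_closed subgroup.m_closed by metis+
      ultimately show ?thesis using I J cII cIJ cJI IJ(1,2) by metis
    qed
    then obtain t where t: "t \<in> Q" "cj t I = cj f1 I" "cj t J = cj f1 J" by blast
    have tc: "t \<in> carrier G" using t Qc by blast
    define g where "g = inv t \<otimes> f1"
    have gc: "g \<in> carrier G" using tc c12 by (simp add: g_def)
    have cjg: "cj g x = cj (inv t) (cj f1 x)" if "x \<in> carrier G" for x
      unfolding g_def using cj_cj[of "inv t" f1 x] tc c12 that by simp
    have tt: "cj (inv t) (cj t x) = x" if "x \<in> carrier G" for x using that tc by (simp add: word_simps)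
    have tt': "cj t (cj (inv t) x) = x" if "x \<in> carrier G" for x using that tc by (simp add: word_simps)
    \<comment> \<open>g centralizes I and J, hence all of S by \<open>rigid\<close>. So f1 acts on S
      as t does, and f, which is conjugate to f1 under S, acts as an element of S too: a
      contradiction to \<open>outer\<close>.\<close>
    have fix_g: "cj g x = x" if "x \<in> S" for x
    proof (rule rigid[OF gc _ _ _ that])
      show "cj g x \<in> S" if "x \<in> S" for x using normal_cj[OF S gc that] .
      show "cj g I = I" "cj g J = J" using cjg ijc t tt by metis+
    qed
    have f1t: "cj f1 x = cj t x" if "x \<in> S" for x
      using fix_g[OF that] cjg tt' Sc that c12 by (metis inv_closed m_closed subsetD)
    have "cj f x = cj (inv s1 \<otimes> t \<otimes> s1) x" if x: "x \<in> S" for x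
    proof -
      have xc: "x \<in> carrier G" using x Sc by blast
      have y: "cj s1 x \<in> S" using normal_cj[OF S sc(1) x] .
      have "f = inv s1 \<otimes> f1 \<otimes> s1" using sc f by (simp add: f1_def word_simps)
      then have "cj f x = cj (inv s1) (cj f1 (cj s1 x))" using sc c12 xc by (simp add: word_simps)
      also have "\<dots> = cj (inv s1) (cj t (cj s1 x))" using f1t[OF y] by simp
      also have "\<dots> = cj (inv s1 \<otimes> t \<otimes> s1) x" using sc tc xc by (simp add: word_simps)
      finally show ?thesis .
    qed
    moreover have "inv s1 \<otimes> t \<otimes> s1 \<in> S"
      using s1 t Q sS subgroup.m_closed subgroup.m_inv_closed by (metis subset_iff)
    ultimately show ?thesis using outer by blast
  qed
  then obtain v where v: "v \<in> S" "cj v f1 = f2 \<or> cj v f1 = z \<otimes> f2" by blast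
  have vc: "v \<in> carrier G" using v Sc by blast
  have "inv s2 \<otimes> v \<otimes> s1 \<in> S" using s1 s2 v sS subgroup.m_closed subgroup.m_inv_closed by metis
  moreover have "cj (inv s2 \<otimes> v \<otimes> s1) f = cj (inv s2) (cj v f1)"
    using sc vc f by (simp add: f1_def word_simps)
  moreover have "cj (inv s2) f2 = f'" using sc f' by (simp add: f2_def word_simps)
  moreover have "cj (inv s2) (z \<otimes> f2) = z \<otimes> cj (inv s2) f2"
    using cj_mult[of "inv s2" z f2] cj_z[of "inv s2"] sc zc c12 by simp
  ultimately show ?thesis using v by metis
qed

section \<open>Types I and II, and the structure of groups of type III\<close>

lemma internal_direct_subgroup:
  assumes K: "subgroup K G" and d: "internal_direct (G\<lparr>carrier := K\<rparr>) U W"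
  shows "subgroup U G" "subgroup W G" "U <#> W = K" "U \<inter> W = {\<one>}"
    "U \<lhd> G\<lparr>carrier := K\<rparr>" "W \<lhd> G\<lparr>carrier := K\<rparr>" "card K = card U * card W"
    "\<And>x y. x \<in> U \<Longrightarrow> y \<in> W \<Longrightarrow> x \<otimes> y = y \<otimes> x"
proof -
  interpret K: group "G\<lparr>carrier := K\<rparr>" by (rule subgroup_imp_group[OF K])
  show n: "U \<lhd> G\<lparr>carrier := K\<rparr>" "W \<lhd> G\<lparr>carrier := K\<rparr>" and i: "U \<inter> W = {\<one>}"
    using d by (auto simp: internal_direct_def)
  show UW: "U <#> W = K" using d by (simp add: internal_direct_def)
  show s: "subgroup U G" "subgroup W G"
    using incl_subgroup[OF K normal_imp_subgroup] n by blast+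
  show "card K = card U * card W" using card_set_mult[OF s i] UW by simp
  show "x \<otimes> y = y \<otimes> x" if "x \<in> U" "y \<in> W" for x y
    using K.normal_imp_commuting[OF n _ that] i by auto
qed

lemma internal_semidirect_subgroup:
  assumes K: "subgroup K G" and d: "internal_semidirect (G\<lparr>carrier := K\<rparr>) U W"
  shows "subgroup U G" "subgroup W G" "U <#> W = K" "U \<inter> W = {\<one>}"
    "U \<lhd> G\<lparr>carrier := K\<rparr>" "card K = card U * card W"
proof -
  show n: "U \<lhd> G\<lparr>carrier := K\<rparr>" and i: "U \<inter> W = {\<one>}"
    using d by (auto simp: internal_semidirect_def)
  show UW: "U <#> W = K" using d by (simp add: internal_semidirect_def)
  show s: "subgroup U G" using incl_subgroup[OF K normal_imp_subgroup] n by blast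
  show s': "subgroup W G" using incl_subgroup[OF K] d by (auto simp: internal_semidirect_def)
  show "card K = card U * card W" using card_set_mult[OF s s' i] UW by simp
qed

lemma internal_semidirectD:
  assumes "internal_semidirect G U W"
  shows "U \<lhd> G" "subgroup U G" "subgroup W G" "U <#> W = carrier G" "U \<inter> W = {\<one>}"
    "order G = card U * card W"
  using assms card_set_mult[of U W] normal_imp_subgroup[of U G]
  by (auto simp: internal_semidirect_def order_def)

lemma internal_directD:
  assumes "internal_direct G U W"
  shows "U \<lhd> G" "W \<lhd> G" "subgroup U G" "subgroup W G" "U <#> W = carrier G" "U \<inter> W = {\<one>}"
    "order G = card U * card W" "\<And>x y. x \<in> U \<Longrightarrow> y \<in> W \<Longrightarrow> x \<otimes> y = y \<otimes> x"
proof -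
  show n: "U \<lhd> G" "W \<lhd> G" and i: "U \<inter> W = {\<one>}" and UW: "U <#> W = carrier G"
    using assms by (auto simp: internal_direct_def)
  show s: "subgroup U G" "subgroup W G" using n normal_imp_subgroup by blast+
  show "order G = card U * card W" using card_set_mult[OF s i] UW by (simp add: order_def)
  show "x \<otimes> y = y \<otimes> x" if "x \<in> U" "y \<in> W" for x y
    using normal_imp_commuting[OF n _ that] i by auto
qed

text \<open>In this form a normal Hall subgroup is visibly compatible with conjugation. A
  conjugation that matches two complements also matches their Hall subgroups of equal order, and a
  normal Hall subgroup of a normal subgroup is normal in the whole group.\<close>

lemma hall_subgroup_eq:
  assumes fin: "finite (carrier G)" and K: "subgroup K G" and U: "U \<lhd> G\<lparr>carrier := K\<rparr>"
    and card: "card K = card U * m" and co: "coprime (card U) m"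
  shows "U = {x \<in> K. x [^] card U = \<one>}"
proof
  interpret K: group "G\<lparr>carrier := K\<rparr>" by (rule subgroup_imp_group[OF K])
  have sU: "subgroup U G" using incl_subgroup[OF K normal_imp_subgroup[OF U]] .
  have UK: "U \<subseteq> K" using normal_imp_subgroup[OF U] subgroup.subset by fastforce
  show "U \<subseteq> {x \<in> K. x [^] card U = \<one>}" using UK pow_card_subgroup[OF sU] by blast
  have finK: "finite K" using fin K subgroup.subset finite_subset by blast
  show "{x \<in> K. x [^] card U = \<one>} \<subseteq> U"
    using K.normal_mem_of_pow[OF U, of m "card U"] finK card co
    by (auto simp: order_def nat_pow_consistent[symmetric])
qed

lemma hall_subgroup_normal:
  assumes fin: "finite (carrier G)" and N: "N \<lhd> G" and U: "U \<lhd> G\<lparr>carrier := N\<rparr>"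
    and card: "card N = card U * m" and co: "coprime (card U) m"
  shows "U \<lhd> G"
proof (rule normal_invI)
  have sN: "subgroup N G" using N normal_imp_subgroup by blast
  have eq: "U = {x \<in> N. x [^] card U = \<one>}" by (rule hall_subgroup_eq[OF fin sN U card co])
  show "subgroup U G" using incl_subgroup[OF sN normal_imp_subgroup[OF U]] .
  fix g x assume g: "g \<in> carrier G" and x: "x \<in> U"
  have "x \<in> {x \<in> N. x [^] card U = \<one>}" using x by (simp only: eq[symmetric])
  then have x': "x \<in> N" "x [^] card U = \<one>" by blast+
  have x'': "x \<in> carrier G" using x'(1) sN subgroup.mem_carrier by metis
  have "cj g x \<in> N" using normal_cj[OF N g x'(1)] .
  moreover have "cj g x [^] card U = \<one>" using cj_pow[OF g x'', of "card U"] x'(2) g by simp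
  ultimately have "cj g x \<in> {x \<in> N. x [^] card U = \<one>}" by blast
  then show "cj g x \<in> U" by (simp only: eq[symmetric])
qed

lemma conj_set_power_torsion:
  assumes g: "g \<in> carrier G" and K: "K \<subseteq> carrier G" and K': "conj_set G g K = K'"
  shows "conj_set G g {x \<in> K. x [^] (n::nat) = \<one>} = {x \<in> K'. x [^] n = \<one>}"
proof -
  have "cj g x [^] n = \<one> \<longleftrightarrow> x [^] n = \<one>" if x: "x \<in> K" for x
  proof -
    have xc: "x \<in> carrier G" using x K by blast
    have "cj g x [^] n = cj g (x [^] n)" using cj_pow[OF g xc] by simp
    moreover have "cj g y = \<one> \<longleftrightarrow> y = \<one>" if "y \<in> carrier G" for y
    proof
      assume "cj g y = \<one>"
      then have "cj (inv g) (cj g y) = \<one>" using g by simp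
      then show "y = \<one>" using g that by (simp add: word_simps)
    qed (use g in simp)
    ultimately show ?thesis using xc by simp
  qed
  then show ?thesis unfolding K'[symmetric] conj_set_eq by auto
qed

lemma AB_conditionsD:
  assumes "AB_conditions G A B"
  shows "subgroup A G" "subgroup B G" "odd (card A)" "odd (card B)" "coprime (card A) (card B)"
    "\<And>x y. x \<in> A \<Longrightarrow> y \<in> A \<Longrightarrow> x \<otimes> y = y \<otimes> x" "\<And>x y. x \<in> B \<Longrightarrow> y \<in> B \<Longrightarrow> x \<otimes> y = y \<otimes> x"
  using assms cyclic_commute unfolding AB_conditions_def by blast+

lemma complement_conjugate:
  assumes fin: "finite (carrier G)"
    and A: "A \<lhd> G" "\<And>x y. x \<in> A \<Longrightarrow> y \<in> A \<Longrightarrow> x \<otimes> y = y \<otimes> x"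
    and K: "internal_semidirect G A K" and K': "internal_semidirect G A K'"
    and co: "coprime (card A) (card K)"
  obtains g where "g \<in> carrier G" "conj_set G g K = K'"
  using schur_zassenhaus_abelian[OF fin A _ _ _ _ _ _ co, of K'] internal_semidirectD[OF K] internal_semidirectD[OF K']
  by blast

text \<open>Serves types I and II together. \<open>B T\<close> is a complement of the abelian Hall
  subgroup \<open>A\<close>, so Schur--Zassenhaus moves it as a whole; \<open>B\<close> and
  \<open>T\<close> follow as Hall subgroups of it.\<close>

lemma two_complement_unique:
  assumes fin: "finite (carrier G)"
    and AB: "AB_conditions G A B" and AK: "internal_semidirect G A (B <#> T)"
    and BT: "internal_direct (G\<lparr>carrier := B <#> T\<rparr>) B T" and T: "card T = 2 ^ k"
    and AB': "AB_conditions G A' B'" and AK': "internal_semidirect G A' (B' <#> T')"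
    and BT': "internal_direct (G\<lparr>carrier := B' <#> T'\<rparr>) B' T'" and T': "card T' = 2 ^ k'"
  shows "(\<exists>g\<in>carrier G. conj_set G g A = A' \<and> conj_set G g B = B' \<and> conj_set G g T = T') \<and> A' = A"
proof -
  note D = internal_semidirectD[OF AK] and D' = internal_semidirectD[OF AK']
  note E = internal_direct_subgroup[OF D(3) BT] and E' = internal_direct_subgroup[OF D'(3) BT']
  note F = AB_conditionsD[OF AB] and F' = AB_conditionsD[OF AB']
  have ord: "order G = 2 ^ k * (card A * card B)" using D(6) E(7) T by simp
  have ord': "order G = 2 ^ k' * (card A' * card B')" using D'(6) E'(7) T' by simp
  have u: "A' = A" "card B' = card B" "(2::nat) ^ k' = 2 ^ k"
    using AB_unique[OF fin D(1) AB ord _ D'(1) AB' ord'] F F' by simp_all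
  have "coprime (card A) (card (B <#> T))" using F E(7) T by simp
  then obtain g where g: "g \<in> carrier G" "conj_set G g (B <#> T) = B' <#> T'"
    using complement_conjugate[OF fin D(1) F(6) AK _ _, of "B' <#> T'"] AK' u(1) by metis
  have KC: "B <#> T \<subseteq> carrier G" using D(3) subgroup.subset by blast
  have co: "coprime (card B) (card T)" "coprime (card T) (card B)" using F T by simp_all
  have co': "coprime (card B') (card T')" "coprime (card T') (card B')" using F' T' by simp_all
  have cB: "card (B <#> T) = card B * card T" "card (B <#> T) = card T * card B" using E(7) by simp_all
  have cB': "card (B' <#> T') = card B' * card T'" "card (B' <#> T') = card T' * card B'" using E'(7) by simp_all
  have "conj_set G g B = B'"
    using hall_subgroup_eq[OF fin D(3) E(5) cB(1) co(1)] hall_subgroup_eq[OF fin D'(3) E'(5) cB'(1) co'(1)]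
      conj_set_power_torsion[OF g(1) KC g(2), of "card B"] u by metis
  moreover have "conj_set G g T = T'"
    using hall_subgroup_eq[OF fin D(3) E(6) cB(2) co(2)] hall_subgroup_eq[OF fin D'(3) E'(6) cB'(2) co'(2)]
      conj_set_power_torsion[OF g(1) KC g(2), of "card T"] u T T' by metis
  moreover have "conj_set G g A = A'" using conj_set_normal[OF D(1) g(1)] u by simp
  ultimately show ?thesis using g u by blast
qed

lemma structure_I_unique:
  assumes "finite (carrier G)" "structure_I G A B T" "structure_I G A' B' T'"
  shows "(\<exists>g\<in>carrier G. conj_set G g A = A' \<and> conj_set G g B = B' \<and> conj_set G g T = T') \<and> A' = A"
  using assms two_complement_unique[of A B T _ A' B' T']
  unfolding structure_I_def cyclic_p_subgroup_def by blast

lemma card_quaternion_group: "m \<ge> 3 \<Longrightarrow> card (carrier (quaternion_group m)) = 2 ^ m"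
proof -
  assume m: "m \<ge> 3"
  have "card (carrier (quaternion_group m)) = nat (4 * 2 ^ (m - 2))"
    using iso_same_card[OF quaternion_group_iso[OF m]] card_quaternion_model[of "2 ^ (m - 2)"] by simp
  also have "(4::int) * 2 ^ (m - 2) = 2 ^ (2 + (m - 2))" by (simp only: power_add) simp
  also have "2 + (m - 2) = m" using m by simp
  finally show ?thesis by (simp add: nat_power_eq)
qed

lemma card_quaternionic:
  assumes "is_quaternionic (G\<lparr>carrier := T\<rparr>)" obtains m where "m \<ge> 3" "card T = 2 ^ m"
  using assms iso_same_card card_quaternion_group unfolding is_quaternionic_def by fastforce

lemma structure_II_unique:
  assumes fin: "finite (carrier G)" and s: "structure_II G A B T" and s': "structure_II G A' B' T'"
  shows "(\<exists>g\<in>carrier G. conj_set G g A = A' \<and> conj_set G g B = B' \<and> conj_set G g T = T') \<and> A' = A"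
proof -
  obtain m where "card T = 2 ^ m" using card_quaternionic s unfolding structure_II_def by blast
  moreover obtain m' where "card T' = 2 ^ m'" using card_quaternionic s' unfolding structure_II_def by blast
  ultimately show ?thesis
    using two_complement_unique[OF fin, of A B T m A' B' T' m'] s s' unfolding structure_II_def by blast
qed

lemma Q8_subgroup:
  assumes Q: "subgroup Q G" and iso: "G\<lparr>carrier := Q\<rparr> \<cong> quaternion_group 3"
  obtains z where "card Q = 8" "z \<in> Q" "z \<noteq> \<one>" "z \<otimes> z = \<one>"
    "\<And>x. x \<in> Q \<Longrightarrow> x \<otimes> x = \<one> \<Longrightarrow> x = \<one> \<or> x = z"
    "\<And>x y. x \<in> Q \<Longrightarrow> y \<in> Q \<Longrightarrow> x \<otimes> y = y \<otimes> x \<or> x \<otimes> y = z \<otimes> (y \<otimes> x)"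
proof -
  let ?M = "quaternion_model 2"
  interpret Q: group "G\<lparr>carrier := Q\<rparr>" by (rule subgroup_imp_group[OF Q])
  interpret M: group ?M by (rule group_quaternion_model) simp
  have "G\<lparr>carrier := Q\<rparr> \<cong> ?M" using iso_trans[OF iso quaternion_group_iso[of 3]] by simp
  then obtain h where h: "h \<in> iso (G\<lparr>carrier := Q\<rparr>) ?M" by (auto simp: is_iso_def)
  have hom: "h (x \<otimes> y) = h x \<otimes>\<^bsub>?M\<^esub> h y" if "x \<in> Q" "y \<in> Q" for x y
    using h that by (auto simp: iso_def hom_def)
  have inj: "inj_on h Q" and img: "h ` Q = carrier ?M" using h by (auto simp: iso_def bij_betw_def)
  have one: "h \<one> = \<one>\<^bsub>?M\<^esub>"
    using hom_one[OF _ Q.is_group M.is_group, of h] h by (simp add: iso_def)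
  have hc: "h x \<in> carrier ?M" if "x \<in> Q" for x using that img by blast
  have h_eq: "x = y" if "x \<in> Q" "y \<in> Q" "h x = h y" for x y using inj that by (auto simp: inj_on_def)
  note cl = subgroup.m_closed[OF Q] subgroup.one_closed[OF Q]
  obtain z where z: "z \<in> Q" "h z = (2, False)" using quaternion_model_2(1) img by (metis imageE)
  show ?thesis
  proof (rule that[of z])
    show "card Q = 8" using iso_same_card[OF iso] card_quaternion_group[of 3] by simp
    show "z \<in> Q" by (rule z)
    show "z \<noteq> \<one>" using z one quaternion_model_2(2) by auto
    show "z \<otimes> z = \<one>"
      using h_eq[OF cl(1)[OF z(1) z(1)] cl(2)] hom[OF z(1) z(1)] z one quaternion_model_2(3) by simp
    show "x = \<one> \<or> x = z" if x: "x \<in> Q" "x \<otimes> x = \<one>" for x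
    proof -
      have "h x \<otimes>\<^bsub>?M\<^esub> h x = \<one>\<^bsub>?M\<^esub>" using hom[OF x(1) x(1)] x one by simp
      then have "h x = h \<one> \<or> h x = h z" using quaternion_model_2(4)[OF hc[OF x(1)]] one z by simp
      then show ?thesis using h_eq x(1) z(1) cl(2) by blast
    qed
    show "x \<otimes> y = y \<otimes> x \<or> x \<otimes> y = z \<otimes> (y \<otimes> x)" if x: "x \<in> Q" "y \<in> Q" for x y
    proof -
      have "h (x \<otimes> y) = h (y \<otimes> x) \<or> h (x \<otimes> y) = h (z \<otimes> (y \<otimes> x))"
        using quaternion_model_2(5)[OF hc[OF x(1)] hc[OF x(2)]] hom x z cl(1) by simp
      then show ?thesis using h_eq[OF cl(1)[OF x] cl(1)[OF x(2,1)]]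
          h_eq[OF cl(1)[OF x] cl(1)[OF z(1) cl(1)[OF x(2,1)]]] by blast
    qed
  qed
qed

end

section \<open>The action of \<open>\<Theta>\<close> on Q8 in groups of type III\<close>

locale type_III = group G for G (structure) +
  fixes A B Q \<Theta>
  assumes fin: "finite (carrier G)" and type_III: "structure_III G A B Q \<Theta>"
begin

lemma AB: "AB_conditions G A B"
  using type_III by (simp add: structure_III_def)

lemmas AB_facts = AB_conditionsD[OF AB]

lemma QA_\<Theta>B: "internal_semidirect G (Q <#> A) (\<Theta> <#> B)"
  using type_III by (simp add: structure_III_def)

lemmas semidirect = internal_semidirectD[OF QA_\<Theta>B]

lemma QA: "internal_direct (G\<lparr>carrier := Q <#> A\<rparr>) Q A"
  and \<Theta>B: "internal_direct (G\<lparr>carrier := \<Theta> <#> B\<rparr>) \<Theta> B"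
  using type_III by (simp_all add: structure_III_def)

lemmas QA_facts = internal_direct_subgroup[OF semidirect(2) QA]
lemmas \<Theta>B_facts = internal_direct_subgroup[OF semidirect(3) \<Theta>B]

lemma card_\<Theta>: obtains k where "card \<Theta> = 3 ^ k"
  using type_III by (auto simp: structure_III_def cyclic_p_subgroup_def)

lemma coprime_3: "coprime (card A) 3" "coprime (card B) 3"
  using type_III by (simp_all add: structure_III_def)

lemma \<Theta>_commute: "x \<in> \<Theta> \<Longrightarrow> y \<in> \<Theta> \<Longrightarrow> x \<otimes> y = y \<otimes> x"
  using type_III cyclic_commute[of \<Theta> x y] by (simp add: structure_III_def cyclic_p_subgroup_def)

lemma Q8: "subgroup Q G" "G\<lparr>carrier := Q\<rparr> \<cong> quaternion_group 3"
  using type_III by (simp_all add: structure_III_def)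

definition z where "z = (SOME z. z \<in> Q \<and> z \<noteq> \<one> \<and> z \<otimes> z = \<one>)"

lemma card_Q: "card Q = 8"
  using iso_same_card[OF Q8(2)] card_quaternion_group[of 3] by simp

lemma z: "z \<in> Q" "z \<noteq> \<one>" "z \<otimes> z = \<one>"
  and involution_Q: "x \<in> Q \<Longrightarrow> x \<otimes> x = \<one> \<Longrightarrow> x = \<one> \<or> x = z"
  and commute_Q: "x \<in> Q \<Longrightarrow> y \<in> Q \<Longrightarrow> x \<otimes> y = y \<otimes> x \<or> x \<otimes> y = z \<otimes> (y \<otimes> x)"
proof -
  obtain y where y: "y \<in> Q" "y \<noteq> \<one>" "y \<otimes> y = \<one>" 
    "\<And>x. x \<in> Q \<Longrightarrow> x \<otimes> x = \<one> \<Longrightarrow> x = \<one> \<or> x = y"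
    "\<And>x x'. x \<in> Q \<Longrightarrow> x' \<in> Q \<Longrightarrow> x \<otimes> x' = x' \<otimes> x \<or> x \<otimes> x' = y \<otimes> (x' \<otimes> x)"
    by (rule Q8_subgroup[OF Q8]) blast
  have "z \<in> Q \<and> z \<noteq> \<one> \<and> z \<otimes> z = \<one>" unfolding z_def by (rule someI[of _ y]) (use y in simp)
  moreover from this have "z = y" using y(4)[of z] by simp
  ultimately show "z \<in> Q" "z \<noteq> \<one>" "z \<otimes> z = \<one>"
    "x \<in> Q \<Longrightarrow> x \<otimes> x = \<one> \<Longrightarrow> x = \<one> \<or> x = z"
    "x \<in> Q \<Longrightarrow> y \<in> Q \<Longrightarrow> x \<otimes> y = y \<otimes> x \<or> x \<otimes> y = z \<otimes> (y \<otimes> x)" for x y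
    using y by blast+
qed

lemma order_III: "order G = card Q * card \<Theta> * (card A * card B)"
  using semidirect(6) QA_facts(7) \<Theta>B_facts(7) by simp

lemma coprime_Q\<Theta>: "coprime (card Q * card \<Theta>) (card A * card B)"
  "coprime (card Q) (card \<Theta> * (card A * card B))" "coprime (card Q) (card A)" "coprime (card \<Theta>) (card B)"
proof -
  obtain k where k: "card \<Theta> = 3 ^ k" by (rule card_\<Theta>)
  have 8: "coprime (8::nat) n" if "odd n" for n
  proof -
    have "coprime (2 ^ 3) n" using that by (simp only: coprime_power_left_iff coprime_left_2_iff_odd) simp
    then show ?thesis by simp
  qed
  have "coprime (card \<Theta>) (card A)" "coprime (card \<Theta>) (card B)"
    using coprime_3 unfolding k by (simp_all add: coprime_commute)
  moreover have "odd (card \<Theta>)" unfolding k by simp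
  ultimately show "coprime (card Q * card \<Theta>) (card A * card B)"
    "coprime (card Q) (card \<Theta> * (card A * card B))" "coprime (card Q) (card A)" "coprime (card \<Theta>) (card B)"
    using AB_facts(3,4) by (simp_all add: card_Q 8)
qed

lemma normal_Q: "Q \<lhd> G"
  by (rule hall_subgroup_normal[OF fin semidirect(1) QA_facts(5,7) coprime_Q\<Theta>(3)])

lemma normal_A: "A \<lhd> G"
proof (rule hall_subgroup_normal[OF fin semidirect(1) QA_facts(6)])
  show "card (Q <#> A) = card A * card Q" using QA_facts(7) by simp
  show "coprime (card A) (card Q)" using coprime_Q\<Theta>(3) by (simp add: coprime_commute)
qed

lemma mem_Q_of_pow_8:
  assumes "x \<in> carrier G" "x [^] (8::nat) = \<one>" shows "x \<in> Q"
proof (rule normal_mem_of_pow[OF normal_Q fin _ _ assms(1)])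
  show "order G = card Q * (card \<Theta> * (card A * card B))" using order_III by simp
  show "coprime 8 (card \<Theta> * (card A * card B))" using coprime_Q\<Theta>(2) card_Q by simp
qed (use assms in simp)

lemma involution:
  assumes "x \<in> carrier G" "x \<otimes> x = \<one>" shows "x = \<one> \<or> x = z"
proof (rule involution_Q[OF mem_Q_of_pow_8])
  have "x [^] (2::nat) = \<one>" using assms by (simp add: numeral_eq_Suc)
  then show "x [^] (8::nat) = \<one>" using pow_mult_eq_one[OF assms(1), of 2 4] by simp
qed (use assms in auto)

lemma zc: "z \<in> carrier G"
  using z(1) Q8(1) subgroup.mem_carrier by metis

lemma z_central: "g \<in> carrier G \<Longrightarrow> z \<otimes> g = g \<otimes> z"
  using unique_involution_central[OF normal_Q z involution_Q] by blast

lemma fixed_points_\<Theta>: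
  assumes W: "subgroup W G" "W \<subseteq> Q" and inv: "\<And>t x. t \<in> \<Theta> \<Longrightarrow> x \<in> W \<Longrightarrow> cj t x \<in> W"
  shows "[card W = card {x\<in>W. \<forall>t\<in>\<Theta>. cj t x = x}] (mod 3)"
proof -
  obtain k where k: "card \<Theta> = 3 ^ k" by (rule card_\<Theta>)
  have Tc: "\<Theta> \<subseteq> carrier G" using \<Theta>B_facts(1) subgroup.subset by blast
  have Wc: "W \<subseteq> carrier G" using W subgroup.subset by blast
  have "[card W = card {x\<in>W. \<forall>t\<in>carrier (G\<lparr>carrier := \<Theta>\<rparr>). cj t x = x}] (mod 3)"
  proof (rule p_group_fixed_points[OF subgroup_imp_group[OF \<Theta>B_facts(1)], where act = "\<lambda>t x. cj t x"])
    show "order (G\<lparr>carrier := \<Theta>\<rparr>) = 3 ^ k" using k by (simp add: order_def)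
    show "finite W" using Wc fin finite_subset by blast
    show "cj (s \<otimes>\<^bsub>G\<lparr>carrier := \<Theta>\<rparr>\<^esub> t) x = cj s (cj t x)"
      if "s \<in> carrier (G\<lparr>carrier := \<Theta>\<rparr>)" "t \<in> carrier (G\<lparr>carrier := \<Theta>\<rparr>)" "x \<in> W" for s t x
      using cj_cj[of s t x] that Tc Wc by (simp add: subset_iff)
  qed (use inv Wc in auto)
  then show ?thesis by simp
qed

text \<open>The fixed points of the 3-group \<open>\<Theta>\<close> form a subgroup of Q8 whose
  order is congruent to 8 modulo 3. It is proper because \<open>\<Theta>\<close> acts nontrivially,
  and the only proper divisor of 8 congruent to 2 modulo 3 is 2.\<close>

lemma centralizer_\<Theta>:
  assumes x: "x \<in> Q" and comm: "\<And>t. t \<in> \<Theta> \<Longrightarrow> t \<otimes> x = x \<otimes> t"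
  shows "x = \<one> \<or> x = z"
proof -
  have Qc: "Q \<subseteq> carrier G" and Tc: "\<Theta> \<subseteq> carrier G"
    using Q8(1) \<Theta>B_facts(1) subgroup.subset by blast+
  define C where "C = {x\<in>Q. \<forall>t\<in>\<Theta>. cj t x = x}"
  have sC: "subgroup C G"
  proof (rule subgroupI)
    show "C \<subseteq> carrier G" using Qc by (auto simp: C_def)
    have "\<one> \<in> C" using subgroup.one_closed[OF Q8(1)] Tc by (auto simp: C_def)
    then show "C \<noteq> {}" by blast
    show "inv y \<in> C" if y: "y \<in> C" for y
    proof -
      have yc: "y \<in> carrier G" using y Qc by (auto simp: C_def)
      have "cj t (inv y) = inv y" if t: "t \<in> \<Theta>" for t
      proof -
        have "cj t (inv y) = inv (cj t y)" using cj_inv t Tc yc by blast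
        then show ?thesis using y t by (simp add: C_def)
      qed
      then show ?thesis using y Q8(1) subgroup.m_inv_closed by (fastforce simp: C_def)
    qed
    show "y \<otimes> y' \<in> C" if y: "y \<in> C" "y' \<in> C" for y y'
    proof -
      have yc: "y \<in> carrier G" "y' \<in> carrier G" using y Qc by (auto simp: C_def)
      have "cj t (y \<otimes> y') = y \<otimes> y'" if t: "t \<in> \<Theta>" for t
      proof -
        have "cj t (y \<otimes> y') = cj t y \<otimes> cj t y'" using cj_mult t Tc yc by blast
        then show ?thesis using y t by (simp add: C_def)
      qed
      then show ?thesis using y Q8(1) subgroup.m_closed by (fastforce simp: C_def)
    qed
  qed
  have CQ: "C \<subseteq> Q" by (auto simp: C_def)
  have finQ: "finite Q" using Qc fin finite_subset by blast
  have "[card Q = card C] (mod 3)"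
    unfolding C_def using Tc by (intro fixed_points_\<Theta>[OF Q8(1)] normal_cj[OF normal_Q]) auto
  then have mod3: "card C mod 3 = 2" using card_Q by (simp add: cong_def)
  have "card C dvd 2 ^ 3" using lagrange_dvd[OF Q8(1) sC CQ] card_Q by simp
  then obtain i where i: "i \<le> 3" "card C = 2 ^ i" using divides_primepow_nat[OF two_is_prime_nat] by blast
  have "C \<noteq> Q"
  proof
    assume "C = Q"
    then have "acts_trivially G t Q" if "t \<in> \<Theta>" for t
      using that unfolding acts_trivially_def conj_map_def by (auto simp: C_def)
    then show False using type_III by (auto simp: structure_III_def)
  qed
  then have "card C < 8" using psubset_card_mono[OF finQ, of C] CQ card_Q by auto
  then have "i \<noteq> 3" using i by auto
  then have "i = 0 \<or> i = 1 \<or> i = 2" using i by auto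
  then have "card C = 2" using i mod3 by auto
  moreover have "cj t z = z" if "t \<in> \<Theta>" for t
    using z_central[of t] cj_eq_iff_commute[of t z] that Tc zc by auto
  then have "{\<one>, z} \<subseteq> C" using z(1) subgroup.one_closed[OF sC] by (auto simp: C_def)
  moreover have "finite C" using CQ finQ finite_subset by blast
  ultimately have "C = {\<one>, z}" using card_seteq[of C "{\<one>, z}"] z(2) by auto
  moreover have "cj t x = x" if t: "t \<in> \<Theta>" for t
    using comm[OF t] cj_eq_iff_commute[of t x] x t Tc Qc by blast
  then have "x \<in> C" using x by (simp add: C_def)
  ultimately show ?thesis by blast
qed

text \<open>The number of fixed points in W is congruent to 4, that is to 1, modulo 3. But W
  contains z and the fixed points of \<open>\<Theta>\<close> in Q are 1 and z, so there are two.
  This keeps Q8 inside every normal subgroup of index 2.\<close>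

lemma no_invariant_subgroup_4:
  assumes W: "subgroup W G" "W \<subseteq> Q" "card W = 4" and inv: "\<And>t x. t \<in> \<Theta> \<Longrightarrow> x \<in> W \<Longrightarrow> cj t x \<in> W"
  shows False
proof -
  have Wc: "W \<subseteq> carrier G" and Tc: "\<Theta> \<subseteq> carrier G"
    using W(1) \<Theta>B_facts(1) subgroup.subset by blast+
  define F where "F = {x\<in>W. \<forall>t\<in>\<Theta>. cj t x = x}"
  have "[card W = card F] (mod 3)" unfolding F_def by (rule fixed_points_\<Theta>[OF W(1,2) inv])
  then have "card F mod 3 = 1" using W by (simp add: cong_def)
  moreover have one: "\<one> \<in> F" using subgroup.one_closed[OF W(1)] Tc by (auto simp: F_def)
  \<comment> \<open>For x in W other than 1, either x or x^2 is the unique involution.\<close>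
  have "z \<in> W"
  proof -
    have "\<exists>x\<in>W. x \<noteq> \<one>"
    proof (rule ccontr)
      assume "\<not> ?thesis"
      then have "W \<subseteq> {\<one>}" by blast
      then have "card W \<le> 1" by (metis card_mono card.empty card_insert_disjoint empty_iff finite.emptyI finite.insertI One_nat_def)
      then show False using W by simp
    qed
    then obtain x where x: "x \<in> W" "x \<noteq> \<one>" by blast
    have xc: "x \<in> carrier G" using x Wc by blast
    have xx: "x \<otimes> x \<in> W" using x W subgroup.m_closed by metis
    have "x [^] (4::nat) = \<one>" using pow_card_subgroup[OF W(1) x(1)] W by simp
    then have "(x \<otimes> x) \<otimes> (x \<otimes> x) = \<one>" using xc by (simp add: numeral_eq_Suc m_assoc)
    then have "x \<otimes> x = \<one> \<or> x \<otimes> x = z" using involution xc by simp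
    then show ?thesis using involution[OF xc] x xx by auto
  qed
  then have "z \<in> F" using z_central cj_eq_iff_commute zc Tc by (auto simp: F_def)
  have "F \<subseteq> {\<one>, z}"
  proof
    fix x assume "x \<in> F"
    then have "x \<in> Q" "\<And>t. t \<in> \<Theta> \<Longrightarrow> t \<otimes> x = x \<otimes> t"
      using W(2) Wc Tc cj_eq_iff_commute by (auto simp: F_def) (metis subsetD)
    then show "x \<in> {\<one>, z}" using centralizer_\<Theta> by blast
  qed
  then have "F = {\<one>, z}" using one \<open>z \<in> F\<close> by blast
  then have "card F = 2" using z(2) by auto
  ultimately show False by simp
qed

end

section \<open>Uniqueness for types III and V\<close>

lemma coprime_8_iff_odd: "coprime (8::nat) n \<longleftrightarrow> odd n"
proof -
  have "coprime (2 ^ 3) n \<longleftrightarrow> odd n"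
    by (simp only: coprime_power_left_iff coprime_left_2_iff_odd) simp
  then show ?thesis by simp
qed

context type_III
begin

lemma coprime_index:
  assumes "odd n" "coprime n 3" shows "coprime (card Q * card \<Theta>) n"
proof -
  obtain k where k: "card \<Theta> = 3 ^ k" by (rule card_\<Theta>)
  have "coprime 8 n" using assms(1) by (rule iffD2[OF coprime_8_iff_odd])
  moreover have "coprime 3 n" using assms(2) by (subst coprime_commute)
  ultimately show ?thesis unfolding k card_Q by simp
qed

lemma cj_z: "g \<in> carrier G \<Longrightarrow> cj g z = z"
  using z_central[of g] cj_eq_iff_commute[of g z] zc by simp

lemma normal_z: "{\<one>, z} \<lhd> G"
proof (rule normal_invI)
  show "subgroup {\<one>, z} G"
  proof (rule subgroupI)
    have "inv z = z" using z(3) zc inv_equality by blast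
    then show "inv x \<in> {\<one>, z}" if "x \<in> {\<one>, z}" for x using that by auto
  qed (use z zc in auto)
qed (use cj_z in auto)

text \<open>\<open>A\<close> is abelian and commutes with \<open>Q\<close>, so a commutator in
  \<open>Q A\<close> is a commutator in Q8.\<close>

lemma commutator_QA:
  assumes x: "x \<in> Q <#> A" and y: "y \<in> Q <#> A" shows "x \<otimes> y \<otimes> inv x \<otimes> inv y \<in> {\<one>, z}"
proof -
  obtain q a where qa: "q \<in> Q" "a \<in> A" "x = q \<otimes> a" using x unfolding set_mult_def by blast
  obtain r b where rb: "r \<in> Q" "b \<in> A" "y = r \<otimes> b" using y unfolding set_mult_def by blast
  have c: "q \<in> carrier G" "a \<in> carrier G" "r \<in> carrier G" "b \<in> carrier G"
    using qa rb Q8(1) AB_facts(1) subgroup.mem_carrier by metis+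
  have xc: "x \<in> carrier G" "y \<in> carrier G" using c qa rb by simp_all
  have xy: "x \<otimes> y = (q \<otimes> r) \<otimes> (a \<otimes> b)"
    using c QA_facts(8)[OF rb(1) qa(2)] unfolding qa rb by (metis m_assoc m_closed)
  have yx: "y \<otimes> x = (r \<otimes> q) \<otimes> (a \<otimes> b)"
    using c QA_facts(8)[OF qa(1) rb(2)] AB_facts(6)[OF qa(2) rb(2)] unfolding qa rb by (metis m_assoc m_closed)
  have "x \<otimes> y = y \<otimes> x \<or> x \<otimes> y = z \<otimes> (y \<otimes> x)"
    using commute_Q[OF qa(1) rb(1)]
  proof
    assume "q \<otimes> r = z \<otimes> (r \<otimes> q)"
    then show ?thesis unfolding xy yx using c zc by (simp add: m_assoc)
  qed (simp add: xy yx)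
  then show ?thesis
  proof
    assume "x \<otimes> y = y \<otimes> x"
    then show ?thesis using xc by (simp add: m_assoc)
  next
    assume "x \<otimes> y = z \<otimes> (y \<otimes> x)"
    then show ?thesis using xc zc by (simp add: m_assoc)
  qed
qed

end

context group
begin

lemma conj_set_consistent:
  "subgroup H G \<Longrightarrow> g \<in> H \<Longrightarrow> conj_set (G\<lparr>carrier := H\<rparr>) g U = conj_set G g U"
  unfolding conj_set_eq by simp

lemma structure_III_unique:
  assumes fin: "finite (carrier G)" and s: "structure_III G A B Q \<Theta>" and t: "structure_III G A' B' Q' \<Theta>'"
  shows "(\<exists>g\<in>carrier G. conj_set G g A = A' \<and> conj_set G g B = B' \<and>
      conj_set G g Q = Q' \<and> conj_set G g \<Theta> = \<Theta>') \<and> A' = A \<and> Q' = Q"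
proof -
  interpret s: type_III G A B Q \<Theta> by unfold_locales (fact fin s)+
  interpret t: type_III G A' B' Q' \<Theta>' by unfold_locales (fact fin t)+
  have odd: "odd (card A * card B)" "coprime (card A * card B) 3"
    "odd (card A' * card B')" "coprime (card A' * card B') 3"
    using s.AB_facts t.AB_facts s.coprime_3 t.coprime_3 by simp_all
  have u: "A' = A" "card B' = card B" "card Q' * card \<Theta>' = card Q * card \<Theta>"
    using AB_unique[OF fin s.normal_A s.AB s.order_III s.coprime_index[OF odd(1,2)] t.normal_A t.AB t.order_III
        t.coprime_index[OF odd(3,4)] s.coprime_index[OF odd(3,4)] t.coprime_index[OF odd(1,2)]] by simp_all
  have card\<Theta>: "card \<Theta>' = card \<Theta>" using u(3) s.card_Q t.card_Q by simp
  have Qc: "Q \<subseteq> carrier G" "Q' \<subseteq> carrier G" using s.Q8 t.Q8 subgroup.subset by blast+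
  have "x [^] (8::nat) = \<one>" if "x \<in> Q" for x using pow_card_subgroup[OF s.Q8(1) that] s.card_Q by simp
  moreover have "x [^] (8::nat) = \<one>" if "x \<in> Q'" for x using pow_card_subgroup[OF t.Q8(1) that] t.card_Q by simp
  ultimately have Q: "Q' = Q" using s.mem_Q_of_pow_8 t.mem_Q_of_pow_8 Qc by blast
  define K where "K = \<Theta> <#> B"
  define K' where "K' = \<Theta>' <#> B'"
  note D = s.semidirect[folded K_def] and D' = t.semidirect[folded K'_def]
  note E = s.\<Theta>B_facts[folded K_def] and E' = t.\<Theta>B_facts[folded K'_def]
  have cardK: "card K' = card K" using E(7) E'(7) card\<Theta> u(2) by simp
  have oddK: "odd (card K)"
  proof -
    obtain k where "card \<Theta> = 3 ^ k" by (rule s.card_\<Theta>)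
    then show ?thesis using E(7) s.AB_facts(4) by simp
  qed
  have "coprime (card (Q <#> A)) (card K)"
  proof -
    have "coprime (card Q) (card K)" using oddK by (simp add: s.card_Q coprime_8_iff_odd)
    moreover have "coprime (card A) (card K)"
      using s.AB_facts(5) s.coprime_3 E(7) by (rule_tac s.card_\<Theta>) simp
    ultimately show ?thesis using s.QA_facts(7) by simp
  qed
  then have "\<exists>g\<in>carrier G. {\<one>, s.z} <#> conj_set G g K = {\<one>, s.z} <#> K'"
  proof (intro schur_zassenhaus_step[OF fin D(1) s.normal_z _ s.commutator_QA D(3,4,5) D'(3)])
    have "q \<in> Q <#> A" if "q \<in> Q" for q
      using s.QA_facts(3) that subgroup.one_closed[OF s.AB_facts(1)] Qc(1) unfolding set_mult_def by force
    then show "{\<one>, s.z} \<subseteq> Q <#> A" using s.z(1) subgroup.one_closed[OF D(2)] by blast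
    show "Q <#> A <#> K' = carrier G" "(Q <#> A) \<inter> K' = {\<one>}" using D'(4,5) u(1) Q by simp_all
  qed
  then obtain g where g: "g \<in> carrier G" "{\<one>, s.z} <#> conj_set G g K = {\<one>, s.z} <#> K'" by blast
  have Kc: "K \<subseteq> carrier G" "K' \<subseteq> carrier G" using D(3) D'(3) subgroup.subset by blast+
  have "conj_set G g K \<subseteq> K'"
  proof
    fix y assume y: "y \<in> conj_set G g K"
    have sg: "subgroup (conj_set G g K) G" by (rule conj_set_subgroup[OF g(1) D(3)])
    have yc: "y \<in> carrier G" using y sg subgroup.mem_carrier by metis
    have "\<one> \<otimes> y \<in> {\<one>, s.z} <#> conj_set G g K" using y unfolding set_mult_def by blast
    then have "y \<in> {\<one>, s.z} <#> K'" using yc g(2) by simp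
    then obtain m k where mk: "m \<in> {\<one>, s.z}" "k \<in> K'" "y = m \<otimes> k" unfolding set_mult_def by blast
    have kc: "k \<in> carrier G" using mk Kc by blast
    have y1: "y [^] card K = \<one>" using pow_card_subgroup[OF sg y] card_conj_set[OF g(1) Kc(1)] by simp
    have k1: "k [^] card K = \<one>" using pow_card_subgroup[OF D'(3) mk(2)] cardK by simp
    \<comment> \<open>|K| is odd: y and k are killed by it, whereas z^|K| = z. So the ambiguity left
      by working modulo z does not occur.\<close>
    have "m \<noteq> s.z"
    proof
      assume m: "m = s.z"
      have "y [^] card K = s.z [^] card K \<otimes> k [^] card K"
        unfolding mk(3) m by (rule pow_mult_distrib[OF s.z_central[OF kc] s.zc kc])
      also have "s.z [^] card K = s.z"
      proof -
        obtain i where i: "card K = 2 * i + 1" using oddK by (rule oddE)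
        have "s.z [^] (2::nat) = \<one>" using s.z(3) s.zc by (simp add: numeral_eq_Suc)
        then have "s.z [^] (2 * i) = \<one>" by (rule pow_mult_eq_one[OF s.zc])
        then show ?thesis unfolding i using s.zc by simp
      qed
      finally show False using y1 k1 s.zc s.z(2) by simp
    qed
    then show "y \<in> K'" using mk kc by simp
  qed
  moreover have "finite K'" using Kc fin finite_subset by blast
  ultimately have gK: "conj_set G g K = K'"
    using card_subset_eq card_conj_set[OF g(1) Kc(1)] cardK by metis
  have cK: "card K = card \<Theta> * card B" "card K = card B * card \<Theta>" using E(7) by simp_all
  have cK': "card K' = card \<Theta>' * card B'" "card K' = card B' * card \<Theta>'" using E'(7) by simp_all
  have co: "coprime (card \<Theta>) (card B)" "coprime (card B) (card \<Theta>)"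
    "coprime (card \<Theta>') (card B')" "coprime (card B') (card \<Theta>')"
    using s.coprime_Q\<Theta>(4) t.coprime_Q\<Theta>(4) by (simp_all add: coprime_commute)
  have "conj_set G g \<Theta> = \<Theta>'"
    using hall_subgroup_eq[OF fin D(3) E(5) cK(1) co(1)] hall_subgroup_eq[OF fin D'(3) E'(5) cK'(1) co(3)]
      conj_set_power_torsion[OF g(1) Kc(1) gK, of "card \<Theta>"] card\<Theta> by metis
  moreover have "conj_set G g B = B'"
    using hall_subgroup_eq[OF fin D(3) E(6) cK(2) co(2)] hall_subgroup_eq[OF fin D'(3) E'(6) cK'(2) co(4)]
      conj_set_power_torsion[OF g(1) Kc(1) gK, of "card B"] u(2) by metis
  moreover have "conj_set G g A = A'" "conj_set G g Q = Q'"
    using conj_set_normal[OF s.normal_A g(1)] conj_set_normal[OF s.normal_Q g(1)] u(1) Q by simp_all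
  ultimately show ?thesis using g u Q by blast
qed

end

section \<open>Normal Hall subgroups in groups of type V\<close>

locale type_V = group G for G (structure) +
  fixes A B S
  assumes fin: "finite (carrier G)" and type_V: "structure_V G A B S"
begin

lemma AB: "AB_conditions G A B"
  using type_V by (simp add: structure_V_def)

lemmas AB_facts = AB_conditionsD[OF AB]

lemma S_AB: "internal_direct G S (A <#> B)" and A_B: "internal_semidirect (G\<lparr>carrier := A <#> B\<rparr>) A B"
  and S: "G\<lparr>carrier := S\<rparr> \<cong> SL2_F5"
  using type_V by (simp_all add: structure_V_def)

lemmas direct = internal_directD[OF S_AB]
lemmas semidirect = internal_semidirect_subgroup[OF direct(4) A_B]

lemma card_S: "card S = 120"
  using iso_same_card[OF S] card_SL2_F5 by simp

lemma coprime_120: "coprime 120 (card A * card B)"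
proof -
  have "coprime (card A) 15" "coprime (card B) 15" using type_V by (simp_all add: structure_V_def)
  then have "coprime (8 * 15) (card A * card B)"
    using AB_facts(3,4) unfolding coprime_mult_left_iff coprime_8_iff_odd by (simp add: coprime_commute)
  then show ?thesis by simp
qed

lemma order_V: "order G = 120 * (card A * card B)"
  using direct(7) semidirect(6) card_S by simp

lemma normal_A: "A \<lhd> G"
  by (rule hall_subgroup_normal[OF fin direct(2) semidirect(5,6) AB_facts(5)])

lemma S_eq: "S = {x \<in> carrier G. x [^] (120::nat) = \<one>}"
proof
  show "S \<subseteq> {x \<in> carrier G. x [^] (120::nat) = \<one>}"
    using pow_card_subgroup[OF direct(3)] direct(3) card_S subgroup.subset by fastforce
  show "{x \<in> carrier G. x [^] (120::nat) = \<one>} \<subseteq> S"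
    using normal_mem_of_pow[OF direct(1) fin _ coprime_120] order_V card_S by auto
qed

lemma AB_eq: "A <#> B = {x \<in> carrier G. x [^] (card A * card B) = \<one>}"
proof
  show "A <#> B \<subseteq> {x \<in> carrier G. x [^] (card A * card B) = \<one>}"
    using pow_card_subgroup[OF direct(4)] direct(4) semidirect(6) subgroup.subset by fastforce
  have "coprime (card A * card B) 120" using coprime_120 by (simp add: coprime_commute)
  then show "{x \<in> carrier G. x [^] (card A * card B) = \<one>} \<subseteq> A <#> B"
    using normal_mem_of_pow[OF direct(2) fin, of 120 "card A * card B"] order_V semidirect(6) by auto
qed

end

context group
begin

text \<open>The two direct factors are the sets of elements killed by their orders, hence do not
  depend on the structure. Only \<open>B\<close> remains to be moved, which happens inside
  \<open>A B\<close>, where it is a complement of the abelian \<open>A\<close>.\<close>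

lemma structure_V_unique:
  assumes fin: "finite (carrier G)" and s: "structure_V G A B S" and t: "structure_V G A' B' S'"
  shows "(\<exists>g\<in>carrier G. conj_set G g A = A' \<and> conj_set G g B = B' \<and> conj_set G g S = S') \<and> A' = A \<and> S' = S"
proof -
  interpret s: type_V G A B S by unfold_locales (fact fin s)+
  interpret t: type_V G A' B' S' by unfold_locales (fact fin t)+
  have u: "A' = A" "card B' = card B"
    using AB_unique[OF fin s.normal_A s.AB s.order_V s.coprime_120 t.normal_A t.AB t.order_V t.coprime_120
        t.coprime_120 s.coprime_120] by simp_all
  have S: "S' = S" using s.S_eq t.S_eq by simp
  have AB: "A' <#> B' = A <#> B" using s.AB_eq t.AB_eq u by simp
  interpret L: group "G\<lparr>carrier := A <#> B\<rparr>" by (rule subgroup_imp_group[OF s.direct(4)])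
  have Lc: "A <#> B \<subseteq> carrier G" using s.direct(4) subgroup.subset by blast
  have sd: "internal_semidirect (G\<lparr>carrier := A <#> B\<rparr>) A B'" using t.A_B AB u(1) by simp
  obtain g where g: "g \<in> carrier (G\<lparr>carrier := A <#> B\<rparr>)" "conj_set (G\<lparr>carrier := A <#> B\<rparr>) g B = B'"
  proof (rule L.complement_conjugate[OF _ s.semidirect(5) _ s.A_B sd s.AB_facts(5)])
    show "finite (carrier (G\<lparr>carrier := A <#> B\<rparr>))" using Lc fin finite_subset by auto
  qed (use s.AB_facts(6) in auto)
  have gc: "g \<in> carrier G" using g Lc by auto
  have "conj_set G g B = B'" using g conj_set_consistent[OF s.direct(4)] by simp
  then show ?thesis
    using conj_set_normal[OF s.normal_A gc] conj_set_normal[OF s.direct(1) gc] gc u S by auto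
qed

lemma cyclic_4_generator:
  assumes P: "subgroup P G" and iso: "G\<lparr>carrier := P\<rparr> \<cong> integer_mod_group 4"
  obtains f where "f \<in> P" "ord f = 4" "\<And>x. x \<in> P \<Longrightarrow> \<exists>i::nat. x = f [^] i" "card P = 4"
proof -
  let ?Z = "integer_mod_group 4"
  interpret P: group "G\<lparr>carrier := P\<rparr>" by (rule subgroup_imp_group[OF P])
  obtain h where h: "h \<in> iso ?Z (G\<lparr>carrier := P\<rparr>)" using P.iso_sym[OF iso] by (auto simp: is_iso_def)
  interpret h: group_hom ?Z "G\<lparr>carrier := P\<rparr>" h
    using h by (simp add: group_hom_def group_hom_axioms_def iso_def P.is_group)
  have inj: "inj_on h (carrier ?Z)" and img: "h ` carrier ?Z = P" using h by (auto simp: iso_def bij_betw_def)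
  have Zc: "carrier ?Z = {0..<4}" by (simp add: carrier_integer_mod_group)
  have f: "h 1 \<in> P" "h 1 \<in> carrier G" using img Zc P subgroup.mem_carrier by fastforce+
  have pow: "h 1 [^] i = h (int i mod 4)" for i :: nat
  proof -
    have "h 1 [^]\<^bsub>G\<lparr>carrier := P\<rparr>\<^esub> i = h (1 [^]\<^bsub>?Z\<^esub> i)" by (rule h.hom_nat_pow[symmetric]) (simp add: Zc)
    then show ?thesis by (simp add: nat_pow_consistent[symmetric])
  qed
  have h0: "h 0 = \<one>" using h.hom_one by simp
  have "ord (h 1) = 4"
  proof (subst ord_unique[OF f(2)], intro allI)
    fix n :: nat
    have "h (int n mod 4) = h 0 \<longleftrightarrow> int n mod 4 = 0"
      by (rule inj_on_eq_iff[OF inj]) (simp_all add: Zc)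
    moreover have "int n mod 4 = 0 \<longleftrightarrow> 4 dvd n" by presburger
    ultimately show "h 1 [^] n = \<one> \<longleftrightarrow> 4 dvd n" by (simp add: pow h0)
  qed
  moreover have "\<exists>i::nat. x = h 1 [^] i" if x: "x \<in> P" for x
  proof -
    obtain j where j: "j \<in> {0..<4}" "x = h j" using x img Zc by blast
    then have "x = h 1 [^] nat j" unfolding pow by simp
    then show ?thesis by blast
  qed
  moreover have "card P = 4" using iso_same_card[OF iso] Zc by simp
  ultimately show ?thesis using that f by blast
qed

text \<open>If a generator of P lay in H, then P would have trivial image in the quotient of order
  2. So it lies outside, and its square is an involution in H.\<close>

lemma ext_by_2_generator:
  assumes fin: "finite (carrier G)" and ext: "nonsplit_ext_by_2 G H"
    and P: "subgroup P G" "G\<lparr>carrier := P\<rparr> \<cong> integer_mod_group 4"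
    and surj: "(\<lambda>f. H #> f) ` P = carrier (G Mod H)"
  obtains f where "H \<lhd> G" "order G = 2 * card H" "f \<in> P" "f \<in> carrier G" "f \<notin> H" "ord f = 4"
    "f \<otimes> f \<in> H" "f \<otimes> f \<noteq> \<one>" "(f \<otimes> f) \<otimes> (f \<otimes> f) = \<one>"
    "card P = 4" "\<And>x. x \<in> P \<Longrightarrow> \<exists>i::nat. x = f [^] i"
proof -
  obtain f where f: "f \<in> P" "ord f = 4" "\<And>x. x \<in> P \<Longrightarrow> \<exists>i::nat. x = f [^] i" "card P = 4"
    using cyclic_4_generator[OF P] by blast
  have H: "H \<lhd> G" using ext by (simp add: nonsplit_ext_by_2_def)
  have sH: "subgroup H G" using H normal_imp_subgroup by blast
  have fc: "f \<in> carrier G" using f P subgroup.mem_carrier by metis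
  have "G Mod H \<cong> integer_mod_group 2" using ext by (simp add: nonsplit_ext_by_2_def)
  then have c2: "card (carrier (G Mod H)) = 2"
    using iso_same_card by (fastforce simp: carrier_integer_mod_group)
  then have ord: "order G = 2 * card H" using lagrange[OF sH] by (simp add: FactGroup_def)
  have fH: "f \<notin> H"
  proof
    assume "f \<in> H"
    have "H #> x = H" if x: "x \<in> P" for x
    proof -
      obtain i where "x = f [^] (i::nat)" using f(3)[OF x] by blast
      moreover have "f [^] i \<in> H" for i :: nat
        by (induction i) (use \<open>f \<in> H\<close> sH subgroup.one_closed subgroup.m_closed in \<open>auto\<close>)
      ultimately show ?thesis using coset_join2[OF _ sH] fc by simp
    qed
    then have "carrier (G Mod H) \<subseteq> {H}" unfolding surj[symmetric] by blast
    then have "card (carrier (G Mod H)) \<le> card {H}" by (intro card_mono) auto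
    then show False using c2 by simp
  qed
  have pow: "f [^] (2::nat) = f \<otimes> f" "f [^] (4::nat) = (f \<otimes> f) \<otimes> (f \<otimes> f)"
    using fc by (simp_all add: numeral_eq_Suc m_assoc)
  have "f \<otimes> f \<noteq> \<one>" using pow(1) pow_eq_id[OF fc, of 2] f(2) by auto
  moreover have "(f \<otimes> f) \<otimes> (f \<otimes> f) = \<one>" using pow(2) pow_eq_id[OF fc, of 4] f(2) by simp
  moreover have "f \<otimes> f \<in> H" by (rule index_2_mult[OF fin H ord fc fH fc fH])
  ultimately show ?thesis using that H ord f fc fH by blast
qed

lemma conj_set_cyclic_4:
  assumes fin: "finite (carrier G)" and x: "x \<in> carrier G" and f: "f \<in> carrier G"
    and P: "subgroup P G" "\<And>y. y \<in> P \<Longrightarrow> \<exists>i::nat. y = f [^] i"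
    and P': "subgroup P' G" "card P' = card P" and f': "cj x f \<in> P'"
  shows "conj_set G x P = P'"
proof -
  have Pc: "P \<subseteq> carrier G" "P' \<subseteq> carrier G" using P P' subgroup.subset by blast+
  have pow: "cj x f [^] i \<in> P'" for i :: nat
    by (induction i) (use f' P'(1) subgroup.one_closed subgroup.m_closed in auto)
  have "conj_set G x P \<subseteq> P'"
  proof
    fix y assume "y \<in> conj_set G x P"
    then obtain p where p: "p \<in> P" "y = cj x p" unfolding conj_set_eq by blast
    obtain i where "p = f [^] (i::nat)" using P(2)[OF p(1)] by blast
    then have "y = cj x f [^] i" using p cj_pow[OF x f] by simp
    then show "y \<in> P'" using pow by simp
  qed
  moreover have "finite P'" using Pc fin finite_subset by blast
  ultimately show ?thesis using card_subset_eq card_conj_set[OF x Pc(1)] P'(2) by metis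
qed

lemma conj_set_commuting:
  assumes "v \<in> carrier G" "U \<subseteq> carrier G" "\<And>x. x \<in> U \<Longrightarrow> v \<otimes> x = x \<otimes> v"
  shows "conj_set G v U = U"
proof -
  have "cj v x = x" if "x \<in> U" for x using assms that cj_eq_iff_commute by blast
  then show ?thesis unfolding conj_set_eq by simp
qed

lemma odd_order_mem_index_2:
  assumes "finite (carrier G)" "H \<lhd> G" "order G = 2 * card H" "x \<in> carrier G" "x [^] (n::nat) = \<one>" "odd n"
  shows "x \<in> H"
  using normal_mem_of_pow[of H 2 n x] assms by (simp add: mult.commute)

lemma odd_inverted_conjugate:
  assumes w: "w \<in> carrier G" "w [^] (n::nat) = \<one>" "odd n" and f: "f \<in> carrier G"
    and inv: "w \<otimes> cj f w = \<one>"
  obtains i :: nat where "cj (w [^] i) f = w \<otimes> f"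
proof -
  obtain k where k: "n = 2 * k + 1" using w(3) by (rule oddE)
  \<comment> \<open>With n = 2 k + 1 the power w^(k+1) squares to w^(n+1) = w.\<close>
  define v where "v = w [^] Suc k"
  have vc: "v \<in> carrier G" using w by (simp add: v_def)
  have "v \<otimes> v = w [^] (n + 1)" unfolding v_def k using w(1) by (simp only: nat_pow_mult) (simp add: mult_2)
  then have vv: "v \<otimes> v = w" using w by simp
  have "w \<otimes> cj f w = \<one>" by (rule inv)
  then have "cj f w = inv w" using w(1) f inv_equality inv_comm by (metis inv_closed m_closed)
  then have "cj f v = inv v"
    unfolding v_def using cj_pow[OF f w(1), of "Suc k"] nat_pow_inv[OF w(1), of "Suc k"] by simp
  then have "cj f (inv v) = v" using cj_inv[OF f vc] vc by simp
  moreover have "cj v f = v \<otimes> cj f (inv v) \<otimes> f" using vc f by (simp add: word_simps)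
  ultimately have "cj v f = w \<otimes> f" using vv by simp
  then show ?thesis using that unfolding v_def by blast
qed

lemma pow_commute:
  assumes "w \<in> carrier G" "x \<in> carrier G" "w \<otimes> x = x \<otimes> w" shows "w [^] (i::nat) \<otimes> x = x \<otimes> w [^] i"
  by (induction i) (use assms in \<open>simp_all, metis m_assoc nat_pow_closed\<close>)

section \<open>Type IV\<close>

lemma index_2_subset_eq:
  assumes "finite (carrier G)" "H \<subseteq> H'" "H' \<subseteq> carrier G" "order G = 2 * card H" "order G = 2 * card H'"
  shows "H' = H"
  using card_subset_eq[of H' H] assms finite_subset by auto

text \<open>The second alternative for the conjugate of f is z f', which is also the inverse of f',
  because f'^4 = 1; either way it lies in the cyclic group generated by f'.\<close>

lemma type_IV_core:
  assumes fin: "finite (carrier G)" and H: "H \<lhd> G" and ord: "order G = 2 * card H"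
    and s: "structure_III (G\<lparr>carrier := H\<rparr>) A B Q \<Theta>"
    and f: "f \<in> carrier G" "f \<notin> H" and f': "f' \<in> carrier G" "f' \<notin> H"
    and ff: "f \<otimes> f \<noteq> \<one>" "(f \<otimes> f) \<otimes> (f \<otimes> f) = \<one>"
    and ff': "f' \<otimes> f' \<noteq> \<one>" "(f' \<otimes> f') \<otimes> (f' \<otimes> f') = \<one>"
    and fB: "\<And>b. b \<in> B \<Longrightarrow> cj f b = b" "\<And>b. b \<in> B \<Longrightarrow> cj f' b = b"
    and f\<Theta>: "\<And>t. t \<in> \<Theta> \<Longrightarrow> cj f t = inv t" "\<And>t. t \<in> \<Theta> \<Longrightarrow> cj f' t = inv t"
  obtains v where "v \<in> H" "\<And>x. x \<in> \<Theta> \<Longrightarrow> v \<otimes> x = x \<otimes> v" "\<And>x. x \<in> B \<Longrightarrow> v \<otimes> x = x \<otimes> v"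
    "cj v f = f' \<or> cj v f = (f' \<otimes> f') \<otimes> f'"
proof -
  have sH: "subgroup H G" using H normal_imp_subgroup by blast
  have Hc: "H \<subseteq> carrier G" using sH subgroup.subset by blast
  interpret HG: group "G\<lparr>carrier := H\<rparr>" by (rule subgroup_imp_group[OF sH])
  interpret s: type_III "G\<lparr>carrier := H\<rparr>" A B Q \<Theta>
    using s fin Hc finite_subset by unfold_locales auto
  define z where "z = s.z"
  have inv_z: "x = \<one> \<or> x = z" if "x \<in> H" "x \<otimes> x = \<one>" for x
    using s.involution[of x] that by (simp add: z_def)
  have zH: "z \<in> H" "z \<noteq> \<one>" "z \<otimes> z = \<one>" using s.zc s.z by (simp_all add: z_def)
  have zc: "z \<in> carrier G" using zH Hc by blast
  have zf: "f \<otimes> f = z" "f' \<otimes> f' = z"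
    using inv_z[OF index_2_mult[OF fin H ord f f]] inv_z[OF index_2_mult[OF fin H ord f' f']] ff ff' by auto
  have sub: "subgroup A G" "subgroup B G" "subgroup \<Theta> G" "subgroup Q G" "subgroup (\<Theta> <#> B) G" "subgroup (Q <#> A) G"
    using incl_subgroup[OF sH] s.AB_facts(1,2) s.\<Theta>B_facts(1) s.Q8(1) s.semidirect(2,3) by simp_all
  have inA: "x \<in> carrier G" if "x \<in> A" for x using that sub subgroup.mem_carrier by metis
  have inB: "x \<in> carrier G" if "x \<in> B" for x using that sub subgroup.mem_carrier by metis
  have inT: "x \<in> carrier G" if "x \<in> \<Theta>" for x using that sub subgroup.mem_carrier by metis
  have inQ: "x \<in> carrier G" if "x \<in> Q" for x using that sub subgroup.mem_carrier by metis
  define h where "h = f' \<otimes> inv f"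
  have "inv f \<notin> H" using f sH subgroup.m_inv_closed inv_inv by metis
  then have hH: "h \<in> H" unfolding h_def using index_2_mult[OF fin H ord f'] f(1) by simp
  have hc: "h \<in> carrier G" using hH Hc by blast
  have f'h: "f' = h \<otimes> f" unfolding h_def using f(1) f'(1) by (simp add: m_assoc)
  \<comment> \<open>f and f' act alike on \<open>B\<close> and on \<open>\<Theta>\<close>, so their
    quotient h centralizes both.\<close>
  have hf: "cj f' x = cj h (cj f x)" if "x \<in> carrier G" for x
    unfolding f'h using cj_cj[OF hc f(1) that] by simp
  have hB: "cj h b = b" if b: "b \<in> B" for b
    using hf[OF inB[OF b]] fB b by simp
  have hT: "cj h t = t" if t: "t \<in> \<Theta>" for t
  proof -
    have it: "inv t \<in> \<Theta>" using t sub(3) subgroup.m_inv_closed by metis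
    have "cj f (inv t) = t" using f\<Theta>(1)[OF it] inT[OF t] by simp
    then show ?thesis using hf[OF inT[OF it]] f\<Theta>(2)[OF it] inT[OF t] by simp
  qed
  obtain y k where yk: "y \<in> Q <#> A" "k \<in> \<Theta> <#> B" "h = y \<otimes> k"
    using hH s.semidirect(4) by (auto simp: set_mult_def)
  obtain q a where qa: "q \<in> Q" "a \<in> A" "y = q \<otimes> a" using yk(1) by (auto simp: set_mult_def)
  obtain t b where tb: "t \<in> \<Theta>" "b \<in> B" "k = t \<otimes> b" using yk(2) by (auto simp: set_mult_def)
  have c: "q \<in> carrier G" "a \<in> carrier G" "t \<in> carrier G" "b \<in> carrier G"
    using qa tb inA inB inT inQ by blast+
  have TB: "x \<otimes> y = y \<otimes> x" if "x \<in> \<Theta>" "y \<in> B" for x y using s.\<Theta>B_facts(8)[OF that] by simp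
  have TT: "x \<otimes> y = y \<otimes> x" if "x \<in> \<Theta>" "y \<in> \<Theta>" for x y using s.\<Theta>_commute[OF that] by simp
  have BB: "x \<otimes> y = y \<otimes> x" if "x \<in> B" "y \<in> B" for x y using s.AB_facts(7)[OF that] by simp
  have kfix: "k \<otimes> x = x \<otimes> k" if x: "x \<in> \<Theta> \<union> B" for x
  proof -
    have xc: "x \<in> carrier G" using x inT inB by blast
    have tx: "t \<otimes> x = x \<otimes> t" using x TT[OF tb(1)] TB[OF tb(1)] by auto
    have "b \<otimes> x = x \<otimes> b" using x TB[OF _ tb(2), symmetric] BB[OF tb(2)] by auto
    with tx show ?thesis unfolding tb(3) using c xc by (metis m_assoc)
  qed
  have kc: "k \<in> carrier G" using c tb by simp
  have yc: "y \<in> carrier G" using c qa by simp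
  have nQ: "cj x y \<in> Q" if "x \<in> H" "y \<in> Q" for x y
    using HG.normal_cj[OF s.normal_Q, of x y] that sH by simp
  have nA: "cj x y \<in> A" if "x \<in> H" "y \<in> A" for x y
    using HG.normal_cj[OF s.normal_A, of x y] that sH by simp
  have QA1: "Q \<inter> A = {\<one>}" using s.QA_facts(4) by simp
  have BH: "B \<subseteq> H" "\<Theta> \<subseteq> H" using s.AB_facts(2) s.\<Theta>B_facts(1) subgroup.subset by fastforce+
  \<comment> \<open>h and k both commute with x, so q a does. As x normalizes Q and
    \<open>A\<close>, which meet trivially, conjugation by x fixes the two factors
    separately.\<close>
  have fix_qa: "cj x q = q" "cj x a = a" if x: "x \<in> \<Theta> \<union> B" for x
  proof -
    have xH: "x \<in> H" and xc: "x \<in> carrier G" using x BH Hc by blast+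
    have "cj h x = x" using x hB hT by blast
    then have hx: "h \<otimes> x = x \<otimes> h" using cj_eq_iff_commute[OF hc xc] by simp
    have "y = h \<otimes> inv k" using yk(3) yc kc by (simp add: m_assoc)
    moreover have "inv k \<otimes> x = x \<otimes> inv k"
      using kfix[OF x] kc xc by (metis inv_closed inv_solve_left inv_solve_right m_assoc m_closed)
    ultimately have "y \<otimes> x = x \<otimes> y" using hx hc kc xc by (metis inv_closed m_assoc)
    then have "cj x y = y" using cj_eq_iff_commute[OF xc yc] by simp
    then have "cj x q \<otimes> cj x a = q \<otimes> a" using cj_mult[OF xc c(1,2)] qa(3) by simp
    then show "cj x q = q" "cj x a = a"
      using decomp_unique[OF sub(4) sub(1) QA1 nQ[OF xH qa(1)] nA[OF xH qa(2)] qa(1,2)] by blast+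
  qed
  have q_or: "q = \<one> \<or> q = z"
  proof -
    have "x \<otimes> q = q \<otimes> x" if "x \<in> \<Theta>" for x
      using fix_qa(1)[of x] cj_eq_iff_commute[OF inT[OF that] c(1)] that by simp
    then show ?thesis using s.centralizer_\<Theta>[OF qa(1)] by (simp add: z_def)
  qed
  have z_comm: "z \<otimes> x = x \<otimes> z" if "x \<in> carrier G" for x
    by (rule unique_involution_central[OF H zH inv_z that])
  have q_comm: "q \<otimes> x = x \<otimes> q" if "x \<in> carrier G" for x using q_or z_comm[OF that] that by auto
  have qq: "q \<otimes> q = \<one>" using q_or zH by auto
  define w where "w = a \<otimes> k"
  have wc: "w \<in> carrier G" using c kc by (simp add: w_def)
  have hw: "h = q \<otimes> w" using yk(3) qa(3) c kc by (simp add: w_def m_assoc)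
  have ak: "a \<otimes> k = k \<otimes> a"
  proof -
    have "t \<otimes> a = a \<otimes> t" "b \<otimes> a = a \<otimes> b"
      using fix_qa(2) cj_eq_iff_commute[OF _ c(2)] c tb by (metis UnI1 UnI2)+
    then show ?thesis unfolding tb(3) using c by (metis m_assoc)
  qed
  have w_comm: "w \<otimes> x = x \<otimes> w" if x: "x \<in> \<Theta> \<union> B" for x
  proof -
    have xc: "x \<in> carrier G" using x BH Hc by blast
    have "a \<otimes> x = x \<otimes> a" using fix_qa(2)[OF x] cj_eq_iff_commute[OF xc c(2)] by simp
    then show ?thesis unfolding w_def using kfix[OF x] xc c kc by (metis m_assoc)
  qed
  \<comment> \<open>Equality of the squares of f and f' says that f inverts h. The factor q is
    central with square 1, so it cancels and the relation holds for w.\<close>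
  have w_inv: "w \<otimes> cj f w = \<one>"
  proof -
    have "f' \<otimes> f' = h \<otimes> cj f h \<otimes> (f \<otimes> f)" unfolding f'h using hc f(1) by (simp add: word_simps)
    then have "z = h \<otimes> cj f h \<otimes> z" using zf by simp
    then have "h \<otimes> cj f h = \<one>" using hc f(1) zc r_cancel_one' by (metis inv_closed m_closed)
    moreover have "cj f h = q \<otimes> cj f w"
    proof -
      have "cj f q = q" using q_comm[OF f(1)] cj_eq_iff_commute[OF f(1) c(1)] by simp
      then show ?thesis unfolding hw using cj_mult[OF f(1) c(1) wc] by simp
    qed
    moreover have "h \<otimes> (q \<otimes> cj f w) = w \<otimes> cj f w"
    proof -
      have "h \<otimes> (q \<otimes> cj f w) = (q \<otimes> q) \<otimes> (w \<otimes> cj f w)"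
        unfolding hw using q_comm[OF wc] c(1) wc f(1) by (metis inv_closed m_assoc m_closed)
      then show ?thesis using qq wc f(1) by simp
    qed
    ultimately show ?thesis by simp
  qed
  let ?n = "card A * card (\<Theta> <#> B)"
  have "w [^] ?n = a [^] ?n \<otimes> k [^] ?n" unfolding w_def by (rule pow_mult_distrib[OF ak c(2) kc])
  moreover have "a [^] ?n = \<one>" using pow_mult_eq_one[OF c(2) pow_card_subgroup[OF sub(1) qa(2)]] .
  moreover have "k [^] ?n = \<one>"
    using pow_mult_eq_one[OF kc pow_card_subgroup[OF sub(5) yk(2)], of "card A"] by (simp add: mult.commute)
  ultimately have wn: "w [^] ?n = \<one>" by simp
  have odd: "odd ?n"
  proof -
    obtain i where "card \<Theta> = 3 ^ i" by (rule s.card_\<Theta>)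
    then show ?thesis using s.AB_facts(3,4) s.\<Theta>B_facts(7) by simp
  qed
  obtain i :: nat where i: "cj (w [^] i) f = w \<otimes> f"
    by (rule odd_inverted_conjugate[OF wc wn odd f(1) w_inv])
  have "w \<otimes> f = q \<otimes> f'"
    unfolding f'h hw using c(1) wc f(1) qq by (simp flip: m_assoc)
  then have "cj (w [^] i) f = f' \<or> cj (w [^] i) f = (f' \<otimes> f') \<otimes> f'"
    using i q_or f'(1) zf(2) by auto
  moreover have "w \<in> H"
  proof -
    have "w = q \<otimes> h" unfolding hw using c(1) wc qq by (simp flip: m_assoc)
    moreover have "q \<in> H" using q_or zH subgroup.one_closed[OF sH] by auto
    ultimately show ?thesis using hH sH subgroup.m_closed by metis
  qed
  then have "w [^] i \<in> H" by (induction i) (use sH subgroup.one_closed subgroup.m_closed in auto)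
  moreover have "w [^] i \<otimes> x = x \<otimes> w [^] i" if "x \<in> \<Theta> \<union> B" for x
    using pow_commute[OF wc _ w_comm[OF that]] that inT inB by blast
  ultimately show ?thesis using that[of "w [^] i"] by blast
qed

lemma cj_conj_set_inv:
  assumes "\<And>x. x \<in> U \<Longrightarrow> cj f x = inv x" "f \<in> carrier G" "g \<in> carrier G" "U \<subseteq> carrier G" "y \<in> conj_set G g U"
  shows "cj (cj g f) y = inv y"
proof -
  obtain x where x: "x \<in> U" "y = cj g x" using assms(5) unfolding conj_set_eq by blast
  have xc: "x \<in> carrier G" using x assms(4) by blast
  have "cj (cj g f) y = cj g (cj f x)" unfolding x(2) using assms(2,3) xc by (simp add: word_simps)
  then show ?thesis using assms(1)[OF x(1)] cj_inv[OF assms(3) xc] x(2) by simp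
qed

lemma cj_conj_set_fix:
  assumes "\<And>x. x \<in> U \<Longrightarrow> cj f x = x" "f \<in> carrier G" "g \<in> carrier G" "U \<subseteq> carrier G" "y \<in> conj_set G g U"
  shows "cj (cj g f) y = y"
proof -
  obtain x where x: "x \<in> U" "y = cj g x" using assms(5) unfolding conj_set_eq by blast
  have xc: "x \<in> carrier G" using x assms(4) by blast
  have "cj (cj g f) y = cj g (cj f x)" unfolding x(2) using assms(2,3) xc by (simp add: word_simps)
  then show ?thesis using assms(1)[OF x(1)] x(2) by simp
qed

lemma cj_square:
  assumes "g \<in> carrier G" "f \<in> carrier G"
  shows "cj g f \<otimes> cj g f = cj g (f \<otimes> f)"
  using assms by (simp add: word_simps)

lemma normal_cj_iff:
  assumes N: "N \<lhd> G" and g: "g \<in> carrier G" and x: "x \<in> carrier G" shows "cj g x \<in> N \<longleftrightarrow> x \<in> N"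
proof
  assume "cj g x \<in> N"
  then have "cj (inv g) (cj g x) \<in> N" using normal_cj[OF N, of "inv g"] g by simp
  then show "x \<in> N" using g x by (simp add: word_simps)
qed (rule normal_cj[OF N g])

text \<open>\<open>A\<close>, \<open>B\<close> and \<open>\<Theta>\<close> have odd order and so lie
  in H'. If Q did not, its intersection with H' would be a \<open>\<Theta>\<close>-invariant
  subgroup of order 4.\<close>

lemma type_IV_subset_index_2:
  assumes fin: "finite (carrier G)" and H: "subgroup H G"
    and s: "structure_III (G\<lparr>carrier := H\<rparr>) A B Q \<Theta>"
    and H': "H' \<lhd> G" "order G = 2 * card H'"
  shows "H \<subseteq> H'"
proof -
  have Hc: "H \<subseteq> carrier G" using H subgroup.subset by blast
  have sH': "subgroup H' G" using H' normal_imp_subgroup by blast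
  interpret HG: group "G\<lparr>carrier := H\<rparr>" by (rule subgroup_imp_group[OF H])
  interpret s: type_III "G\<lparr>carrier := H\<rparr>" A B Q \<Theta>
    using s fin Hc finite_subset by unfold_locales auto
  have sub: "subgroup A G" "subgroup B G" "subgroup \<Theta> G" "subgroup Q G"
    using incl_subgroup[OF H] s.AB_facts(1,2) s.\<Theta>B_facts(1) s.Q8(1) by simp_all
  have odd_sub: "U \<subseteq> H'" if U: "subgroup U G" "odd (card U)" for U
  proof
    fix x assume x: "x \<in> U"
    then have "x \<in> carrier G" using U(1) subgroup.mem_carrier by metis
    then show "x \<in> H'" by (rule odd_order_mem_index_2[OF fin H' _ pow_card_subgroup[OF U(1) x] U(2)])
  qed
  have "odd (card \<Theta>)"
  proof -
    obtain k where "card \<Theta> = 3 ^ k" by (rule s.card_\<Theta>)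
    then show ?thesis by simp
  qed
  then have AB\<Theta>: "A \<subseteq> H'" "B \<subseteq> H'" "\<Theta> \<subseteq> H'" using odd_sub sub s.AB_facts(3,4) by blast+
  have "Q \<subseteq> H'"
  proof (rule ccontr)
    assume "\<not> Q \<subseteq> H'"
    then obtain x where x: "x \<in> Q" "x \<notin> H'" by blast
    have Qc: "Q \<subseteq> carrier G" using sub(4) subgroup.subset by blast
    have xc: "x \<in> carrier G" using x Qc by blast
    define W where "W = Q \<inter> H'"
    have sW: "subgroup W G" unfolding W_def using subgroups_Inter_pair sub(4) sH' by blast
    have QH: "Q \<subseteq> H" using s.Q8(1) subgroup.subset by fastforce
    have finQ: "finite Q" using Qc fin finite_subset by blast
    \<comment> \<open>Left multiplication by x exchanges W and the rest of Q, so each has four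
      elements.\<close>
    have img: "(\<lambda>y. x \<otimes> y) ` (Q - H') \<subseteq> W"
    proof
      fix y assume "y \<in> (\<lambda>y. x \<otimes> y) ` (Q - H')"
      then obtain u where u: "u \<in> Q" "u \<notin> H'" "y = x \<otimes> u" by blast
      have "x \<otimes> u \<in> H'" by (rule index_2_mult[OF fin H' xc x(2)]) (use u Qc in auto)
      moreover have "x \<otimes> u \<in> Q" using x(1) u(1) sub(4) subgroup.m_closed by metis
      ultimately show "y \<in> W" using u by (simp add: W_def)
    qed
    have img': "(\<lambda>y. x \<otimes> y) ` W \<subseteq> Q - H'"
    proof
      fix y assume "y \<in> (\<lambda>y. x \<otimes> y) ` W"
      then obtain u where u: "u \<in> Q" "u \<in> H'" "y = x \<otimes> u" by (auto simp: W_def)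
      have "x \<otimes> u \<in> Q" using x(1) u(1) sub(4) subgroup.m_closed by metis
      moreover have "x \<otimes> u \<notin> H'"
      proof
        assume "x \<otimes> u \<in> H'"
        then have "x \<otimes> u \<otimes> inv u \<in> H'" using u sH' subgroup.m_closed subgroup.m_inv_closed by metis
        then show False using x xc u Qc by (auto simp: m_assoc)
      qed
      ultimately show "y \<in> Q - H'" using u by simp
    qed
    have "card (Q - H') \<le> card W"
      using card_inj_on_le[OF _ img] inj_on_subset[OF inj_on_cmult[OF xc]] Qc finQ W_def by blast
    moreover have "card W \<le> card (Q - H')"
      using card_inj_on_le[OF _ img'] inj_on_subset[OF inj_on_cmult[OF xc]] Qc finQ W_def by blast
    moreover have "card Q = card (Q - H') + card W"
      unfolding W_def using finQ card_Diff_subset_Int[of Q H'] card_mono[of Q "Q \<inter> H'"] by (simp add: Int_commute)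
    ultimately have W4: "card W = 4" using s.card_Q by simp
    show False
    proof (rule s.no_invariant_subgroup_4[OF _ _ W4])
      show "W \<subseteq> Q" by (auto simp: W_def)
      then show "subgroup W (G\<lparr>carrier := H\<rparr>)" using subgroup_incl[OF sW H] QH by blast
      show "t \<otimes>\<^bsub>G\<lparr>carrier := H\<rparr>\<^esub> y \<otimes>\<^bsub>G\<lparr>carrier := H\<rparr>\<^esub> inv\<^bsub>G\<lparr>carrier := H\<rparr>\<^esub> t \<in> W" if "t \<in> \<Theta>" "y \<in> W" for t y
      proof -
        have tH: "t \<in> H" using that(1) s.\<Theta>B_facts(1) subgroup.subset by fastforce
        have "cj t y \<in> Q" using HG.normal_cj[OF s.normal_Q, of t y] that(2) tH H by (simp add: W_def)
        moreover have "cj t y \<in> H'" using normal_cj[OF H'(1)] that(2) tH Hc by (auto simp: W_def)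
        ultimately show ?thesis using tH H by (simp add: W_def)
      qed
    qed
  qed
  moreover have "H = Q <#> A <#> (\<Theta> <#> B)" using s.semidirect(4) by simp
  ultimately show ?thesis
    using AB\<Theta> subgroup.m_closed[OF sH'] unfolding set_mult_def by (auto; meson subsetD)
qed

lemma structure_IV_unique:
  assumes fin: "finite (carrier G)" and s: "structure_IV G A B Q \<Theta> \<Phi>" and t: "structure_IV G A' B' Q' \<Theta>' \<Phi>'"
  shows "(\<exists>g\<in>carrier G. conj_set G g A = A' \<and> conj_set G g B = B' \<and>
      conj_set G g Q = Q' \<and> conj_set G g \<Theta> = \<Theta>' \<and> conj_set G g \<Phi> = \<Phi>') \<and> A' = A \<and> Q' = Q"
proof -
  define H where "H = (Q <#> A) <#> (\<Theta> <#> B)"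
  define H' where "H' = (Q' <#> A') <#> (\<Theta>' <#> B')"
  have s3: "structure_III (G\<lparr>carrier := H\<rparr>) A B Q \<Theta>" and s4: "nonsplit_ext_by_2 G H"
    and s5: "subgroup \<Phi> G" "G\<lparr>carrier := \<Phi>\<rparr> \<cong> integer_mod_group 4" "(\<lambda>f. H #> f) ` \<Phi> = carrier (G Mod H)"
    and s6: "\<And>f. f \<in> \<Phi> \<Longrightarrow> ord f = 4 \<Longrightarrow> acts_by_inversion G f \<Theta> \<and> acts_trivially G f B"
    using s unfolding structure_IV_def Let_def H_def[symmetric] by blast+
  have t3: "structure_III (G\<lparr>carrier := H'\<rparr>) A' B' Q' \<Theta>'" and t4: "nonsplit_ext_by_2 G H'"
    and t5: "subgroup \<Phi>' G" "G\<lparr>carrier := \<Phi>'\<rparr> \<cong> integer_mod_group 4" "(\<lambda>f. H' #> f) ` \<Phi>' = carrier (G Mod H')"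
    and t6: "\<And>f. f \<in> \<Phi>' \<Longrightarrow> ord f = 4 \<Longrightarrow> acts_by_inversion G f \<Theta>' \<and> acts_trivially G f B'"
    using t unfolding structure_IV_def Let_def H'_def[symmetric] by blast+
  obtain f where f: "H \<lhd> G" "order G = 2 * card H" "f \<in> \<Phi>" "f \<in> carrier G" "f \<notin> H" "ord f = 4"
    "f \<otimes> f \<in> H" "f \<otimes> f \<noteq> \<one>" "(f \<otimes> f) \<otimes> (f \<otimes> f) = \<one>"
    "card \<Phi> = 4" "\<And>x. x \<in> \<Phi> \<Longrightarrow> \<exists>i::nat. x = f [^] i"
    by (rule ext_by_2_generator[OF fin s4 s5]) blast
  obtain f' where f': "H' \<lhd> G" "order G = 2 * card H'" "f' \<in> \<Phi>'" "f' \<in> carrier G" "f' \<notin> H'" "ord f' = 4"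
    "f' \<otimes> f' \<in> H'" "f' \<otimes> f' \<noteq> \<one>" "(f' \<otimes> f') \<otimes> (f' \<otimes> f') = \<one>"
    "card \<Phi>' = 4" "\<And>x. x \<in> \<Phi>' \<Longrightarrow> \<exists>i::nat. x = f' [^] i"
    by (rule ext_by_2_generator[OF fin t4 t5]) blast
  have sH: "subgroup H G" using f(1) normal_imp_subgroup by blast
  have Hc: "H \<subseteq> carrier G" "H' \<subseteq> carrier G" using f(1) f'(1) normal_imp_subgroup subgroup.subset by blast+
  have HH': "H' = H"
    using index_2_subset_eq[OF fin type_IV_subset_index_2[OF fin sH s3 f'(1,2)] Hc(2) f(2) f'(2)] .
  interpret HG: group "G\<lparr>carrier := H\<rparr>" by (rule subgroup_imp_group[OF sH])
  have finH: "finite (carrier (G\<lparr>carrier := H\<rparr>))" using fin Hc finite_subset by auto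
  interpret s: type_III "G\<lparr>carrier := H\<rparr>" A B Q \<Theta> using s3 finH by unfold_locales
  interpret t: type_III "G\<lparr>carrier := H\<rparr>" A' B' Q' \<Theta>' using t3 finH HH' by unfold_locales auto
  note u = HG.structure_III_unique[OF finH s3 t3[unfolded HH']]
  obtain g where g: "g \<in> H" "conj_set G g A = A'" "conj_set G g B = B'" "conj_set G g Q = Q'" "conj_set G g \<Theta> = \<Theta>'"
    using u conj_set_consistent[OF sH] by auto
  have AQ: "A' = A" "Q' = Q" using u by blast+
  have gc: "g \<in> carrier G" using g Hc by blast
  have sub: "subgroup A G" "subgroup B G" "subgroup Q G" "subgroup \<Theta> G" "subgroup B' G" "subgroup \<Theta>' G"
    using incl_subgroup[OF sH] s.AB_facts(1,2) s.\<Theta>B_facts(1) s.Q8(1) t.AB_facts(2) t.\<Theta>B_facts(1) by simp_all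
  note subc = sub[THEN subgroup.subset]
  have act: "cj f b = b" if "b \<in> B" for b
    using s6[OF f(3,6)] that unfolding acts_trivially_def conj_map_def by auto
  have act': "cj f' b = b" if "b \<in> B'" for b
    using t6[OF f'(3,6)] that unfolding acts_trivially_def conj_map_def by auto
  have inverts: "cj f x = inv x" if "x \<in> \<Theta>" for x
    using s6[OF f(3,6)] that unfolding acts_by_inversion_def conj_map_def by auto
  have inverts': "cj f' x = inv x" if "x \<in> \<Theta>'" for x
    using t6[OF f'(3,6)] that unfolding acts_by_inversion_def conj_map_def by auto
  define f1 where "f1 = cj g f"
  have f1c: "f1 \<in> carrier G" using gc f by (simp add: f1_def)
  have f1H: "f1 \<notin> H" using normal_cj_iff[OF f(1) gc f(4)] f(5) by (simp add: f1_def)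
  have f1f1: "f1 \<otimes> f1 \<noteq> \<one>" "(f1 \<otimes> f1) \<otimes> (f1 \<otimes> f1) = \<one>"
    using cj_square[OF gc f(4)] cj_square[OF gc m_closed[OF f(4,4)]] cj_eq_one_iff[OF gc m_closed[OF f(4,4)]] f(8,9) gc
    by (simp_all add: f1_def)
  \<comment> \<open>After g only \<open>\<Phi>\<close> remains to be matched. \<open>v\<close>
    centralizes \<open>\<Theta>'\<close> and \<open>B'\<close>, and it lies in H, where
    \<open>A'\<close> and \<open>Q'\<close> are normal, so the subgroups already matched stay in
    place.\<close>
  obtain v where v: "v \<in> H" "\<And>x. x \<in> \<Theta>' \<Longrightarrow> v \<otimes> x = x \<otimes> v" "\<And>x. x \<in> B' \<Longrightarrow> v \<otimes> x = x \<otimes> v"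
    "cj v f1 = f' \<or> cj v f1 = (f' \<otimes> f') \<otimes> f'"
  proof (rule type_IV_core[OF fin f(1,2) t3[unfolded HH'] f1c f1H f'(4) _ f1f1 f'(8,9)])
    show "f' \<notin> H" using f'(5) HH' by simp
    show "cj f1 b = b" if "b \<in> B'" for b
      unfolding f1_def by (rule cj_conj_set_fix[OF act f(4) gc subc(2)]) (use that g in simp_all)
    show "cj f1 x = inv x" if "x \<in> \<Theta>'" for x
      unfolding f1_def by (rule cj_conj_set_inv[OF inverts f(4) gc subc(4)]) (use that g in simp_all)
  qed (use act' inverts' in blast)+
  have vc: "v \<in> carrier G" using v Hc by blast
  have comp: "conj_set G (v \<otimes> g) U = conj_set G v (conj_set G g U)" if "U \<subseteq> carrier G" for U
    using conj_set_conj_set[OF vc gc that] by simp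
  have vn: "conj_set G v A' = A'" "conj_set G v Q' = Q'"
    using HG.conj_set_normal[OF t.normal_A, of v] HG.conj_set_normal[OF t.normal_Q, of v] v conj_set_consistent[OF sH]
    by simp_all
  have vB: "conj_set G v B' = B'" by (rule conj_set_commuting[OF vc subc(5) v(3)])
  have vT: "conj_set G v \<Theta>' = \<Theta>'" by (rule conj_set_commuting[OF vc subc(6) v(2)])
  have "cj (v \<otimes> g) f = cj v f1" unfolding f1_def using cj_cj[OF vc gc f(4)] by simp
  then have "cj (v \<otimes> g) f \<in> \<Phi>'" using v(4) f'(3) t5(1) subgroup.m_closed by metis
  then have "conj_set G (v \<otimes> g) \<Phi> = \<Phi>'"
    using conj_set_cyclic_4[OF fin m_closed[OF vc gc] f(4) s5(1) f(11) t5(1)] f(10) f'(10) by simp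
  moreover have "conj_set G (v \<otimes> g) A = A'" "conj_set G (v \<otimes> g) B = B'"
    "conj_set G (v \<otimes> g) Q = Q'" "conj_set G (v \<otimes> g) \<Theta> = \<Theta>'"
    using comp subc g vn vB vT by simp_all
  ultimately show ?thesis using m_closed[OF vc gc] AQ by blast
qed

section \<open>Type VI\<close>

text \<open>h = s x with s in \<open>2A5\<close> and x in the odd-order subgroup \<open>A B\<close>.
  The component x is treated by a square root, s by the conjugacy result for the group of order 240
  generated by S and f. The two conjugating elements commute with the opposite factors, so they can
  be combined.\<close>

lemma type_VI_core:
  assumes fin: "finite (carrier G)" and H: "H \<lhd> G" and ord: "order G = 2 * card H"
    and s: "structure_V (G\<lparr>carrier := H\<rparr>) A B S"
    and f: "f \<in> carrier G" "f \<notin> H" and f': "f' \<in> carrier G" "f' \<notin> H"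
    and ff: "f \<otimes> f \<noteq> \<one>" "(f \<otimes> f) \<otimes> (f \<otimes> f) = \<one>"
    and ff': "f' \<otimes> f' \<noteq> \<one>" "(f' \<otimes> f') \<otimes> (f' \<otimes> f') = \<one>"
    and fB: "\<And>b. b \<in> B \<Longrightarrow> cj f b = b" "\<And>b. b \<in> B \<Longrightarrow> cj f' b = b"
    and outer: "\<not> (\<exists>s\<in>S. \<forall>x\<in>S. cj f x = cj s x)"
  obtains v where "v \<in> H" "\<And>x. x \<in> B \<Longrightarrow> v \<otimes> x = x \<otimes> v"
    "cj v f = f' \<or> cj v f = (f' \<otimes> f') \<otimes> f'"
proof -
  have sH: "subgroup H G" using H normal_imp_subgroup by blast
  have Hc: "H \<subseteq> carrier G" using sH subgroup.subset by blast
  interpret HG: group "G\<lparr>carrier := H\<rparr>" by (rule subgroup_imp_group[OF sH])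
  interpret s: type_V "G\<lparr>carrier := H\<rparr>" A B S
    using s fin Hc finite_subset by unfold_locales auto
  define L where "L = A <#> B"
  have LH: "L = A <#>\<^bsub>G\<lparr>carrier := H\<rparr>\<^esub> B" by (simp add: L_def)
  note D = s.direct[folded LH]
  have sub: "subgroup S G" "subgroup L G" "subgroup A G" "subgroup B G"
    using incl_subgroup[OF sH] D(3,4) s.AB_facts(1,2) by simp_all
  have subc: "S \<subseteq> carrier G" "L \<subseteq> carrier G" "B \<subseteq> carrier G" using sub subgroup.subset by blast+
  have SH: "S \<subseteq> H" "L \<subseteq> H" using D(3,4) subgroup.subset by fastforce+
  have cardL: "card L = card A * card B" using s.semidirect(6) by (simp add: L_def)
  have cardH: "card H = card S * card L" "card H = card L * card S" using D(7) by (simp_all add: order_def)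
  have co: "coprime (card S) (card L)" "coprime (card L) (card S)"
    using s.coprime_120 unfolding cardL s.card_S by (simp_all add: coprime_commute)
  have nS: "S \<lhd> G" by (rule hall_subgroup_normal[OF fin H D(1) cardH(1) co(1)])
  have nL: "L \<lhd> G" by (rule hall_subgroup_normal[OF fin H D(2) cardH(2) co(2)])
  have SL: "x \<otimes> y = y \<otimes> x" if "x \<in> S" "y \<in> L" for x y using D(8)[OF that] by simp
  have iso: "G\<lparr>carrier := S\<rparr> \<cong> SL2_F5" using s.S by simp
  obtain e where "SL2_embedding G e S" by (rule SL2_embedding_exists[OF sub(1) iso])
  then interpret e: SL2_embedding G e S .
  define z where "z = e.z"
  have z: "z \<in> S" "z \<noteq> \<one>" "z \<otimes> z = \<one>" using e.z by (simp_all add: z_def)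
  have zc: "z \<in> carrier G" using z subc by blast
  have inv_z: "x = \<one> \<or> x = z" if x: "x \<in> H" "x \<otimes> x = \<one>" for x
  proof -
    have xc: "x \<in> carrier G" using x Hc by blast
    have "x [^] (2::nat) = \<one>" using x xc by (simp add: numeral_eq_Suc)
    then have "x [^] (120::nat) = \<one>" using pow_mult_eq_one[OF xc, of 2 60] by simp
    then have "x \<in> S" using s.S_eq x by (simp add: nat_pow_consistent[symmetric])
    then show ?thesis using e.involution x by (simp add: z_def)
  qed
  have zf: "f \<otimes> f = z" "f' \<otimes> f' = z"
    using inv_z[OF index_2_mult[OF fin H ord f f]] inv_z[OF index_2_mult[OF fin H ord f' f']] ff ff' by auto
  define h where "h = f' \<otimes> inv f"
  have "inv f \<notin> H" using f sH subgroup.m_inv_closed inv_inv by metis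
  then have hH: "h \<in> H" unfolding h_def using index_2_mult[OF fin H ord f'] f(1) by simp
  have hc: "h \<in> carrier G" using hH Hc by blast
  have f'h: "f' = h \<otimes> f" unfolding h_def using f(1) f'(1) by (simp add: m_assoc)
  have hB: "h \<otimes> b = b \<otimes> h" if b: "b \<in> B" for b
  proof -
    have bc: "b \<in> carrier G" using b subc by blast
    have "cj f' b = cj h (cj f b)" unfolding f'h using cj_cj[OF hc f(1) bc] by simp
    then have "cj h b = b" using fB b by simp
    then show ?thesis using cj_eq_iff_commute[OF hc bc] by simp
  qed
  obtain s x where sx: "s \<in> S" "x \<in> L" "h = s \<otimes> x"
    using hH D(5) by (auto simp: set_mult_def)
  have c: "s \<in> carrier G" "x \<in> carrier G" using sx subc by blast+
  have BL: "B \<subseteq> L"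
  proof
    fix b assume b: "b \<in> B"
    then have "\<one> \<otimes> b \<in> L" unfolding L_def set_mult_def using subgroup.one_closed[OF sub(3)] by blast
    then show "b \<in> L" using b subc by (simp add: subset_iff)
  qed
  have xB: "x \<otimes> b = b \<otimes> x" if b: "b \<in> B" for b
  proof -
    have bc: "b \<in> carrier G" using b subc by blast
    have sb: "s \<otimes> b = b \<otimes> s" using SL[OF sx(1)] b BL by blast
    have "s \<otimes> (x \<otimes> b) = h \<otimes> b" unfolding sx(3) using c bc by (simp add: m_assoc)
    also have "\<dots> = b \<otimes> h" by (rule hB[OF b])
    also have "\<dots> = (b \<otimes> s) \<otimes> x" unfolding sx(3) using c bc by (simp add: m_assoc)
    also have "\<dots> = s \<otimes> (b \<otimes> x)" unfolding sb[symmetric] using c bc by (simp add: m_assoc)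
    finally show ?thesis using c bc by simp
  qed
  have fs: "cj f s \<in> S" by (rule normal_cj[OF nS f(1) sx(1)])
  have fx: "cj f x \<in> L" by (rule normal_cj[OF nL f(1) sx(2)])
  have fc: "cj f s \<in> carrier G" "cj f x \<in> carrier G" using fs fx subc by blast+
  have "f' \<otimes> f' = h \<otimes> cj f h \<otimes> (f \<otimes> f)" unfolding f'h using hc f(1) by (simp add: word_simps)
  then have "z = h \<otimes> cj f h \<otimes> z" using zf by simp
  then have h1: "h \<otimes> cj f h = \<one>" using hc f(1) zc r_cancel_one' by (metis inv_closed m_closed)
  \<comment> \<open>S and L commute elementwise, so the relation splits into an S-part and an
    L-part: f inverts s and x separately.\<close>
  have "h \<otimes> cj f h = s \<otimes> (x \<otimes> cj f s) \<otimes> cj f x"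
    unfolding sx(3) cj_mult[OF f(1) c] using c fc by (simp add: m_assoc)
  also have "x \<otimes> cj f s = cj f s \<otimes> x" using SL[OF fs sx(2)] by simp
  finally have "(s \<otimes> cj f s) \<otimes> (x \<otimes> cj f x) = \<one> \<otimes> \<one>" using h1 c fc by (simp add: m_assoc)
  moreover have "s \<otimes> cj f s \<in> S" "x \<otimes> cj f x \<in> L"
    using sx fs fx sub subgroup.m_closed by metis+
  ultimately have s1: "s \<otimes> cj f s = \<one>" and x1: "x \<otimes> cj f x = \<one>"
    using decomp_unique[OF sub(1,2), of "s \<otimes> cj f s" "x \<otimes> cj f x" \<one> \<one>] D(6)
      subgroup.one_closed[OF sub(1)] subgroup.one_closed[OF sub(2)] by simp_all
  have "odd (card L)" using s.AB_facts(3,4) cardL by simp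
  then obtain i :: nat where i: "cj (x [^] i) f = x \<otimes> f"
    by (rule odd_inverted_conjugate[OF c(2) pow_card_subgroup[OF sub(2) sx(2)] _ f(1) x1])
  define y where "y = x [^] i"
  have yL: "y \<in> L" unfolding y_def by (induction i) (use sx(2) subgroup.one_closed[OF sub(2)] subgroup.m_closed[OF sub(2)] in auto)
  have yc: "y \<in> carrier G" using yL subc by blast
  have yB: "y \<otimes> b = b \<otimes> y" if "b \<in> B" for b
    unfolding y_def using pow_commute[OF c(2) _ xB[OF that]] that subc by blast
  \<comment> \<open>Since f^2 = z lies in S, the cosets S and S f form the subgroup generated by S
    and f, of order 240.\<close>
  define E where "E = S \<union> (\<lambda>u. u \<otimes> f) ` S"
  have fS: "f \<notin> S" using f SH by blast
  have "S \<inter> (\<lambda>u. u \<otimes> f) ` S = {}"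
  proof (rule ccontr)
    assume "S \<inter> (\<lambda>u. u \<otimes> f) ` S \<noteq> {}"
    then obtain u where u: "u \<in> S" "u \<otimes> f \<in> S" by blast
    then have "inv u \<otimes> (u \<otimes> f) \<in> S" using sub(1) subgroup.m_closed subgroup.m_inv_closed by metis
    then show False using u subc f(1) fS by (auto simp: inv_cancel_left)
  qed
  moreover have "card ((\<lambda>u. u \<otimes> f) ` S) = card S"
    by (rule card_image) (rule inj_on_subset[OF inj_on_multc[OF f(1)] subc(1)])
  moreover have finS: "finite S" using subc fin finite_subset by blast
  ultimately have cardE: "card E = 240" unfolding E_def using s.card_S by (simp add: card_Un_disjoint)
  have Ec: "E \<subseteq> carrier G" unfolding E_def using subc f by auto
  have E_mult: "u \<otimes> w \<in> E" if u: "u \<in> E" and w: "w \<in> E" for u w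
  proof -
    have cS: "t \<in> carrier G" if "t \<in> S" for t using that subc by blast
    consider "u \<in> S" "w \<in> S" | t where "u \<in> S" "t \<in> S" "w = t \<otimes> f" | r where "r \<in> S" "u = r \<otimes> f" "w \<in> S"
      | r t where "r \<in> S" "u = r \<otimes> f" "t \<in> S" "w = t \<otimes> f"
      using u w unfolding E_def by blast
    then show ?thesis
    proof cases
      case 1
      then show ?thesis using subgroup.m_closed[OF sub(1)] by (simp add: E_def)
    next
      case 2
      then have "u \<otimes> w = (u \<otimes> t) \<otimes> f" using 2(3) cS[OF 2(1)] cS[OF 2(2)] f(1) by (simp add: m_assoc)
      then show ?thesis using subgroup.m_closed[OF sub(1) 2(1,2)] by (auto simp: E_def)
    next
      case 3
      have "cj f w \<in> S" by (rule normal_cj[OF nS f(1) 3(3)])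
      moreover have "u \<otimes> w = (r \<otimes> cj f w) \<otimes> f" unfolding 3(2) using cS[OF 3(1)] cS[OF 3(3)] f(1) by (simp add: word_simps)
      ultimately show ?thesis using subgroup.m_closed[OF sub(1) 3(1)] by (auto simp: E_def)
    next
      case 4
      have ft: "cj f t \<in> S" by (rule normal_cj[OF nS f(1) 4(3)])
      have "u \<otimes> w = (r \<otimes> cj f t) \<otimes> (f \<otimes> f)" unfolding 4(2,4) using cS[OF 4(1)] cS[OF 4(3)] f(1) by (simp add: word_simps)
      then show ?thesis
        using subgroup.m_closed[OF sub(1) subgroup.m_closed[OF sub(1) 4(1) ft] z(1)] zf(1) by (simp add: E_def)
    qed
  qed
  have sE: "subgroup E G"
  proof (rule subgroupI[OF Ec _ _ E_mult])
    show "E \<noteq> {}" using z(1) by (auto simp: E_def)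
    show "inv u \<in> E" if u: "u \<in> E" for u
    proof -
      have uc: "u \<in> carrier G" using u Ec by blast
      have pw: "u [^] Suc k \<in> E" for k by (induction k) (use u uc E_mult in auto)
      have "ord u \<ge> 1" by (rule ord_ge_1[OF fin uc])
      then obtain k where k: "ord u = Suc k" by (cases "ord u") auto
      have "u [^] k \<otimes> u = \<one>" using pow_ord_eq_1[OF uc] unfolding k by simp
      then have "inv u = u [^] k" using inv_equality uc by simp
      moreover have "u [^] k \<in> E"
      proof (cases k)
        case 0
        then show ?thesis using subgroup.one_closed[OF sub(1)] by (simp add: E_def)
      qed (use pw in simp)
      ultimately show ?thesis by simp
    qed
  qed
  interpret E: group "G\<lparr>carrier := E\<rparr>" by (rule subgroup_imp_group[OF sE])
  have SE: "S \<subseteq> E" and sfE: "s \<otimes> f \<in> E" using sx(1) by (auto simp: E_def)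
  have "\<one> \<otimes> f \<in> E" using subgroup.one_closed[OF sub(1)] by (auto simp: E_def)
  then have fE: "f \<in> E" using f(1) by simp
  have sfS: "s \<otimes> f \<notin> S"
  proof
    assume "s \<otimes> f \<in> S"
    then have "inv s \<otimes> (s \<otimes> f) \<in> S" using sx(1) sub(1) subgroup.m_closed subgroup.m_inv_closed by metis
    then show False using c f(1) fS by (simp add: inv_cancel_left)
  qed
  have sfsf: "(s \<otimes> f) \<otimes> (s \<otimes> f) = z"
  proof -
    have "(s \<otimes> f) \<otimes> (s \<otimes> f) = (s \<otimes> cj f s) \<otimes> (f \<otimes> f)" using c f(1) by (simp add: word_simps)
    then show ?thesis using s1 zf zc by simp
  qed
  have invE: "inv\<^bsub>G\<lparr>carrier := E\<rparr>\<^esub> u = inv u" if "u \<in> E" for u using m_inv_consistent[OF sE that] .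
  have "\<exists>r\<in>S. r \<otimes>\<^bsub>G\<lparr>carrier := E\<rparr>\<^esub> f \<otimes>\<^bsub>G\<lparr>carrier := E\<rparr>\<^esub> inv\<^bsub>G\<lparr>carrier := E\<rparr>\<^esub> r = s \<otimes> f \<or>
    r \<otimes>\<^bsub>G\<lparr>carrier := E\<rparr>\<^esub> f \<otimes>\<^bsub>G\<lparr>carrier := E\<rparr>\<^esub> inv\<^bsub>G\<lparr>carrier := E\<rparr>\<^esub> r = z \<otimes>\<^bsub>G\<lparr>carrier := E\<rparr>\<^esub> (s \<otimes> f)"
  proof (rule E.SL2_outer_conjugate)
    show "S \<lhd> G\<lparr>carrier := E\<rparr>"
    proof (rule E.normal_invI)
      show "subgroup S (G\<lparr>carrier := E\<rparr>)" by (rule subgroup_incl[OF sub(1) sE SE])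
      show "u \<otimes>\<^bsub>G\<lparr>carrier := E\<rparr>\<^esub> w \<otimes>\<^bsub>G\<lparr>carrier := E\<rparr>\<^esub> inv\<^bsub>G\<lparr>carrier := E\<rparr>\<^esub> u \<in> S"
        if "u \<in> carrier (G\<lparr>carrier := E\<rparr>)" "w \<in> S" for u w
        using normal_cj[OF nS _ that(2)] that(1) invE Ec by auto
    qed
    show "\<not> (\<exists>s\<in>S. \<forall>x\<in>S. f \<otimes>\<^bsub>G\<lparr>carrier := E\<rparr>\<^esub> x \<otimes>\<^bsub>G\<lparr>carrier := E\<rparr>\<^esub> inv\<^bsub>G\<lparr>carrier := E\<rparr>\<^esub> f =
       s \<otimes>\<^bsub>G\<lparr>carrier := E\<rparr>\<^esub> x \<otimes>\<^bsub>G\<lparr>carrier := E\<rparr>\<^esub> inv\<^bsub>G\<lparr>carrier := E\<rparr>\<^esub> s)"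
      using outer invE fE SE by (simp add: subset_iff)
  qed (use cardE Ec fin finite_subset iso fE fS sfE sfS sfsf zf z in \<open>auto simp: order_def\<close>)
  then obtain r where r: "r \<in> S" "cj r f = s \<otimes> f \<or> cj r f = z \<otimes> (s \<otimes> f)" using invE SE by auto
  have rc: "r \<in> carrier G" using r subc by blast
  \<comment> \<open>y centralizes S and carries f to x f. Once r has carried f to s f up to z,
    conjugation by y inserts the missing x, and s x f = f'.\<close>
  have ysf: "cj y (u \<otimes> f) = u \<otimes> (x \<otimes> f)" if u: "u \<in> S" for u
  proof -
    have uc: "u \<in> carrier G" using u subc by blast
    have "cj y (u \<otimes> f) = cj y u \<otimes> cj y f" by (rule cj_mult[OF yc uc f(1)])
    moreover have "cj y u = u" using SL[OF u yL] cj_eq_iff_commute[OF yc uc] by simp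
    ultimately show ?thesis using i by (simp add: y_def)
  qed
  have "cj (y \<otimes> r) f = cj y (cj r f)" using cj_cj[OF yc rc f(1)] by simp
  moreover have "cj y (s \<otimes> f) = f'" unfolding ysf[OF sx(1)] f'h sx(3) using c f(1) by (simp add: m_assoc)
  moreover have "cj y (z \<otimes> (s \<otimes> f)) = z \<otimes> f'"
  proof -
    have "cj y (z \<otimes> (s \<otimes> f)) = cj y ((z \<otimes> s) \<otimes> f)" using c zc f(1) by (simp add: m_assoc)
    also have "\<dots> = (z \<otimes> s) \<otimes> (x \<otimes> f)" by (rule ysf[OF subgroup.m_closed[OF sub(1) z(1) sx(1)]])
    also have "\<dots> = z \<otimes> f'" unfolding f'h sx(3) using c zc f(1) by (simp add: m_assoc)
    finally show ?thesis .
  qed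
  ultimately have "cj (y \<otimes> r) f = f' \<or> cj (y \<otimes> r) f = (f' \<otimes> f') \<otimes> f'" using r(2) zf by metis
  moreover have "y \<otimes> r \<in> H" using yL r(1) SH subgroup.m_closed[OF sH] by blast
  moreover have "(y \<otimes> r) \<otimes> b = b \<otimes> (y \<otimes> r)" if b: "b \<in> B" for b
  proof -
    have bc: "b \<in> carrier G" using b subc by blast
    have "r \<otimes> b = b \<otimes> r" using SL[OF r(1)] b BL by blast
    then show ?thesis using yB[OF b] bc yc rc by (metis m_assoc)
  qed
  ultimately show ?thesis using that[of "y \<otimes> r"] by blast
qed

text \<open>S is generated by elements with fifth power 1 and \<open>A B\<close> has odd order, so
  both lie in every normal subgroup of index 2.\<close>

lemma type_VI_subset_index_2:
  assumes fin: "finite (carrier G)" and H: "subgroup H G"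
    and s: "structure_V (G\<lparr>carrier := H\<rparr>) A B S"
    and H': "H' \<lhd> G" "order G = 2 * card H'"
  shows "H \<subseteq> H'"
proof -
  have Hc: "H \<subseteq> carrier G" using H subgroup.subset by blast
  have sH': "subgroup H' G" using H' normal_imp_subgroup by blast
  interpret HG: group "G\<lparr>carrier := H\<rparr>" by (rule subgroup_imp_group[OF H])
  interpret s: type_V "G\<lparr>carrier := H\<rparr>" A B S
    using s fin Hc finite_subset by unfold_locales auto
  have sub: "subgroup S G" "subgroup (A <#> B) G"
    using incl_subgroup[OF H] s.direct(3,4) by simp_all
  have iso: "G\<lparr>carrier := S\<rparr> \<cong> SL2_F5" using s.S by simp
  obtain e where "SL2_embedding G e S" by (rule SL2_embedding_exists[OF sub(1) iso])
  then interpret e: SL2_embedding G e S .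
  have "S \<subseteq> H'"
  proof (rule e.generated[OF sH'])
    show "x \<in> H'" if x: "x \<in> S" "x [^] (5::nat) = \<one>" for x
      by (rule odd_order_mem_index_2[OF fin H' _ x(2)]) (use subgroup.mem_carrier[OF sub(1) x(1)] in simp_all)
  qed
  moreover have "A <#> B \<subseteq> H'"
  proof
    fix x assume x: "x \<in> A <#> B"
    have "odd (card (A <#> B))" using s.semidirect(6) s.AB_facts(3,4) by simp
    then show "x \<in> H'"
      by (rule odd_order_mem_index_2[OF fin H' subgroup.mem_carrier[OF sub(2) x] pow_card_subgroup[OF sub(2) x]])
  qed
  moreover have "H = S <#> (A <#> B)" using s.direct(5) by simp
  ultimately show ?thesis
    using subgroup.m_closed[OF sH'] unfolding set_mult_def[of G S] by blast
qed

lemma structure_VI_unique: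
  assumes fin: "finite (carrier G)" and s: "structure_VI G A B S \<Phi>" and t: "structure_VI G A' B' S' \<Phi>'"
  shows "(\<exists>g\<in>carrier G. conj_set G g A = A' \<and> conj_set G g B = B' \<and>
      conj_set G g S = S' \<and> conj_set G g \<Phi> = \<Phi>') \<and> A' = A \<and> S' = S"
proof -
  define H where "H = S <#> (A <#> B)"
  define H' where "H' = S' <#> (A' <#> B')"
  have s3: "structure_V (G\<lparr>carrier := H\<rparr>) A B S" and s4: "nonsplit_ext_by_2 G H"
    and s5: "subgroup \<Phi> G" "G\<lparr>carrier := \<Phi>\<rparr> \<cong> integer_mod_group 4" "(\<lambda>f. H #> f) ` \<Phi> = carrier (G Mod H)"
    and s6: "\<And>f. f \<in> \<Phi> \<Longrightarrow> ord f = 4 \<Longrightarrow> acts_trivially G f B"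
    using s unfolding structure_VI_def Let_def H_def[symmetric] by blast+
  have t3: "structure_V (G\<lparr>carrier := H'\<rparr>) A' B' S'" and t4: "nonsplit_ext_by_2 G H'"
    and t5: "subgroup \<Phi>' G" "G\<lparr>carrier := \<Phi>'\<rparr> \<cong> integer_mod_group 4" "(\<lambda>f. H' #> f) ` \<Phi>' = carrier (G Mod H')"
    and t6: "\<And>f. f \<in> \<Phi>' \<Longrightarrow> ord f = 4 \<Longrightarrow> acts_by_outer G f S' \<and> acts_trivially G f B'"
    using t unfolding structure_VI_def Let_def H'_def[symmetric] by blast+
  obtain f where f: "H \<lhd> G" "order G = 2 * card H" "f \<in> \<Phi>" "f \<in> carrier G" "f \<notin> H" "ord f = 4"
    "f \<otimes> f \<in> H" "f \<otimes> f \<noteq> \<one>" "(f \<otimes> f) \<otimes> (f \<otimes> f) = \<one>"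
    "card \<Phi> = 4" "\<And>x. x \<in> \<Phi> \<Longrightarrow> \<exists>i::nat. x = f [^] i"
    by (rule ext_by_2_generator[OF fin s4 s5]) blast
  obtain f' where f': "H' \<lhd> G" "order G = 2 * card H'" "f' \<in> \<Phi>'" "f' \<in> carrier G" "f' \<notin> H'" "ord f' = 4"
    "f' \<otimes> f' \<in> H'" "f' \<otimes> f' \<noteq> \<one>" "(f' \<otimes> f') \<otimes> (f' \<otimes> f') = \<one>"
    "card \<Phi>' = 4" "\<And>x. x \<in> \<Phi>' \<Longrightarrow> \<exists>i::nat. x = f' [^] i"
    by (rule ext_by_2_generator[OF fin t4 t5]) blast
  have sH: "subgroup H G" using f(1) normal_imp_subgroup by blast
  have Hc: "H \<subseteq> carrier G" "H' \<subseteq> carrier G" using f(1) f'(1) normal_imp_subgroup subgroup.subset by blast+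
  have HH': "H' = H"
    using index_2_subset_eq[OF fin type_VI_subset_index_2[OF fin sH s3 f'(1,2)] Hc(2) f(2) f'(2)] .
  interpret HG: group "G\<lparr>carrier := H\<rparr>" by (rule subgroup_imp_group[OF sH])
  have finH: "finite (carrier (G\<lparr>carrier := H\<rparr>))" using fin Hc finite_subset by auto
  interpret s: type_V "G\<lparr>carrier := H\<rparr>" A B S using s3 finH by unfold_locales
  interpret t: type_V "G\<lparr>carrier := H\<rparr>" A' B' S' using t3 finH HH' by unfold_locales auto
  note u = HG.structure_V_unique[OF finH s3 t3[unfolded HH']]
  obtain g where g: "g \<in> H" "conj_set G g A = A'" "conj_set G g B = B'" "conj_set G g S = S'"
    using u conj_set_consistent[OF sH] by auto
  have AS: "A' = A" "S' = S" using u by blast+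
  have gc: "g \<in> carrier G" using g Hc by blast
  have sub: "subgroup A G" "subgroup B G" "subgroup S G" "subgroup B' G" "subgroup S' G"
    using incl_subgroup[OF sH] s.AB_facts(1,2) s.direct(3) t.AB_facts(2) t.direct(3) by simp_all
  note subc = sub[THEN subgroup.subset]
  have act: "cj f b = b" if "b \<in> B" for b
    using s6[OF f(3,6)] that unfolding acts_trivially_def conj_map_def by auto
  have act': "cj f' b = b" if "b \<in> B'" for b
    using t6[OF f'(3,6)] that unfolding acts_trivially_def conj_map_def by auto
  have outer: "\<not> (\<exists>s\<in>S'. \<forall>x\<in>S'. cj f' x = cj s x)"
  proof
    assume "\<exists>s\<in>S'. \<forall>x\<in>S'. cj f' x = cj s x"
    then obtain r where r: "r \<in> S'" "\<And>x. x \<in> S' \<Longrightarrow> cj f' x = cj r x" by blast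
    have "conj_map G f' S' = conj_map (G\<lparr>carrier := S'\<rparr>) r (carrier (G\<lparr>carrier := S'\<rparr>))"
      unfolding conj_map_def using r m_inv_consistent[OF sub(5)] by (auto simp: restrict_def)
    then have "conj_map G f' S' \<in> inner_automorphisms (G\<lparr>carrier := S'\<rparr>)"
      unfolding inner_automorphisms_def using r(1) by auto
    then show False using t6[OF f'(3,6)] unfolding acts_by_outer_def by blast
  qed
  define f1 where "f1 = cj g f"
  have f1c: "f1 \<in> carrier G" using gc f by (simp add: f1_def)
  have f1H: "f1 \<notin> H" using normal_cj_iff[OF f(1) gc f(4)] f(5) by (simp add: f1_def)
  have f1f1: "f1 \<otimes> f1 \<noteq> \<one>" "(f1 \<otimes> f1) \<otimes> (f1 \<otimes> f1) = \<one>"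
    using cj_square[OF gc f(4)] cj_square[OF gc m_closed[OF f(4,4)]] cj_eq_one_iff[OF gc m_closed[OF f(4,4)]] f(8,9) gc
    by (simp_all add: f1_def)
  \<comment> \<open>The core lemma is applied from f' towards f1, because \<open>outer\<close>
    speaks of f'; the inverse of v then leads back.\<close>
  obtain v where v: "v \<in> H" "\<And>x. x \<in> B' \<Longrightarrow> v \<otimes> x = x \<otimes> v"
    "cj v f' = f1 \<or> cj v f' = (f1 \<otimes> f1) \<otimes> f1"
  proof (rule type_VI_core[OF fin f(1,2) t3[unfolded HH'] f'(4) _ f1c f1H f'(8,9) f1f1])
    show "f' \<notin> H" using f'(5) HH' by simp
    show "cj f1 b = b" if "b \<in> B'" for b
      unfolding f1_def by (rule cj_conj_set_fix[OF act f(4) gc subc(2)]) (use that g in simp_all)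
  qed (use act' outer in blast)+
  define w where "w = inv v"
  have wH: "w \<in> H" unfolding w_def using v(1) sH subgroup.m_inv_closed by metis
  have vc: "v \<in> carrier G" and wc: "w \<in> carrier G" using v wH Hc by blast+
  have "(f1 \<otimes> f1) \<otimes> f1 = inv f1" using f1f1(2) f1c inv_equality[of "(f1 \<otimes> f1) \<otimes> f1" f1] by (simp add: m_assoc)
  then have "cj v f' = f1 \<or> cj v f' = inv f1" using v(3) by simp
  moreover have "cj w (cj v f') = f'" unfolding w_def using vc f'(4) by (simp add: word_simps)
  ultimately have "cj w f1 = f' \<or> cj w (inv f1) = f'" by metis
  then have "cj w f1 = f' \<or> inv (cj w f1) = f'" using cj_inv[OF wc f1c] by simp
  then have "cj w f1 = f' \<or> cj w f1 = inv f'" using wc f1c by auto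
  then have w\<Phi>: "cj w f1 \<in> \<Phi>'" using f'(3) t5(1) subgroup.m_inv_closed by metis
  have wB: "w \<otimes> x = x \<otimes> w" if x: "x \<in> B'" for x
  proof -
    have xc: "x \<in> carrier G" using x subc by blast
    show ?thesis unfolding w_def using v(2)[OF x] vc xc
      by (metis inv_closed inv_solve_left inv_solve_right m_assoc m_closed)
  qed
  have comp: "conj_set G (w \<otimes> g) U = conj_set G w (conj_set G g U)" if "U \<subseteq> carrier G" for U
    using conj_set_conj_set[OF wc gc that] by simp
  have wn: "conj_set G w A' = A'" "conj_set G w S' = S'"
    using HG.conj_set_normal[OF t.normal_A, of w] HG.conj_set_normal[OF t.direct(1), of w] wH conj_set_consistent[OF sH]
    by simp_all
  have wBB: "conj_set G w B' = B'" by (rule conj_set_commuting[OF wc subc(4) wB])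
  have "cj (w \<otimes> g) f = cj w f1" unfolding f1_def using cj_cj[OF wc gc f(4)] by simp
  then have "cj (w \<otimes> g) f \<in> \<Phi>'" using w\<Phi> by simp
  then have "conj_set G (w \<otimes> g) \<Phi> = \<Phi>'"
    using conj_set_cyclic_4[OF fin m_closed[OF wc gc] f(4) s5(1) f(11) t5(1)] f(10) f'(10) by simp
  moreover have "conj_set G (w \<otimes> g) A = A'" "conj_set G (w \<otimes> g) B = B'" "conj_set G (w \<otimes> g) S = S'"
    using comp subc g wn wBB by simp_all
  ultimately show ?thesis using m_closed[OF wc gc] AS by blast
qed

end

section \<open>The types are pairwise distinct\<close>

text \<open>Phrased through exponents, so that isomorphisms preserve it at once.\<close>

definition odd_torsion :: "('a, 'b) monoid_scheme \<Rightarrow> 'a \<Rightarrow> bool" where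
  "odd_torsion G x \<longleftrightarrow> (\<exists>n::nat. odd n \<and> x [^]\<^bsub>G\<^esub> n = \<one>\<^bsub>G\<^esub>)"

definition two_torsion :: "('a, 'b) monoid_scheme \<Rightarrow> 'a \<Rightarrow> bool" where
  "two_torsion G x \<longleftrightarrow> (\<exists>n::nat. x [^]\<^bsub>G\<^esub> ((2::nat) ^ n) = \<one>\<^bsub>G\<^esub>)"

text \<open>In a finite group this means that there is a normal 2-complement.\<close>

definition odd_closed :: "('a, 'b) monoid_scheme \<Rightarrow> bool" where
  "odd_closed G \<longleftrightarrow> (\<forall>x\<in>carrier G. \<forall>y\<in>carrier G.
     odd_torsion G x \<longrightarrow> odd_torsion G y \<longrightarrow> odd_torsion G (x \<otimes>\<^bsub>G\<^esub> y))"

text \<open>Tests products of those 2-elements that are products of two odd-torsion elements. In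
  types III and IV such 2-elements all lie in Q8; in \<open>2A5\<close> two of them multiply to an
  element of order 5.\<close>

definition two_closed :: "('a, 'b) monoid_scheme \<Rightarrow> bool" where
  "two_closed G \<longleftrightarrow> (\<forall>a\<in>carrier G. \<forall>b\<in>carrier G. \<forall>c\<in>carrier G. \<forall>d\<in>carrier G.
     odd_torsion G a \<longrightarrow> odd_torsion G b \<longrightarrow> odd_torsion G c \<longrightarrow> odd_torsion G d \<longrightarrow>
     two_torsion G (a \<otimes>\<^bsub>G\<^esub> b) \<longrightarrow> two_torsion G (c \<otimes>\<^bsub>G\<^esub> d) \<longrightarrow>
     two_torsion G (a \<otimes>\<^bsub>G\<^esub> b \<otimes>\<^bsub>G\<^esub> (c \<otimes>\<^bsub>G\<^esub> d)))"

text \<open>The order of x is divisible by the full 2-part of |G|, so a power of x generates a Sylow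
  2-subgroup.\<close>

definition cyclic_sylow_2 :: "('a, 'b) monoid_scheme \<Rightarrow> bool" where
  "cyclic_sylow_2 G \<longleftrightarrow> (\<exists>x\<in>carrier G. \<exists>k m. order G = 2 ^ k * m \<and> odd m \<and>
     (\<forall>n::nat. x [^]\<^bsub>G\<^esub> n = \<one>\<^bsub>G\<^esub> \<longrightarrow> 2 ^ k dvd n))"

lemma iso_invariants:
  assumes G: "group G" and H: "group H" and iso: "G \<cong> H"
  shows "odd_closed G \<Longrightarrow> odd_closed H" "two_closed G \<Longrightarrow> two_closed H" "cyclic_sylow_2 G \<Longrightarrow> cyclic_sylow_2 H"
proof -
  interpret G: group G by (rule G)
  interpret H: group H by (rule H)
  obtain h where h: "h \<in> iso G H" using iso by (auto simp: is_iso_def)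
  interpret h: group_hom G H h
    using h by (simp add: group_hom_def group_hom_axioms_def iso_def G H)
  have inj: "inj_on h (carrier G)" and img: "h ` carrier G = carrier H" using h by (auto simp: iso_def bij_betw_def)
  have pow: "h x [^]\<^bsub>H\<^esub> n = \<one>\<^bsub>H\<^esub> \<longleftrightarrow> x [^]\<^bsub>G\<^esub> n = \<one>\<^bsub>G\<^esub>" if "x \<in> carrier G" for x and n :: nat
    using inj_on_eq_iff[OF inj, of "x [^]\<^bsub>G\<^esub> n" "\<one>\<^bsub>G\<^esub>"] h.hom_nat_pow[OF that, of n] that by simp
  have tor: "odd_torsion H (h x) \<longleftrightarrow> odd_torsion G x" "two_torsion H (h x) \<longleftrightarrow> two_torsion G x"
    if "x \<in> carrier G" for x
    using pow[OF that] by (simp_all add: odd_torsion_def two_torsion_def)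
  have ball: "(\<forall>y\<in>carrier H. P y) \<longleftrightarrow> (\<forall>x\<in>carrier G. P (h x))" for P
    unfolding img[symmetric] by simp
  show "odd_closed G \<Longrightarrow> odd_closed H"
    unfolding odd_closed_def ball using tor by (simp flip: h.hom_mult)
  show "two_closed G \<Longrightarrow> two_closed H"
    unfolding two_closed_def ball using tor by (simp flip: h.hom_mult)
  show "cyclic_sylow_2 G \<Longrightarrow> cyclic_sylow_2 H"
    unfolding cyclic_sylow_2_def using pow iso_same_card[OF iso] unfolding order_def by (metis h.hom_closed)
qed

context group
begin

lemma eq_one_of_coprime_powers:
  assumes "x \<in> carrier G" "x [^] (m::nat) = \<one>" "x [^] (n::nat) = \<one>" "coprime m n" shows "x = \<one>"
  using subgroup_pow_coprime[OF triv_subgroup assms(1) _ _ assms(4)] assms(2,3) by simp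

lemma odd_two_torsion:
  assumes "x \<in> carrier G" "odd_torsion G x" "two_torsion G x" shows "x = \<one>"
proof -
  obtain m where m: "odd m" "x [^] (m::nat) = \<one>" using assms(2) by (auto simp: odd_torsion_def)
  obtain n where n: "x [^] ((2::nat) ^ n) = \<one>" using assms(3) by (auto simp: two_torsion_def)
  show ?thesis by (rule eq_one_of_coprime_powers[OF assms(1) m(2) n]) (use m in simp)
qed

lemma finite_set_mult: "finite U \<Longrightarrow> finite V \<Longrightarrow> finite (U <#> V)"
  unfolding set_mult_def by simp

lemma finite_AB: assumes "AB_conditions G A B" shows "finite A" "finite B"
  using assms card.infinite unfolding AB_conditions_def by fastforce+

text \<open>\<open>A B\<close> is normal of odd order and 2-power index, so it contains every
  odd-torsion element.\<close>

lemma two_complement_odd_closed: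
  assumes AB: "AB_conditions G A B" and AK: "internal_semidirect G A (B <#> T)"
    and BT: "internal_direct (G\<lparr>carrier := B <#> T\<rparr>) B T" and T: "card T = 2 ^ k"
  shows "finite (carrier G)" "odd_closed G" "order G = 2 ^ k * (card A * card B)"
proof -
  note D = internal_semidirectD[OF AK] and E = internal_direct_subgroup[OF internal_semidirectD(3)[OF AK] BT]
  note F = AB_conditionsD[OF AB]
  have "finite T" using T by (metis card.infinite power_not_zero zero_neq_numeral)
  then show fin: "finite (carrier G)"
    using finite_AB[OF AB] unfolding D(4)[symmetric] by (intro finite_set_mult)
  show ord: "order G = 2 ^ k * (card A * card B)" using D(6) E(7) T by simp
  have subc: "A \<subseteq> carrier G" "B \<subseteq> carrier G" "T \<subseteq> carrier G" "B <#> T \<subseteq> carrier G"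
    using F(1,2) E(2) D(3) subgroup.subset by blast+
  have sM: "subgroup (A <#> B) G" by (rule mult_norm_subgroup[OF D(1) F(2)])
  have "A <#> B \<lhd> G"
  proof (rule normal_invI[OF sM])
    fix g x assume g: "g \<in> carrier G" and x: "x \<in> A <#> B"
    obtain a b where ab: "a \<in> A" "b \<in> B" "x = a \<otimes> b" using x by (auto simp: set_mult_def)
    have "g \<in> A <#> (B <#> T)" using g D(4) by simp
    then obtain a' r where r: "a' \<in> A" "r \<in> B <#> T" "g = a' \<otimes> r"
      unfolding set_mult_def[of G A] by blast
    have c: "a \<in> carrier G" "b \<in> carrier G" "a' \<in> carrier G" "r \<in> carrier G" using ab r subc by blast+
    interpret K: group "G\<lparr>carrier := B <#> T\<rparr>" by (rule subgroup_imp_group[OF D(3)])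
    have rb: "cj r b \<in> B" using K.normal_cj[OF E(5), of r b] r(2) ab(2) D(3) by simp
    \<comment> \<open>With g = a' r and b' = r b r^-1 in \<open>B\<close>, conjugation by a' changes
      b' only by the left factor a' (b' a'^-1 b'^-1), which lies in \<open>A\<close>.\<close>
    have "cj a' (cj r b) = (a' \<otimes> cj (cj r b) (inv a')) \<otimes> cj r b"
      using c by (simp add: word_simps)
    moreover have "cj (cj r b) (inv a') \<in> A"
      using normal_cj[OF D(1), of "cj r b" "inv a'"] c subgroup.m_inv_closed[OF F(1) r(1)] by simp
    moreover have "cj g a \<in> A" by (rule normal_cj[OF D(1) g ab(1)])
    ultimately have "cj g a \<otimes> (a' \<otimes> cj (cj r b) (inv a')) \<in> A"
      using r(1) subgroup.m_closed[OF F(1)] by simp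
    moreover have "cj g x = (cj g a \<otimes> (a' \<otimes> cj (cj r b) (inv a'))) \<otimes> cj r b"
      unfolding ab(3) r(3) using c by (simp add: word_simps)
    ultimately show "cj g x \<in> A <#> B" using rb unfolding set_mult_def by blast
  qed
  moreover have cM: "card (A <#> B) = card A * card B"
    using card_set_mult[OF F(1,2) subgroup_coprime_inter[OF F(1,2,5)]] .
  ultimately have odd_M: "x \<in> A <#> B" if "x \<in> carrier G" "odd_torsion G x" for x
    using that normal_mem_of_pow[OF _ fin, of "A <#> B" "2 ^ k" _ x] ord unfolding odd_torsion_def
    by (auto simp: mult.commute)
  show "odd_closed G"
    unfolding odd_closed_def
  proof (intro ballI impI)
    fix x y assume "x \<in> carrier G" "y \<in> carrier G" "odd_torsion G x" "odd_torsion G y"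
    then have "x \<otimes> y \<in> A <#> B" using odd_M subgroup.m_closed[OF sM] by blast
    then have "(x \<otimes> y) [^] (card A * card B) = \<one>" using pow_card_subgroup[OF sM] cM by metis
    then show "odd_torsion G (x \<otimes> y)" using F(3,4) unfolding odd_torsion_def by (metis even_mult_iff)
  qed
qed

lemma type_I_invariants:
  assumes s: "structure_I G A B T" shows "odd_closed G" "cyclic_sylow_2 G"
proof -
  obtain k where T: "subgroup T G" "cyclic_group (G\<lparr>carrier := T\<rparr>)" "card T = 2 ^ k"
    using s unfolding structure_I_def cyclic_p_subgroup_def by blast
  have d: "AB_conditions G A B" "internal_semidirect G A (B <#> T)" "internal_direct (G\<lparr>carrier := B <#> T\<rparr>) B T"
    using s unfolding structure_I_def by blast+
  note D = two_complement_odd_closed[OF d T(3)]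
  show "odd_closed G" by (rule D)
  obtain t where t: "t \<in> T" "T = range (\<lambda>n::int. t [^] n)" using cyclic_subgroup_elems[OF T(1,2)] by blast
  have tc: "t \<in> carrier G" using t T subgroup.mem_carrier by metis
  have "T = generate G {t}" using t(2) generate_pow[OF tc] by auto
  then have "ord t = 2 ^ k" using generate_pow_card[OF tc] T(3) by simp
  then have "\<forall>n::nat. t [^] n = \<one> \<longrightarrow> 2 ^ k dvd n" using pow_eq_id[OF tc] by simp
  moreover have "odd (card A * card B)" using AB_conditionsD(3,4)[OF d(1)] by simp
  ultimately show "cyclic_sylow_2 G" unfolding cyclic_sylow_2_def using D(3) tc by blast
qed

lemma type_II_invariants:
  assumes s: "structure_II G A B T" shows "odd_closed G" "\<not> cyclic_sylow_2 G"
proof -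
  have d: "AB_conditions G A B" "internal_semidirect G A (B <#> T)" "internal_direct (G\<lparr>carrier := B <#> T\<rparr>) B T"
    and T: "subgroup T G" "is_quaternionic (G\<lparr>carrier := T\<rparr>)"
    using s unfolding structure_II_def by blast+
  obtain k where k: "k \<ge> 3" "G\<lparr>carrier := T\<rparr> \<cong> quaternion_group k" using T(2) unfolding is_quaternionic_def by blast
  have cT: "card T = 2 ^ k" using iso_same_card[OF k(2)] card_quaternion_group[OF k(1)] by simp
  note D = two_complement_odd_closed[OF d cT]
  show "odd_closed G" by (rule D)
  have odd: "odd (card A * card B)" using AB_conditionsD(3,4)[OF d(1)] by simp
  have nonab: "\<exists>x\<in>T. \<exists>y\<in>T. x \<otimes> y \<noteq> y \<otimes> x"
  proof -
    let ?M = "quaternion_model (2 ^ (k - 2))"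
    have "G\<lparr>carrier := T\<rparr> \<cong> ?M" using iso_trans[OF k(2) quaternion_group_iso[OF k(1)]] .
    then obtain h where h: "h \<in> hom (G\<lparr>carrier := T\<rparr>) ?M" "h ` T = carrier ?M"
      by (auto simp: is_iso_def iso_def bij_betw_def)
    have "(2::int) ^ 1 \<le> 2 ^ (k - 2)" using k(1) by (intro power_increasing) auto
    then obtain x y where xy: "x \<in> carrier ?M" "y \<in> carrier ?M" "x \<otimes>\<^bsub>?M\<^esub> y \<noteq> y \<otimes>\<^bsub>?M\<^esub> x"
      using quaternion_model_nonabelian[of "2 ^ (k - 2)"] by auto
    obtain u v where uv: "u \<in> T" "v \<in> T" "x = h u" "y = h v" using xy(1,2) h(2) by (metis imageE)
    have "h (u \<otimes> v) = x \<otimes>\<^bsub>?M\<^esub> y" "h (v \<otimes> u) = y \<otimes>\<^bsub>?M\<^esub> x" using h(1) uv by (auto simp: hom_def)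
    then show ?thesis using xy(3) uv by metis
  qed
  show "\<not> cyclic_sylow_2 G"
  proof
    assume "cyclic_sylow_2 G"
    then obtain x i m where x: "x \<in> carrier G" "order G = 2 ^ i * m" "odd m"
      "\<And>n::nat. x [^] n = \<one> \<Longrightarrow> 2 ^ i dvd n"
      unfolding cyclic_sylow_2_def by blast
    have eq: "2 ^ i * m = 2 ^ k * (card A * card B)" using x(2) D(3) by simp
    have "2 ^ i dvd 2 ^ k * (card A * card B)" "2 ^ k dvd 2 ^ i * m" using eq by (metis dvd_triv_left)+
    then have "(2::nat) ^ i dvd 2 ^ k" "(2::nat) ^ k dvd 2 ^ i"
      using odd x(3) by (simp_all add: coprime_dvd_mult_left_iff)
    then have ik: "(2::nat) ^ i = 2 ^ k" by (rule dvd_antisym)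
    have "2 ^ i dvd ord x" using x(4)[OF pow_ord_eq_1[OF x(1)]] .
    then obtain j where j: "ord x = 2 ^ i * j" by blast
    have "ord x \<ge> 1" by (rule ord_ge_1[OF D(1) x(1)])
    then have j0: "j \<noteq> 0" using j by auto
    \<comment> \<open>Removing the cofactor j from the order of x leaves y of order exactly 2^i =
      |T|. A conjugate of y inside T then generates T, although T is nonabelian.\<close>
    define y where "y = x [^] j"
    have yc: "y \<in> carrier G" using x by (simp add: y_def)
    have oy: "ord y = 2 ^ i" unfolding y_def using ord_pow[OF x(1), of j] j j0 by simp
    have "y [^] ((2::nat) ^ i) = \<one>" using pow_ord_eq_1[OF yc] oy by simp
    then obtain g where g: "g \<in> carrier G" "cj g y \<in> T"
      by (rule sylow_conjugate_elem[OF D(1) two_is_prime_nat yc _ T(1), of _ "card A * card B"])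
        (use D(3) cT odd in auto)
    define w where "w = cj g y"
    have wc: "w \<in> carrier G" using g yc by (simp add: w_def)
    have "w [^] n = \<one> \<longleftrightarrow> ord y dvd n" for n
      unfolding w_def cj_pow[OF g(1) yc, symmetric] using cj_eq_one_iff[OF g(1)] pow_eq_id[OF yc] yc by simp
    then have "ord w = ord y" using ord_unique[OF wc] by blast
    then have "card (generate G {w}) = card T" using generate_pow_card[OF wc] oy ik cT by simp
    moreover have "generate G {w} \<subseteq> T" using generate_subgroup_incl[OF _ T(1)] g(2) by (simp add: w_def)
    moreover have "finite T" using D(1) T(1) subgroup.subset finite_subset by blast
    ultimately have "T = generate G {w}" using card_subset_eq by blast
    then have Tp: "T = {w [^] (n::int) |n. n \<in> UNIV}" using generate_pow[OF wc] by simp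
    obtain u v where uv: "u \<in> T" "v \<in> T" "u \<otimes> v \<noteq> v \<otimes> u" using nonab by blast
    obtain n n' :: int where "u = w [^] n" "v = w [^] n'" using uv(1,2) Tp by auto
    then have "u \<otimes> v = v \<otimes> u" using int_pow_mult[OF wc] by (metis add.commute)
    then show False using uv(3) by simp
  qed
qed

lemma type_III_finite:
  assumes s: "structure_III G A B Q \<Theta>" shows "finite (carrier G)"
proof -
  have sd: "internal_semidirect G (Q <#> A) (\<Theta> <#> B)" using s by (simp add: structure_III_def)
  have "card Q = 8"
    using s iso_same_card card_quaternion_group[of 3] unfolding structure_III_def by fastforce
  then have "finite Q" by (metis card.infinite zero_neq_numeral)
  moreover have "finite \<Theta>"
    using s unfolding structure_III_def cyclic_p_subgroup_def
    by (metis card.infinite power_not_zero zero_neq_numeral)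
  moreover have "finite A" "finite B" using finite_AB s unfolding structure_III_def by blast+
  ultimately show ?thesis
    unfolding internal_semidirectD(4)[OF sd, symmetric] by (intro finite_set_mult)
qed

lemma type_V_finite:
  assumes s: "structure_V G A B S" shows "finite (carrier G)"
proof -
  have sd: "internal_direct G S (A <#> B)" using s by (simp add: structure_V_def)
  have "card S = 120" using s iso_same_card card_SL2_F5 unfolding structure_V_def by fastforce
  then have "finite S" by (metis card.infinite zero_neq_numeral)
  moreover have "finite A" "finite B" using finite_AB s unfolding structure_V_def by blast+
  ultimately show ?thesis
    unfolding internal_directD(5)[OF sd, symmetric] by (intro finite_set_mult)
qed

text \<open>A nontrivial commutator of t in \<open>\<Theta>\<close> and q in Q lies in Q, hence is a
  2-element; but it is also the product of t and a conjugate of t^-1, both odd torsion. The subgroup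
  H makes this serve types III and IV.\<close>

lemma not_odd_closed_III:
  assumes H: "subgroup H G" and s: "structure_III (G\<lparr>carrier := H\<rparr>) A B Q \<Theta>"
  shows "\<not> odd_closed G"
proof
  assume oc: "odd_closed G"
  interpret HG: group "G\<lparr>carrier := H\<rparr>" by (rule subgroup_imp_group[OF H])
  interpret s: type_III "G\<lparr>carrier := H\<rparr>" A B Q \<Theta>
    using s HG.type_III_finite[OF s] by unfold_locales
  have sub: "subgroup \<Theta> G" "subgroup Q G"
    using incl_subgroup[OF H] s.\<Theta>B_facts(1) s.Q8(1) by simp_all
  obtain t where t: "t \<in> \<Theta>" "\<not> acts_trivially (G\<lparr>carrier := H\<rparr>) t Q"
    using s by (auto simp: structure_III_def)
  have tH: "t \<in> H" using t(1) s.\<Theta>B_facts(1) subgroup.subset by fastforce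
  have tc: "t \<in> carrier G" using t sub subgroup.mem_carrier by metis
  obtain q where q: "q \<in> Q" "cj t q \<noteq> q"
    using t(2) tH H unfolding acts_trivially_def conj_map_def by auto
  have qc: "q \<in> carrier G" using q sub subgroup.mem_carrier by metis
  obtain k where "card \<Theta> = 3 ^ k" by (rule s.card_\<Theta>)
  then have "odd (card \<Theta>)" by simp
  then have tor: "odd_torsion G x" if "x \<in> \<Theta>" for x
    unfolding odd_torsion_def using pow_card_subgroup[OF sub(1) that] by blast
  have it: "inv t \<in> \<Theta>" using t sub subgroup.m_inv_closed by metis
  have "cj q (inv t) [^] card \<Theta> = cj q (inv t [^] card \<Theta>)" using cj_pow[OF qc, of "inv t" "card \<Theta>"] tc by simp
  also have "\<dots> = \<one>" using pow_card_subgroup[OF sub(1) it] qc by simp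
  finally have "odd_torsion G (cj q (inv t))" unfolding odd_torsion_def using \<open>odd (card \<Theta>)\<close> by blast
  then have "odd_torsion G (t \<otimes> cj q (inv t))"
    using oc tor[OF t(1)] tc qc unfolding odd_closed_def by simp
  moreover have eq: "t \<otimes> cj q (inv t) = cj t q \<otimes> inv q" using tc qc by (simp add: word_simps)
  have "cj t q \<in> Q" using HG.normal_cj[OF s.normal_Q, of t q] tH q(1) H by simp
  then have inQ: "cj t q \<otimes> inv q \<in> Q" using q(1) sub subgroup.m_closed subgroup.m_inv_closed by metis
  then have "(cj t q \<otimes> inv q) [^] ((2::nat) ^ 3) = \<one>" using pow_card_subgroup[OF sub(2) inQ] s.card_Q by simp
  then have "two_torsion G (cj t q \<otimes> inv q)" unfolding two_torsion_def by blast
  ultimately have "cj t q \<otimes> inv q = \<one>" using odd_two_torsion eq tc qc by simp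
  then have "cj t q = q" using tc qc inv_equality[of "cj t q" "inv q"] by simp
  then show False using q by simp
qed

text \<open>Odd-torsion elements lie in H, so their products do, and the 2-elements of H are those
  of the normal subgroup Q.\<close>

lemma two_closed_III:
  assumes H: "subgroup H G" and s: "structure_III (G\<lparr>carrier := H\<rparr>) A B Q \<Theta>"
    and odd: "\<And>x. x \<in> carrier G \<Longrightarrow> odd_torsion G x \<Longrightarrow> x \<in> H"
  shows "two_closed G"
proof -
  interpret HG: group "G\<lparr>carrier := H\<rparr>" by (rule subgroup_imp_group[OF H])
  interpret s: type_III "G\<lparr>carrier := H\<rparr>" A B Q \<Theta>
    using s HG.type_III_finite[OF s] by unfold_locales
  have sQ: "subgroup Q G" using incl_subgroup[OF H] s.Q8(1) by simp
  have inQ: "x \<in> Q" if x: "x \<in> H" "two_torsion G x" for x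
  proof -
    obtain n where n: "x [^] ((2::nat) ^ n) = \<one>" using x(2) by (auto simp: two_torsion_def)
    have "odd (card \<Theta> * (card A * card B))"
      using s.coprime_Q\<Theta>(2) unfolding s.card_Q coprime_8_iff_odd .
    then show ?thesis
      using HG.normal_mem_of_pow[OF s.normal_Q s.fin, of "card \<Theta> * (card A * card B)" "2 ^ n" x] s.order_III x n
      by (simp add: nat_pow_consistent[symmetric])
  qed
  have "two_torsion G x" if "x \<in> Q" for x
    using pow_card_subgroup[OF sQ that] s.card_Q unfolding two_torsion_def by (intro exI[of _ 3]) simp
  then show ?thesis
    unfolding two_closed_def using odd inQ subgroup.m_closed[OF H] subgroup.m_closed[OF sQ] by meson
qed

lemma SL2_invariants:
  assumes S: "subgroup S G" and iso: "G\<lparr>carrier := S\<rparr> \<cong> SL2_F5"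
  shows "\<not> odd_closed G" "\<not> two_closed G"
proof -
  obtain e where "SL2_embedding G e S" by (rule SL2_embedding_exists[OF S iso])
  then interpret e: SL2_embedding G e S .
  obtain a b c d where abcd: "a \<in> S" "b \<in> S" "c \<in> S" "d \<in> S"
    "a [^] (5::nat) = \<one>" "b [^] (5::nat) = \<one>" "c [^] (5::nat) = \<one>" "d [^] (5::nat) = \<one>"
    "(a \<otimes> b) [^] (4::nat) = \<one>" "a \<otimes> b \<noteq> \<one>" "(c \<otimes> d) [^] (4::nat) = \<one>"
    "(a \<otimes> b \<otimes> (c \<otimes> d)) [^] (5::nat) = \<one>" "a \<otimes> b \<otimes> (c \<otimes> d) \<noteq> \<one>"
    using e.odd_order_products by blast
  have car: "a \<in> carrier G" "b \<in> carrier G" "c \<in> carrier G" "d \<in> carrier G"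
    using abcd S subgroup.mem_carrier by metis+
  have odd: "odd_torsion G x" if "x [^] (5::nat) = \<one>" for x
    unfolding odd_torsion_def using that by (intro exI[of _ 5]) simp
  have two: "two_torsion G x" if "x [^] (4::nat) = \<one>" for x
    unfolding two_torsion_def using that by (intro exI[of _ 2]) simp
  show "\<not> odd_closed G"
  proof
    assume "odd_closed G"
    then have "odd_torsion G (a \<otimes> b)" unfolding odd_closed_def using car odd abcd by blast
    then show False using odd_two_torsion[of "a \<otimes> b"] two abcd(9,10) car by simp
  qed
  show "\<not> two_closed G"
  proof
    assume "two_closed G"
    then have "two_torsion G (a \<otimes> b \<otimes> (c \<otimes> d))"
      unfolding two_closed_def using car odd[OF abcd(5)] odd[OF abcd(6)] odd[OF abcd(7)] odd[OF abcd(8)]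
        two[OF abcd(9)] two[OF abcd(11)] by blast
    then show False using odd_two_torsion odd[OF abcd(12)] abcd(13) car by simp
  qed
qed

lemma nonsplit_ext_order:
  assumes "nonsplit_ext_by_2 G H" shows "H \<lhd> G" "order G = 2 * card H"
proof -
  show H: "H \<lhd> G" using assms by (simp add: nonsplit_ext_by_2_def)
  have "G Mod H \<cong> integer_mod_group 2" using assms by (simp add: nonsplit_ext_by_2_def)
  then have "card (carrier (G Mod H)) = 2"
    using iso_same_card by (fastforce simp: carrier_integer_mod_group)
  then show "order G = 2 * card H"
    using lagrange[OF normal_imp_subgroup[OF H]] by (simp add: FactGroup_def)
qed

lemma type_III_invariants:
  assumes s: "structure_III G A B Q \<Theta>"
  shows "\<not> odd_closed G" "two_closed G" "\<not> 16 dvd order G"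
proof -
  have eq: "G\<lparr>carrier := carrier G\<rparr> = G" by simp
  show "\<not> odd_closed G" "two_closed G"
    using not_odd_closed_III[OF subgroup_self, unfolded eq, OF s] two_closed_III[OF subgroup_self, unfolded eq, OF s]
    by blast+
  interpret s: type_III G A B Q \<Theta> using s type_III_finite[OF s] by unfold_locales
  have "odd (card \<Theta> * (card A * card B))"
    using s.coprime_Q\<Theta>(2) unfolding s.card_Q coprime_8_iff_odd .
  moreover have "order G = 8 * (card \<Theta> * (card A * card B))" using s.order_III s.card_Q by simp
  ultimately show "\<not> 16 dvd order G" by presburger
qed

lemma type_IV_invariants:
  assumes s: "structure_IV G A B Q \<Theta> \<Phi>"
  shows "\<not> odd_closed G" "two_closed G" "16 dvd order G"
proof -
  define H where "H = (Q <#> A) <#> (\<Theta> <#> B)"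
  have s3: "structure_III (G\<lparr>carrier := H\<rparr>) A B Q \<Theta>" and s4: "nonsplit_ext_by_2 G H"
    using s unfolding structure_IV_def Let_def H_def[symmetric] by blast+
  note H = nonsplit_ext_order[OF s4]
  have sH: "subgroup H G" by (rule normal_imp_subgroup[OF H(1)])
  interpret HG: group "G\<lparr>carrier := H\<rparr>" by (rule subgroup_imp_group[OF sH])
  interpret s: type_III "G\<lparr>carrier := H\<rparr>" A B Q \<Theta>
    using s3 HG.type_III_finite[OF s3] by unfold_locales
  have cH: "card H = 8 * (card \<Theta> * (card A * card B))" using s.order_III s.card_Q by (simp add: order_def)
  then show "16 dvd order G" using H(2) by presburger
  have "finite H" using s.fin by simp
  moreover have "H \<noteq> {}" using subgroup.one_closed[OF sH] by blast
  ultimately have "order G > 0" using H(2) by (simp add: card_gt_0_iff)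
  then have fin: "finite (carrier G)" by (simp add: order_gt_0_iff_finite)
  show "\<not> odd_closed G" by (rule not_odd_closed_III[OF sH s3])
  show "two_closed G"
    by (rule two_closed_III[OF sH s3]) (use odd_order_mem_index_2[OF fin H] in \<open>auto simp: odd_torsion_def\<close>)
qed

lemma type_V_invariants:
  assumes s: "structure_V G A B S"
  shows "\<not> odd_closed G" "\<not> two_closed G" "\<not> 16 dvd order G"
proof -
  interpret s: type_V G A B S using s type_V_finite[OF s] by unfold_locales
  show "\<not> odd_closed G" "\<not> two_closed G" using SL2_invariants[OF s.direct(3) s.S] by blast+
  have "odd (card A * card B)" using s.AB_facts(3,4) by simp
  then show "\<not> 16 dvd order G" using s.order_V by presburger
qed

lemma type_VI_invariants:
  assumes s: "structure_VI G A B S \<Phi>"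
  shows "\<not> odd_closed G" "\<not> two_closed G" "16 dvd order G"
proof -
  define H where "H = S <#> (A <#> B)"
  have s3: "structure_V (G\<lparr>carrier := H\<rparr>) A B S" and s4: "nonsplit_ext_by_2 G H"
    using s unfolding structure_VI_def Let_def H_def[symmetric] by blast+
  note H = nonsplit_ext_order[OF s4]
  have sH: "subgroup H G" by (rule normal_imp_subgroup[OF H(1)])
  interpret HG: group "G\<lparr>carrier := H\<rparr>" by (rule subgroup_imp_group[OF sH])
  interpret s: type_V "G\<lparr>carrier := H\<rparr>" A B S using s3 HG.type_V_finite[OF s3] by unfold_locales
  have "card H = 120 * (card A * card B)" using s.order_V by (simp add: order_def)
  then show "16 dvd order G" using H(2) by presburger
  have "subgroup S G" using incl_subgroup[OF sH s.direct(3)] .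
  moreover have "G\<lparr>carrier := S\<rparr> \<cong> SL2_F5" using s.S by simp
  ultimately show "\<not> odd_closed G" "\<not> two_closed G" using SL2_invariants by blast+
qed

text \<open>A decision tree with the six types as leaves; the later tests are claimed only in the
  branch where they separate. Types III and V have order 8 times an odd number, and the extension by
  2 raises the 2-part to 16.\<close>

lemma has_type_invariants:
  assumes "has_type G i"
  shows "odd_closed G \<longleftrightarrow> i = Type_I \<or> i = Type_II"
    "odd_closed G \<Longrightarrow> cyclic_sylow_2 G \<longleftrightarrow> i = Type_I"
    "\<not> odd_closed G \<Longrightarrow> two_closed G \<longleftrightarrow> i = Type_III \<or> i = Type_IV"
    "\<not> odd_closed G \<Longrightarrow> 16 dvd order G \<longleftrightarrow> i = Type_IV \<or> i = Type_VI"
  using assms type_I_invariants type_II_invariants type_III_invariants type_IV_invariants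
    type_V_invariants type_VI_invariants
  by (cases i; fastforce)+

end

lemma has_type_iso:
  assumes G: "group G" and H: "group H" and iso: "G \<cong> H" and i: "has_type G i" and j: "has_type H j"
  shows "i = j"
proof -
  have sym: "H \<cong> G" by (rule group.iso_sym[OF G iso])
  have "odd_closed G \<longleftrightarrow> odd_closed H" "two_closed G \<longleftrightarrow> two_closed H" "cyclic_sylow_2 G \<longleftrightarrow> cyclic_sylow_2 H"
    using iso_invariants[OF G H iso] iso_invariants[OF H G sym] by blast+
  moreover have "order G = order H" using iso_same_card[OF iso] by (simp add: order_def)
  ultimately show ?thesis
    using group.has_type_invariants[OF G i] group.has_type_invariants[OF H j] by (cases i; cases j) auto
qed

section \<open>The uniqueness theorem\<close>

theorem theorem1p2:
  fixes G :: "('a, 'c) monoid_scheme" and G' :: "('b, 'd) monoid_scheme"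
  assumes "group G" and "group G'"
  shows "(\<forall>i j. i \<noteq> j \<and> has_type G i \<and> has_type G' j \<longrightarrow> \<not> G \<cong> G') \<and>
    (finite (carrier G) \<longrightarrow>
      (\<forall>A B T A' B' T'.
         structure_I G A B T \<and> structure_I G A' B' T' \<longrightarrow>
         (\<exists>g\<in>carrier G. conj_set G g A = A' \<and> conj_set G g B = B' \<and> conj_set G g T = T') \<and>
         A' = A) \<and>
      (\<forall>A B T A' B' T'.
         structure_II G A B T \<and> structure_II G A' B' T' \<longrightarrow>
         (\<exists>g\<in>carrier G. conj_set G g A = A' \<and> conj_set G g B = B' \<and> conj_set G g T = T') \<and>
         A' = A) \<and>
      (\<forall>A B Q \<Theta> A' B' Q' \<Theta>'.
         structure_III G A B Q \<Theta> \<and> structure_III G A' B' Q' \<Theta>' \<longrightarrow>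
         (\<exists>g\<in>carrier G. conj_set G g A = A' \<and> conj_set G g B = B' \<and>
            conj_set G g Q = Q' \<and> conj_set G g \<Theta> = \<Theta>') \<and>
         A' = A \<and> Q' = Q) \<and>
      (\<forall>A B Q \<Theta> \<Phi> A' B' Q' \<Theta>' \<Phi>'.
         structure_IV G A B Q \<Theta> \<Phi> \<and> structure_IV G A' B' Q' \<Theta>' \<Phi>' \<longrightarrow>
         (\<exists>g\<in>carrier G. conj_set G g A = A' \<and> conj_set G g B = B' \<and>
            conj_set G g Q = Q' \<and> conj_set G g \<Theta> = \<Theta>' \<and> conj_set G g \<Phi> = \<Phi>') \<and>
         A' = A \<and> Q' = Q) \<and>
      (\<forall>A B S A' B' S'.
         structure_V G A B S \<and> structure_V G A' B' S' \<longrightarrow>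
         (\<exists>g\<in>carrier G. conj_set G g A = A' \<and> conj_set G g B = B' \<and> conj_set G g S = S') \<and>
         A' = A \<and> S' = S) \<and>
      (\<forall>A B S \<Phi> A' B' S' \<Phi>'.
         structure_VI G A B S \<Phi> \<and> structure_VI G A' B' S' \<Phi>' \<longrightarrow>
         (\<exists>g\<in>carrier G. conj_set G g A = A' \<and> conj_set G g B = B' \<and>
            conj_set G g S = S' \<and> conj_set G g \<Phi> = \<Phi>') \<and>
         A' = A \<and> S' = S))"
proof (rule conjI, goal_cases)
  case 1
  show ?case using has_type_iso[OF assms] by blast
next
  case 2
  show ?case
    by (intro impI conjI; intro allI impI; elim conjE)
      (rule group.structure_I_unique[OF assms(1)] group.structure_II_unique[OF assms(1)]
        group.structure_III_unique[OF assms(1)] group.structure_IV_unique[OF assms(1)]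
        group.structure_V_unique[OF assms(1)] group.structure_VI_unique[OF assms(1)]; assumption)+
qed

end
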